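(* Let $\mu$ be a self-similar measure of finite type satisfying the positive row property (setting described in the context), with support $K$. Then there exists a truly essential point $x\in K$ at which the local dimension exists and $\dim_{loc}\mu(x)=\dim_H K$.
   Context: Setting. Let $m\ge 1$ be an integer, $0<\varrho<1$, $0=d_0<d_1<\dots<d_m$, $S_j(x)=\varrho x+d_j$ for $j\in\mathcal A=\{0,\dots,m\}$. Let $K$ be the unique non-empty compact set with $K=\bigcup_j S_j(K)$; the $d_j$ are scaled so that the convex hull of $K$ is $[0,1]$ ($K$ need not be an interval). For $\sigma=(j_1,\dots,j_n)\in\mathcal A^n$ put $S_\sigma=S_{j_1}\circ\cdots\circ S_{j_n}$. The IFS is of finite type if there is a finite set $F\subseteq\mathbb R$ such that for every $n\ge1$ and all $\sigma,\sigma'\in\mathcal A^n$, either $\varrho^{-n}|S_\sigma(0)-S_{\sigma'}(0)|>1$ or $\varrho^{-n}(S_\sigma(0)-S_{\sigma'}(0))\in F$. Given $p_j>0$ with $\sum_j p_j=1$, $\mu$ is the unique Borel probability measure with $\mu=\sum_j p_j\,\mu\circ S_j^{-1}$; its support is $K$; $\mu$ is called of finite type if the IFS is. Local dimension. $\dim_{loc}\mu(x)=\lim_{r\to0^+}\frac{\log\mu([x-r,x+r])}{\log r}$ when the limit exists. Net intervals. Let $h_1<\dots<h_{s_n}$ be the elements of $\{S_\sigma(0),S_\sigma(1):\sigma\in\mathcal A^n\}$; $\mathcal F_n$ (net intervals of level $n$) is the set of $[h_j,h_{j+1}]$ with $(h_j,h_{j+1})\cap K\ne\emptyset$; $\mathcal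 F_0=\{[0,1]\}$. Each $\Delta\in\mathcal F_n$, $n\ge1$, is contained in a unique $\widehat\Delta\in\mathcal F_{n-1}$, its parent ($\Delta$ is a child of $\widehat\Delta$). For $\Delta=[a,b]\in\mathcal F_n$: normalized length $\ell_n(\Delta)=\varrho^{-n}(b-a)$; neighbour set $V_n(\Delta)$ = the increasingly ordered tuple of the distinct elements of $\{\varrho^{-n}(a-S_\sigma(0)):\sigma\in\mathcal A^n,\ \Delta\subseteq S_\sigma[0,1]\}$; $r_n(\Delta)$ = position of $\Delta$, from left to right, among the level $n$ net intervals with the same parent and the same normalized length. The characteristic vector is $\mathcal C_n(\Delta)=(\ell_n(\Delta),V_n(\Delta),r_n(\Delta))$. Under finite type the set $\Omega$ of characteristic vectors is finite, and the characteristic vectors of the children of $\Delta$ depend only on that of $\Delta$, so one may speak of children of characteristic vectors. An admissible path is a finite sequence of characteristic vectors, each being the parent of the next. A loop class is a non-empty $\Omega'\subseteq\Omega$ such that any $\alpha,\beta\in\Omega'$ are joined by an admissible path from $\alpha$ to $\beta$ inside $\Omega'$; it is an essential class if in addition all children of elements of $\Omega'$ are in $\Omega'$. There is exactly one essential class $\Omega_0$ (known). A net interval is essential if its characteristic vector is in $\Omega_0$. Truly essential points. $x\in K$ is a boundary point if it is an endpoint of a net interval of some level. If $x$ is an endpoint of $\Delta_n(x)\in\mathcal F_n$, the other net interval $\Delta_n'(x)$ is the level $n$ net interval on the other side of $x$ having $x$ as an endpoint (the empty set if there is none). $x$ is a boundary essential point if for some $n$ it is an endpoint of $\Delta_n(x)\in\mathcal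 F_n$ and both $\Delta_n(x)$ and $\Delta_n'(x)$ are essential (the empty set counting as essential). $x$ is an interior essential point if it is not a boundary point and it lies in the interior of some essential net interval. $x$ is truly essential if it is boundary essential or interior essential. Positive row property. For a level $n$ net interval $\Delta=[a,b]$ with parent $\widehat\Delta=[c,d]$, $V_n(\Delta)=(a_1,\dots,a_N)$, $V_{n-1}(\widehat\Delta)=(c_1,\dots,c_M)$, the primitive transition matrix $T(\mathcal C_{n-1}(\widehat\Delta),\mathcal C_n(\Delta))$ is the $M\times N$ matrix whose $jk$ entry is $p_\ell$ if there are $\ell\in\mathcal A$ and $\sigma\in\mathcal A^{n-1}$ with $S_\sigma(0)=c-\varrho^{n-1}c_j$ and $S_{\sigma\ell}(0)=a-\varrho^n a_k$, and $0$ otherwise (it depends only on the two characteristic vectors). The positive row property: every primitive transition matrix $T(\alpha,\beta)$ with $\alpha,\beta\in\Omega_0$ has a non-zero entry in each row. *)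

theory Defs
  imports "HOL-Probability.Probability"
begin

section \<open>Hausdorff dimension\<close>

text \<open>The contribution of a covering set of diameter \<open>t\<close> is \<open>t powr s\<close>, with the usual
  conventions that the empty set contributes \<open>0\<close> and that every non-empty set contributes \<open>1\<close>
  when \<open>s = 0\<close> (whereas \<open>0 powr 0 = 0\<close>).\<close>

definition hausdorff_gauge :: "real \<Rightarrow> 'a::metric_space set \<Rightarrow> ennreal" where
  "hausdorff_gauge s U =
     (if U = {} then 0 else if s = 0 then 1 else ennreal (diameter U powr s))"

definition hausdorff_premeasure :: "real \<Rightarrow> real \<Rightarrow> 'a::metric_space set \<Rightarrow> ennreal" where
  "hausdorff_premeasure s \<delta> A =
     (INF U \<in> {U :: nat \<Rightarrow> 'a set. A \<subseteq> (\<Union>i. U i) \<and> (\<forall>i. bounded (U i) \<and> diameter (U i) \<le> \<delta>)}.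
        \<Sum>i. hausdorff_gauge s (U i))"

definition hausdorff_measure :: "real \<Rightarrow> 'a::metric_space set \<Rightarrow> ennreal" where
  "hausdorff_measure s A = (SUP \<delta> \<in> {0<..}. hausdorff_premeasure s \<delta> A)"

definition hausdorff_dim :: "'a::metric_space set \<Rightarrow> ereal" where
  "hausdorff_dim A = (INF s \<in> {s. 0 \<le> s \<and> hausdorff_measure s A = 0}. ereal s)"


section \<open>Local dimension\<close>

text \<open>Only meaningful for \<open>x\<close> in the support of \<open>\<mu>\<close>, since \<open>ln 0 = 0\<close>.\<close>

definition has_local_dim :: "real measure \<Rightarrow> real \<Rightarrow> real \<Rightarrow> bool" where
  "has_local_dim \<mu> x D \<longleftrightarrow>
     ((\<lambda>r. ln (measure \<mu> {x - r..x + r}) / ln r) \<longlongrightarrow> D) (at_right 0)"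


section \<open>Equicontractive iterated function systems on the line\<close>

type_synonym char_vec = "real \<times> real list \<times> nat"

context
  fixes m :: nat and \<rho> :: real and d :: "nat \<Rightarrow> real"
begin

definition ifs_map :: "nat \<Rightarrow> real \<Rightarrow> real" where
  "ifs_map j x = \<rho> * x + d j"

primrec word_map :: "nat list \<Rightarrow> real \<Rightarrow> real" where
  "word_map [] = id"
| "word_map (j # \<sigma>) = ifs_map j \<circ> word_map \<sigma>"

definition ifs_words :: "nat \<Rightarrow> nat list set" where
  "ifs_words n = {\<sigma>. length \<sigma> = n \<and> set \<sigma> \<subseteq> {..m}}"

definition ifs_attractor :: "real set \<Rightarrow> bool" where
  "ifs_attractor K \<longleftrightarrow> K \<noteq> {} \<and> compact K \<and> K = (\<Union>j\<in>{..m}. ifs_map j ` K)"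

definition ifs_finite_type :: bool where
  "ifs_finite_type \<longleftrightarrow>
     (\<exists>F :: real set. finite F \<and>
        (\<forall>n\<ge>1. \<forall>\<sigma>\<in>ifs_words n. \<forall>\<tau>\<in>ifs_words n.
           \<bar>word_map \<sigma> 0 - word_map \<tau> 0\<bar> / \<rho> ^ n > 1 \<or>
           (word_map \<sigma> 0 - word_map \<tau> 0) / \<rho> ^ n \<in> F))"

definition self_similar_measure :: "(nat \<Rightarrow> real) \<Rightarrow> real measure \<Rightarrow> bool" where
  "self_similar_measure p \<mu> \<longleftrightarrow>
     prob_space \<mu> \<and> sets \<mu> = sets borel \<and>
     (\<forall>A\<in>sets borel. measure \<mu> A = (\<Sum>j\<le>m. p j * measure (distr \<mu> borel (ifs_map j)) A))"

definition level_points :: "nat \<Rightarrow> real set" where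
  "level_points n = (\<Union>\<sigma>\<in>ifs_words n. {word_map \<sigma> 0, word_map \<sigma> 1})"

end

subsection \<open>Net intervals and characteristic vectors\<close>

text \<open>The interval \<open>{a..b}\<close> is represented by the pair \<open>(a, b)\<close>. One and the same interval can be a
  net interval of several levels, with different characteristic vectors, so every notion
  concerning a net interval also takes its level \<open>n\<close>.\<close>

context
  fixes m :: nat and \<rho> :: real and d :: "nat \<Rightarrow> real" and K :: "real set"
begin

definition net_intervals :: "nat \<Rightarrow> (real \<times> real) set" where
  "net_intervals n =
     (if n = 0 then {(0, 1)}
      else {(a, b). a \<in> level_points m \<rho> d n \<and> b \<in> level_points m \<rho> d n \<and> a < b \<and>
                    {a<..<b} \<inter> level_points m \<rho> d n = {} \<and> {a<..<b} \<inter> K \<noteq> {}})"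

definition net_child :: "nat \<Rightarrow> real \<times> real \<Rightarrow> real \<times> real \<Rightarrow> bool" where
  "net_child n P \<Delta> \<longleftrightarrow>
     P \<in> net_intervals n \<and> \<Delta> \<in> net_intervals (Suc n) \<and> {fst \<Delta>..snd \<Delta>} \<subseteq> {fst P..snd P}"

definition norm_length :: "nat \<Rightarrow> real \<times> real \<Rightarrow> real" where
  "norm_length n \<Delta> = (snd \<Delta> - fst \<Delta>) / \<rho> ^ n"

definition neighbours :: "nat \<Rightarrow> real \<times> real \<Rightarrow> real list" where
  "neighbours n \<Delta> =
     sorted_list_of_set
       {(fst \<Delta> - word_map \<rho> d \<sigma> 0) / \<rho> ^ n | \<sigma>.
          \<sigma> \<in> ifs_words m n \<and> {fst \<Delta>..snd \<Delta>} \<subseteq> word_map \<rho> d \<sigma> ` {0..1}}"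

definition sibling_position :: "nat \<Rightarrow> real \<times> real \<Rightarrow> nat" where
  "sibling_position n \<Delta> =
     (case n of
        0 \<Rightarrow> 1
      | Suc k \<Rightarrow> card {\<Delta>'. (\<exists>P. net_child k P \<Delta> \<and> net_child k P \<Delta>') \<and>
                           norm_length n \<Delta>' = norm_length n \<Delta> \<and> fst \<Delta>' \<le> fst \<Delta>})"

definition char_vector :: "nat \<Rightarrow> real \<times> real \<Rightarrow> char_vec" where
  "char_vector n \<Delta> = (norm_length n \<Delta>, neighbours n \<Delta>, sibling_position n \<Delta>)"

definition char_vectors :: "char_vec set" where
  "char_vectors = {char_vector n \<Delta> | n \<Delta>. \<Delta> \<in> net_intervals n}"

definition char_child :: "char_vec \<Rightarrow> char_vec \<Rightarrow> bool" where
  "char_child \<alpha> \<beta> \<longleftrightarrow>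
     (\<exists>n P \<Delta>. net_child n P \<Delta> \<and> char_vector n P = \<alpha> \<and> char_vector (Suc n) \<Delta> = \<beta>)"

definition admissible_path :: "char_vec list \<Rightarrow> bool" where
  "admissible_path \<gamma> \<longleftrightarrow> \<gamma> \<noteq> [] \<and> set \<gamma> \<subseteq> char_vectors \<and> successively char_child \<gamma>"

definition loop_class :: "char_vec set \<Rightarrow> bool" where
  "loop_class L \<longleftrightarrow>
     L \<noteq> {} \<and> L \<subseteq> char_vectors \<and>
     (\<forall>\<alpha>\<in>L. \<forall>\<beta>\<in>L. \<exists>\<gamma>. admissible_path \<gamma> \<and> hd \<gamma> = \<alpha> \<and> last \<gamma> = \<beta> \<and> set \<gamma> \<subseteq> L)"

definition is_essential_class :: "char_vec set \<Rightarrow> bool" where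
  "is_essential_class L \<longleftrightarrow>
     loop_class L \<and> (\<forall>\<alpha>\<in>L. \<forall>\<beta>. char_child \<alpha> \<beta> \<longrightarrow> \<beta> \<in> L)"

text \<open>Under finite type there is exactly one essential class.\<close>

definition essential_class :: "char_vec set" where
  "essential_class = (THE L. is_essential_class L)"

definition essential_net_interval :: "nat \<Rightarrow> real \<times> real \<Rightarrow> bool" where
  "essential_net_interval n \<Delta> \<longleftrightarrow>
     \<Delta> \<in> net_intervals n \<and> char_vector n \<Delta> \<in> essential_class"


subsection \<open>Truly essential points\<close>

definition boundary_point :: "real \<Rightarrow> bool" where
  "boundary_point x \<longleftrightarrow> x \<in> K \<and> (\<exists>n. \<exists>\<Delta>\<in>net_intervals n. x = fst \<Delta> \<or> x = snd \<Delta>)"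

text \<open>At most one level \<open>n\<close> net interval \<open>\<Delta>'\<close> lies on the other side of \<open>x\<close>; the bounded
  quantifier over \<open>\<Delta>'\<close> imposes no condition when there is none.\<close>

definition boundary_essential :: "real \<Rightarrow> bool" where
  "boundary_essential x \<longleftrightarrow> x \<in> K \<and>
     (\<exists>n. \<exists>\<Delta>\<in>net_intervals n. (x = fst \<Delta> \<or> x = snd \<Delta>) \<and> essential_net_interval n \<Delta> \<and>
        (\<forall>\<Delta>'\<in>net_intervals n.
           (x = fst \<Delta> \<and> x = snd \<Delta>') \<or> (x = snd \<Delta> \<and> x = fst \<Delta>')
             \<longrightarrow> essential_net_interval n \<Delta>'))"

definition interior_essential :: "real \<Rightarrow> bool" where
  "interior_essential x \<longleftrightarrow> x \<in> K \<and> \<not> boundary_point x \<and>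
     (\<exists>n \<Delta>. essential_net_interval n \<Delta> \<and> x \<in> {fst \<Delta><..<snd \<Delta>})"

definition truly_essential :: "real \<Rightarrow> bool" where
  "truly_essential x \<longleftrightarrow> boundary_essential x \<or> interior_essential x"


subsection \<open>Transition matrices\<close>

text \<open>The matrix of the pair \<open>P\<close> (level \<open>n\<close>), \<open>\<Delta>\<close> (level \<open>n + 1\<close>), indexed from \<open>0\<close>. The letter \<open>l\<close>
  is unique when it exists, because \<open>d\<close> is injective on the alphabet.\<close>

definition transition_matrix ::
    "(nat \<Rightarrow> real) \<Rightarrow> nat \<Rightarrow> real \<times> real \<Rightarrow> real \<times> real \<Rightarrow> nat \<Rightarrow> nat \<Rightarrow> real" where
  "transition_matrix p n P \<Delta> j k =
     (let letter = (\<lambda>l. l \<le> m \<and>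
            (\<exists>\<sigma>\<in>ifs_words m n.
               word_map \<rho> d \<sigma> 0 = fst P - \<rho> ^ n * (neighbours n P ! j) \<and>
               word_map \<rho> d (\<sigma> @ [l]) 0 = fst \<Delta> - \<rho> ^ Suc n * (neighbours (Suc n) \<Delta> ! k)))
      in if \<exists>l. letter l then p (THE l. letter l) else 0)"

text \<open>The matrix depends only on the characteristic vectors of \<open>P\<close> and \<open>\<Delta>\<close>, so the matrices
  \<open>T(\<alpha>, \<beta>)\<close> with \<open>\<alpha>\<close>, \<open>\<beta>\<close> essential are exactly those ranged over here.\<close>

definition positive_row_property :: "(nat \<Rightarrow> real) \<Rightarrow> bool" where
  "positive_row_property p \<longleftrightarrow>
     (\<forall>n P \<Delta>. net_child n P \<Delta> \<and> char_vector n P \<in> essential_class \<and>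
               char_vector (Suc n) \<Delta> \<in> essential_class \<longrightarrow>
        (\<forall>j < length (neighbours n P). \<exists>k < length (neighbours (Suc n) \<Delta>).
           transition_matrix p n P \<Delta> j k \<noteq> 0))"

end

end

theory Submission
  imports Defs
begin

text \<open>Two cylinders of the same level have the same map iff they have the same left endpoint; let
  \<open>f \<sigma>\<close> be the total weight of all words with the map of \<open>\<sigma>\<close>. Maximality arguments, possible because
  finite type bounds the number of cylinders meeting a given one, yield a word \<open>\<theta>\<close> such that
  \<open>f (\<omega> \<theta> \<eta>)\<close> is comparable to \<open>f (\<omega> \<theta>) f (\<theta> \<eta>)\<close>, and such that \<open>f (\<omega> \<theta>)\<close> is comparable to the measure
  of a ball of radius comparable to \<open>\<rho> ^ |\<omega> \<theta>|\<close> around any point coded by \<open>\<omega> \<theta> \<theta>\<close>.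
  The number of distinct maps of level \<open>n\<close> lies between \<open>exp (h n)\<close> and \<open>L exp (h n)\<close>, where
  \<open>h = - dim K ln \<rho>\<close>. By pigeonhole there are blocks \<open>\<theta> \<eta> \<theta>\<close> with \<open>|\<eta>| = n\<close> whose weight is at least,
  and others whose weight is at most, a constant times \<open>exp (- h n)\<close>. Concatenating blocks of
  slowly growing length, always choosing the kind that corrects the deviation accumulated so far, keeps
  \<open>ln f + h n\<close> of lower order than \<open>n\<close>, so the resulting point has local dimension \<open>dim K\<close>.
  Starting inside an essential net interval makes it truly essential.\<close>

text \<open>Concatenation gives \<open>f \<sigma> * f \<tau> \<le> f (\<sigma> @ \<tau>)\<close>;
  the obstacle is the converse. A word with the map of \<open>\<sigma> @ \<tau>\<close> may pass, at
  level \<open>length \<sigma>\<close>, through another cylinder overlapping that of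
  \<open>\<sigma>\<close>, whose weight is unrelated to \<open>f \<sigma>\<close>. The word
  \<open>\<theta>\<close> controls such detours from both sides: its first part makes them copies,
  under the prefix, of finitely many fixed ones; by its end every detour that will ever rejoin has
  already done so, and its weight is counted in \<open>f (\<omega> @ \<theta>)\<close> up to a fixed
  factor. Averaging bounds a heavy block only from below and a light one only from above; on the
  other side a trivial bound leaves an error linear in the block length. Steering by the sign of the
  accumulated deviation keeps these errors from adding up: with middle parts of length
  \<open>N\<close> in block \<open>N\<close>, the deviation after \<open>N\<close> blocks is O(N)
  while the total length is of order \<open>N^2\<close>. Consecutive scales differ by O(N) levels,
  so interpolating between them costs no more.\<close>

lemma card_le_mult_card_image:
  assumes "finite A" and "\<And>w. w \<in> g ` A \<Longrightarrow> card {a \<in> A. g a = w} \<le> L"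
  shows "card A \<le> L * card (g ` A)"
proof -
  have "card A = (\<Sum>w\<in>g ` A. \<Sum>a | a \<in> A \<and> g a = w. 1)"
    unfolding card_eq_sum by (rule sum.image_gen[OF assms(1)])
  also have "\<dots> = (\<Sum>w\<in>g ` A. card {a \<in> A. g a = w})" by simp
  also have "\<dots> \<le> (\<Sum>w\<in>g ` A. L)" by (intro sum_mono assms(2))
  finally show ?thesis by (simp add: mult.commute)
qed

section \<open>Words and their affine maps\<close>

lemma word_map_eq: "word_map \<rho> d \<sigma> x = \<rho> ^ length \<sigma> * x + word_map \<rho> d \<sigma> 0"
proof (induction \<sigma>)
  case (Cons j \<sigma>)
  then show ?case by (simp add: ifs_map_def algebra_simps)
qed simp

lemma word_map_append: "word_map \<rho> d (\<sigma> @ \<tau>) x = word_map \<rho> d \<sigma> (word_map \<rho> d \<tau> x)"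
  by (induction \<sigma>) auto

lemma word_map_append_0:
  "word_map \<rho> d (\<sigma> @ \<tau>) 0 = word_map \<rho> d \<sigma> 0 + \<rho> ^ length \<sigma> * word_map \<rho> d \<tau> 0"
  unfolding word_map_append using word_map_eq[of \<rho> d \<sigma> "word_map \<rho> d \<tau> 0"] by simp

lemma finite_ifs_words: "finite (ifs_words m n)"
  unfolding ifs_words_def using finite_lists_length_eq[of "{..m}" n] by (simp add: conj_commute)

lemma ifs_words_0: "ifs_words m 0 = {[]}"
  by (auto simp: ifs_words_def)

lemma append_in_ifs_words:
  "\<sigma> \<in> ifs_words m a \<Longrightarrow> \<tau> \<in> ifs_words m b \<Longrightarrow> \<sigma> @ \<tau> \<in> ifs_words m (a + b)"
  by (auto simp: ifs_words_def)

lemma bij_betw_append_ifs_words: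
  "bij_betw (\<lambda>(\<sigma>, \<tau>). \<sigma> @ \<tau>) (ifs_words m a \<times> ifs_words m b) (ifs_words m (a + b))"
proof (rule bij_betwI[where g = "\<lambda>\<sigma>. (take a \<sigma>, drop a \<sigma>)"])
  show "(\<lambda>\<sigma>. (take a \<sigma>, drop a \<sigma>)) \<in> ifs_words m (a + b) \<rightarrow> ifs_words m a \<times> ifs_words m b"
    using set_take_subset set_drop_subset by (fastforce simp: ifs_words_def)
qed (auto simp: ifs_words_def)

lemma sum_ifs_words_add:
  fixes g :: "nat list \<Rightarrow> 'b::comm_monoid_add"
  shows "(\<Sum>\<tau>\<in>ifs_words m (a + b). g \<tau>) = (\<Sum>\<sigma>\<in>ifs_words m a. \<Sum>\<tau>\<in>ifs_words m b. g (\<sigma> @ \<tau>))"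
  using sum.reindex_bij_betw[OF bij_betw_append_ifs_words[of m a b], of g]
  by (simp add: sum.cartesian_product case_prod_unfold)

lemma sum_ifs_words_Suc:
  fixes g :: "nat list \<Rightarrow> 'b::comm_monoid_add"
  shows "(\<Sum>\<tau>\<in>ifs_words m (Suc n). g \<tau>) = (\<Sum>\<tau>\<in>ifs_words m n. \<Sum>j\<le>m. g (\<tau> @ [j]))"
proof -
  have "ifs_words m 1 = (\<lambda>j. [j]) ` {..m}"
    by (auto simp: ifs_words_def length_Suc_conv)
  then show ?thesis
    unfolding Suc_eq_plus1 sum_ifs_words_add by (simp add: sum.reindex inj_on_def del: One_nat_def)
qed

lemma ifs_words_add_split:
  assumes "\<tau> \<in> ifs_words m (a + b)"
  obtains \<sigma> \<upsilon> where "\<sigma> \<in> ifs_words m a" "\<upsilon> \<in> ifs_words m b" "\<tau> = \<sigma> @ \<upsilon>"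
proof (rule that)
  show "take a \<tau> \<in> ifs_words m a" "drop a \<tau> \<in> ifs_words m b"
    using assms set_take_subset[of a \<tau>] set_drop_subset[of a \<tau>] by (auto simp: ifs_words_def)
qed simp

lemma successively_imp_rtranclp: "\<gamma> \<noteq> [] \<Longrightarrow> successively R \<gamma> \<Longrightarrow> R\<^sup>*\<^sup>* (hd \<gamma>) (last \<gamma>)"
proof (induction \<gamma>)
  case (Cons x \<gamma>)
  then show ?case
    by (cases \<gamma>) (auto intro: converse_rtranclp_into_rtranclp)
qed simp

lemma rtranclp_imp_successively:
  "R\<^sup>*\<^sup>* x y \<Longrightarrow> \<exists>\<gamma>. \<gamma> \<noteq> [] \<and> successively R \<gamma> \<and> hd \<gamma> = x \<and> last \<gamma> = y \<and> (\<forall>z\<in>set \<gamma>. R\<^sup>*\<^sup>* x z)"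
proof (induction rule: rtranclp_induct)
  case base
  show ?case by (intro exI[of _ "[x]"]) auto
next
  case (step y z)
  then obtain \<gamma> where \<gamma>: "\<gamma> \<noteq> []" "successively R \<gamma>" "hd \<gamma> = x" "last \<gamma> = y" "\<forall>w\<in>set \<gamma>. R\<^sup>*\<^sup>* x w"
    by blast
  then have "successively R (\<gamma> @ [z])" using step.hyps by (auto simp: successively_append_iff)
  with \<gamma> step.hyps show ?case
    by (intro exI[of _ "\<gamma> @ [z]"]) (auto intro: rtranclp.rtrancl_into_rtrancl)
qed

section \<open>The attractor and its cylinders\<close>

locale finite_type_ifs =
  fixes m :: nat and \<rho> :: real and d :: "nat \<Rightarrow> real" and K :: "real set"
  assumes rho_pos: "0 < \<rho>" and rho_less_1: "\<rho> < 1"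
    and d_0: "d 0 = 0" and d_mono: "strict_mono_on {..m} d"
    and attractor: "ifs_attractor m \<rho> d K" and hull: "convex hull K = {0..1}"
    and finite_type: "ifs_finite_type m \<rho> d"
begin

abbreviation W :: "nat \<Rightarrow> nat list set" where "W n \<equiv> ifs_words m n"
abbreviation c :: "nat list \<Rightarrow> real" where "c \<sigma> \<equiv> word_map \<rho> d \<sigma> 0"
abbreviation E :: "nat \<Rightarrow> real set" where "E n \<equiv> level_points m \<rho> d n"

lemma W_length: "\<sigma> \<in> W n \<Longrightarrow> length \<sigma> = n"
  by (simp add: ifs_words_def)

lemma K_subset: "K \<subseteq> {0..1}"
  using hull hull_subset[of K convex] by simp

lemma compact_K: "compact K" and K_ne: "K \<noteq> {}"
  and K_eq: "K = (\<Union>j\<in>{..m}. ifs_map \<rho> d j ` K)"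
  using attractor by (auto simp: ifs_attractor_def)

lemma zero_in_K: "0 \<in> K"
proof -
  obtain a where a: "a \<in> K" "\<And>t. t \<in> K \<Longrightarrow> a \<le> t"
    using compact_attains_inf[OF compact_K K_ne] by blast
  have "K \<subseteq> {a..1}" using a(2) K_subset by auto
  then have "convex hull K \<subseteq> {a..1}" by (intro hull_minimal) auto
  with hull have "a \<le> 0" by auto
  with a(1) K_subset show ?thesis by force
qed

lemma one_in_K: "1 \<in> K"
proof -
  obtain a where a: "a \<in> K" "\<And>t. t \<in> K \<Longrightarrow> t \<le> a"
    using compact_attains_sup[OF compact_K K_ne] by blast
  have "K \<subseteq> {0..a}" using a(2) K_subset by auto
  then have "convex hull K \<subseteq> {0..a}" by (intro hull_minimal) auto
  with hull have "1 \<le> a" by auto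
  with a(1) K_subset show ?thesis by force
qed

lemma d_le: "j \<le> m \<Longrightarrow> d j \<le> d m"
  using strict_mono_onD[OF d_mono, of j m] by (cases "j = m") auto

lemma d_nonneg: "j \<le> m \<Longrightarrow> 0 \<le> d j"
  using strict_mono_onD[OF d_mono, of 0 j] d_0 by (cases "j = 0") auto

text \<open>The scaling of the convex hull to \<open>{0..1}\<close> amounts to \<open>1\<close>
  being the fixed point of the last map: the largest point of \<open>K\<close> can only come from
  the largest translation.\<close>

lemma d_m: "d m = 1 - \<rho>"
proof (rule antisym)
  have "ifs_map \<rho> d m 1 \<in> K" using one_in_K K_eq by blast
  then show "d m \<le> 1 - \<rho>" using K_subset by (force simp: ifs_map_def)
  obtain j y where j: "j \<le> m" "y \<in> K" "1 = \<rho> * y + d j"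
    using one_in_K K_eq by (force simp: ifs_map_def)
  have "\<rho> * y \<le> \<rho> * 1" using j(2) K_subset rho_pos by (intro mult_left_mono) auto
  with j(3) d_le[OF j(1)] show "1 - \<rho> \<le> d m" by simp
qed

lemma c_bounds: "set \<sigma> \<subseteq> {..m} \<Longrightarrow> 0 \<le> c \<sigma> \<and> c \<sigma> + \<rho> ^ length \<sigma> \<le> 1"
proof (induction \<sigma>)
  case (Cons j \<sigma>)
  then have j: "0 \<le> d j" "d j \<le> 1 - \<rho>" and IH: "0 \<le> c \<sigma>" "c \<sigma> + \<rho> ^ length \<sigma> \<le> 1"
    using d_nonneg d_le d_m by force+
  have "0 \<le> \<rho> * c \<sigma>" using IH rho_pos by simp
  moreover have "\<rho> * (c \<sigma> + \<rho> ^ length \<sigma>) \<le> \<rho> * 1"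
    using IH rho_pos by (intro mult_left_mono) auto
  ultimately show ?case using j by (simp add: ifs_map_def algebra_simps)
qed simp

lemma c_W: "\<sigma> \<in> W n \<Longrightarrow> 0 \<le> c \<sigma> \<and> c \<sigma> + \<rho> ^ n \<le> 1"
  using c_bounds by (auto simp: ifs_words_def)

lemma c_W_01: "\<sigma> \<in> W n \<Longrightarrow> 0 \<le> c \<sigma> \<and> c \<sigma> \<le> 1"
  using c_W[of \<sigma> n] rho_pos by (smt (verit) zero_less_power)

lemma word_map_K: "set \<sigma> \<subseteq> {..m} \<Longrightarrow> y \<in> K \<Longrightarrow> word_map \<rho> d \<sigma> y \<in> K"
proof (induction \<sigma>)
  case (Cons j \<sigma>)
  then have "word_map \<rho> d \<sigma> y \<in> K" "j \<le> m" by auto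
  then show ?case using K_eq by auto
qed simp

lemma word_map_W_K: "\<sigma> \<in> W n \<Longrightarrow> y \<in> K \<Longrightarrow> c \<sigma> + \<rho> ^ n * y \<in> K"
  using word_map_K[of \<sigma> y] word_map_eq[of \<rho> d \<sigma> y] by (auto simp: ifs_words_def add.commute)

lemma K_decompose: "x \<in> K \<Longrightarrow> \<exists>\<sigma>\<in>W n. \<exists>y\<in>K. x = c \<sigma> + \<rho> ^ n * y"
proof (induction n arbitrary: x)
  case 0
  then show ?case by (auto simp: ifs_words_0)
next
  case (Suc n)
  obtain j y where j: "j \<le> m" "y \<in> K" "x = \<rho> * y + d j"
    using Suc.prems K_eq by (force simp: ifs_map_def)
  obtain \<sigma> z where z: "\<sigma> \<in> W n" "z \<in> K" "y = c \<sigma> + \<rho> ^ n * z"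
    using Suc.IH[OF j(2)] by blast
  have "j # \<sigma> \<in> W (Suc n)" using j z by (auto simp: ifs_words_def)
  moreover have "x = c (j # \<sigma>) + \<rho> ^ Suc n * z"
    using j z by (simp add: ifs_map_def algebra_simps)
  ultimately show ?case using z(2) by blast
qed

section \<open>Left endpoints of cylinders\<close>

definition pts :: "nat \<Rightarrow> real set" where "pts n = c ` W n"

lemma ptsI: "\<sigma> \<in> W n \<Longrightarrow> c \<sigma> \<in> pts n"
  by (simp add: pts_def)

lemma ptsE:
  assumes "y \<in> pts n"
  obtains \<sigma> where "\<sigma> \<in> W n" "y = c \<sigma>"
  using assms unfolding pts_def by blast

lemma pts_01: "y \<in> pts n \<Longrightarrow> 0 \<le> y \<and> y \<le> 1"
  using c_W_01 by (auto elim: ptsE)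

lemma pts_0: "pts 0 = {0}"
  by (simp add: pts_def ifs_words_0)

lemma pts_K: "y \<in> pts n \<Longrightarrow> y \<in> K"
  using word_map_W_K[OF _ zero_in_K] by (auto elim!: ptsE)

lemma finite_pts: "finite (pts n)"
  unfolding pts_def by (intro finite_imageI finite_ifs_words)

lemma zeros_in_W: "replicate n 0 \<in> W n"
  by (auto simp: ifs_words_def)

lemma pts_ne: "pts n \<noteq> {}"
  using zeros_in_W by (auto simp: pts_def)

lemma pts_add: "pts (a + b) = (\<lambda>(y, z). y + \<rho> ^ a * z) ` (pts a \<times> pts b)"
proof (intro equalityI subsetI)
  fix x assume "x \<in> pts (a + b)"
  then obtain \<tau> where \<tau>: "\<tau> \<in> W (a + b)" "x = c \<tau>" by (rule ptsE)
  from \<tau>(1) obtain \<sigma> \<upsilon> where s: "\<sigma> \<in> W a" "\<upsilon> \<in> W b" "\<tau> = \<sigma> @ \<upsilon>"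
    by (rule ifs_words_add_split)
  then show "x \<in> (\<lambda>(y, z). y + \<rho> ^ a * z) ` (pts a \<times> pts b)"
    using \<tau>(2) by (intro image_eqI[where x = "(c \<sigma>, c \<upsilon>)"]) (auto simp: word_map_append_0 W_length ptsI)
next
  fix x assume "x \<in> (\<lambda>(y, z). y + \<rho> ^ a * z) ` (pts a \<times> pts b)"
  then obtain \<sigma> \<upsilon> where s: "\<sigma> \<in> W a" "\<upsilon> \<in> W b" "x = c \<sigma> + \<rho> ^ a * c \<upsilon>"
    by (auto elim!: ptsE)
  then have "x = c (\<sigma> @ \<upsilon>)" by (simp add: word_map_append_0 W_length)
  with append_in_ifs_words[OF s(1,2)] show "x \<in> pts (a + b)" by (simp add: ptsI)
qed

text \<open>Finite type enters only through this constant, a bound, uniform in the level, on the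
  number of distinct cylinders whose left endpoints lie within one cylinder length of each
  other.\<close>

definition L :: nat where
  "L = (SOME L. L \<ge> 1 \<and> (\<forall>n A. A \<subseteq> pts n \<and> (\<forall>y\<in>A. \<forall>z\<in>A. \<bar>y - z\<bar> \<le> \<rho> ^ n) \<longrightarrow> card A \<le> L))"

lemma L_props:
  "L \<ge> 1 \<and> (\<forall>n A. A \<subseteq> pts n \<and> (\<forall>y\<in>A. \<forall>z\<in>A. \<bar>y - z\<bar> \<le> \<rho> ^ n) \<longrightarrow> card A \<le> L)"
proof -
  obtain F :: "real set" where F: "finite F"
    "\<And>n \<sigma> \<tau>. n \<ge> 1 \<Longrightarrow> \<sigma> \<in> W n \<Longrightarrow> \<tau> \<in> W n \<Longrightarrow>
      \<bar>c \<sigma> - c \<tau>\<bar> / \<rho> ^ n > 1 \<or> (c \<sigma> - c \<tau>) / \<rho> ^ n \<in> F"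
    using finite_type unfolding ifs_finite_type_def by metis
  \<comment> \<open>The extra \<open>1\<close> covers level \<open>0\<close>, about which the finite
    type condition says nothing, and makes the bound at least \<open>1\<close> even when
    \<open>F\<close> is empty.\<close>
  have "card A \<le> card F + 1" if A: "A \<subseteq> pts n" "\<forall>y\<in>A. \<forall>z\<in>A. \<bar>y - z\<bar> \<le> \<rho> ^ n" for n A
  proof (cases "n = 0 \<or> A = {}")
    case True
    then have "A \<subseteq> {0}" using A by (auto simp: pts_0)
    then have "card A \<le> card {0::real}" by (intro card_mono) auto
    then show ?thesis by simp
  next
    case False
    then obtain z where z: "z \<in> A" by blast
    have "(y - z) / \<rho> ^ n \<in> F" if y: "y \<in> A" for y
    proof -
      obtain \<sigma> \<tau> where "\<sigma> \<in> W n" "\<tau> \<in> W n" "y = c \<sigma>" "z = c \<tau>"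
        using A(1) z y by (meson ptsE subsetD)
      moreover have "\<bar>y - z\<bar> / \<rho> ^ n \<le> 1" using A(2) z y rho_pos by simp
      ultimately show ?thesis using F(2)[of n \<sigma> \<tau>] False by auto
    qed
    then have "(\<lambda>y. (y - z) / \<rho> ^ n) ` A \<subseteq> F" by auto
    moreover have "inj_on (\<lambda>y. (y - z) / \<rho> ^ n) A" using rho_pos by (auto simp: inj_on_def)
    ultimately have "card A \<le> card F" using F(1) card_inj_on_le by blast
    then show ?thesis by simp
  qed
  then have "\<exists>L::nat. L \<ge> 1 \<and>
      (\<forall>n A. A \<subseteq> pts n \<and> (\<forall>y\<in>A. \<forall>z\<in>A. \<bar>y - z\<bar> \<le> \<rho> ^ n) \<longrightarrow> card A \<le> L)"
    by (intro exI[of _ "card F + 1"]) auto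
  then show ?thesis unfolding L_def by (rule someI_ex)
qed

lemma L_ge_1: "L \<ge> 1"
  using L_props by (rule conjunct1)

lemma card_close_pts:
  assumes "A \<subseteq> pts n" and "\<And>y z. y \<in> A \<Longrightarrow> z \<in> A \<Longrightarrow> \<bar>y - z\<bar> \<le> \<rho> ^ n"
  shows "card A \<le> L"
  by (rule conjunct2[OF L_props, rule_format]) (use assms in auto)


subsection \<open>Growth of the number of cylinders\<close>

lemma pts_addE:
  assumes "w \<in> pts (a + b)"
  obtains y z where "y \<in> pts a" "z \<in> pts b" "w = y + \<rho> ^ a * z"
proof -
  from assms obtain x where x: "x \<in> pts a \<times> pts b" "w = (\<lambda>(y, z). y + \<rho> ^ a * z) x"
    unfolding pts_add by (elim imageE)
  show thesis by (rule that[of "fst x" "snd x"]) (use x in \<open>auto simp: case_prod_unfold\<close>)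
qed

definition M :: "nat \<Rightarrow> nat" where "M n = card (pts n)"

lemma M_pos: "M n \<ge> 1"
  unfolding M_def using finite_pts pts_ne by (metis One_nat_def Suc_leI card_gt_0_iff)

lemma M_0: "M 0 = 1"
  by (simp add: M_def pts_0)

lemma M_add_le: "M (a + b) \<le> M a * M b"
proof -
  have "card (pts (a + b)) \<le> card (pts a \<times> pts b)"
    unfolding pts_add by (intro card_image_le finite_cartesian_product finite_pts)
  then show ?thesis by (simp add: M_def card_cartesian_product)
qed

text \<open>A point \<open>w\<close> of level \<open>a + b\<close> has at most \<open>L\<close>
  decompositions: the level \<open>a\<close> component determines the other one and lies in the
  interval of length \<open>\<rho> ^ a\<close> ending at \<open>w\<close>.\<close>

lemma M_add_ge: "M a * M b \<le> L * M (a + b)"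
proof -
  let ?g = "\<lambda>(y, z). y + \<rho> ^ a * z"
  have "card (pts a \<times> pts b) \<le> L * card (?g ` (pts a \<times> pts b))"
  proof (rule card_le_mult_card_image)
    show "finite (pts a \<times> pts b)" by (intro finite_cartesian_product finite_pts)
    fix w
    let ?A = "{x \<in> pts a \<times> pts b. ?g x = w}"
    have inj: "inj_on fst ?A" using rho_pos by (auto simp: inj_on_def)
    have "card (fst ` ?A) \<le> L"
    proof (rule card_close_pts)
      show "fst ` ?A \<subseteq> pts a" by auto
      have near: "w - \<rho> ^ a \<le> y \<and> y \<le> w" if y: "y \<in> fst ` ?A" for y
      proof -
        obtain x where x: "x \<in> ?A" "y = fst x" using y by (elim imageE)
        define z where "z = snd x"
        have z: "z \<in> pts b" "y + \<rho> ^ a * z = w"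
          using x by (auto simp: z_def case_prod_unfold)
        have "0 \<le> z" "z \<le> 1" using z(1) pts_01 by blast+
        then have "0 \<le> \<rho> ^ a * z" "\<rho> ^ a * z \<le> \<rho> ^ a" using rho_pos
          by (auto simp: mult_left_le)
        then show ?thesis using z(2) by simp
      qed
      show "\<bar>y - z\<bar> \<le> \<rho> ^ a" if "y \<in> fst ` ?A" "z \<in> fst ` ?A" for y z
        using near[OF that(1)] near[OF that(2)] by linarith
    qed
    then show "card ?A \<le> L" using card_image[OF inj] by simp
  qed
  then show ?thesis by (simp add: M_def pts_add card_cartesian_product)
qed

lemma M_mult_le: "M (n * k) \<le> M n ^ k"
proof (induction k)
  case (Suc k)
  have "M (n * Suc k) \<le> M n * M (n * k)" using M_add_le[of n "n * k"] by simp
  also have "\<dots> \<le> M n * M n ^ k" using Suc by simp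
  finally show ?case by simp
qed (simp add: M_0)

lemma M_mult_ge: "M n ^ k \<le> L ^ k * M (n * k)"
proof (induction k)
  case (Suc k)
  have "M n ^ Suc k \<le> L ^ k * (M n * M (n * k))" using Suc by simp
  also have "\<dots> \<le> L ^ k * (L * M (n * Suc k))" using M_add_ge[of n "n * k"] by simp
  finally show ?case by (simp add: mult.assoc mult.left_commute)
qed (simp add: M_0)

text \<open>Since \<open>ln (M n)\<close> is subadditive in \<open>n\<close>, Fekete's lemma
  identifies this infimum with the limit, the exponential growth rate of the number of distinct
  maps. Taking the infimum as definition makes the lower bound on \<open>M n\<close>
  immediate.\<close>

definition h :: real where "h = (INF n\<in>{1..}. ln (real (M n)) / real n)"

lemma bdd_below_M: "bdd_below ((\<lambda>n. ln (real (M n)) / real n) ` {1..})"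
  using M_pos by (intro bdd_belowI2[where m = 0]) (simp add: divide_nonneg_nonneg)

lemma h_nonneg: "h \<ge> 0"
  unfolding h_def using M_pos by (intro cINF_greatest) (auto simp: divide_nonneg_nonneg)

lemma M_ge_exp: "exp (h * n) \<le> M n"
proof (cases "n = 0")
  case False
  have "h \<le> ln (real (M n)) / real n"
    unfolding h_def using bdd_below_M by (rule cINF_lower) (use False in simp)
  then have "h * n \<le> ln (real (M n))" using False by (simp add: field_simps)
  then have "exp (h * n) \<le> exp (ln (real (M n)))" by simp
  also have "\<dots> = M n" using M_pos[of n] by (intro exp_ln) simp
  finally show ?thesis .
qed (simp add: M_0)

text \<open>Compare through level \<open>n * j\<close>: \<open>M n ^ j\<close> is at most
  \<open>L ^ j\<close> times its size, which in turn is at most \<open>M j ^ n\<close>. Hence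
  \<open>(ln (M n) - ln L) / n\<close> lies below every term \<open>ln (M j) / j\<close> of the
  infimum.\<close>

lemma M_le_exp: "M n \<le> L * exp (h * n)"
proof (cases "n = 0")
  case True
  then show ?thesis using L_ge_1 by (simp add: M_0)
next
  case False
  have "(ln (real (M n)) - ln (real L)) / real n \<le> h"
    unfolding h_def
  proof (rule cINF_greatest)
    fix j :: nat assume "j \<in> {1..}"
    then have j: "j \<ge> 1" by simp
    have "real (M n) ^ j \<le> real L ^ j * real (M (n * j))"
      using M_mult_ge[of n j] by (metis of_nat_le_iff of_nat_mult of_nat_power)
    also have "\<dots> \<le> real L ^ j * real (M j) ^ n"
      using M_mult_le[of j n] by (intro mult_left_mono) (simp_all add: mult.commute flip: of_nat_power)
    finally have "ln (real (M n) ^ j) \<le> ln (real L ^ j * real (M j) ^ n)"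
      using M_pos[of n] by (intro ln_mono) auto
    then have "j * ln (real (M n)) \<le> j * ln (real L) + n * ln (real (M j))"
      using M_pos[of n] M_pos[of j] L_ge_1 by (simp add: ln_mult ln_realpow)
    then show "(ln (real (M n)) - ln (real L)) / real n \<le> ln (real (M j)) / real j"
      using j False by (simp add: field_simps)
  qed simp
  then have "ln (real (M n)) \<le> ln (real L) + h * n" using False by (simp add: field_simps)
  then have "exp (ln (real (M n))) \<le> exp (ln (real L) + h * n)" by simp
  then show ?thesis using M_pos[of n] L_ge_1 by (simp add: exp_add)
qed

text \<open>The exponent with \<open>\<rho> powr s = exp (- h)\<close>, which turns out to be the
  Hausdorff dimension of \<open>K\<close>. Distinct maps, not words, are counted, so exact overlaps
  do not inflate it.\<close>

definition s :: real where "s = h / - ln \<rho>"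

lemma ln_rho_neg: "ln \<rho> < 0"
  using rho_pos rho_less_1 by simp

lemma s_nonneg: "s \<ge> 0"
  unfolding s_def using h_nonneg ln_rho_neg by (intro divide_nonneg_nonneg) auto

lemma h_eq: "h = - s * ln \<rho>"
  using ln_rho_neg by (simp add: s_def)

lemma rho_power_powr_s: "(\<rho> ^ n) powr s = exp (- h * n)"
  using rho_pos by (simp add: powr_def ln_realpow h_eq mult_ac)

lemma ex_scale:
  assumes "0 < r" "r \<le> 1"
  obtains k where "\<rho> ^ Suc k < r" "r \<le> \<rho> ^ k"
proof -
  obtain k0 where "\<rho> ^ k0 < r"
    using assms(1) rho_less_1 by (metis real_arch_pow_inv)
  then obtain k where k: "\<rho> ^ k < r" "\<And>i. i < k \<Longrightarrow> r \<le> \<rho> ^ i"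
    using exists_least_iff[of "\<lambda>k. \<rho> ^ k < r"] by (meson not_less)
  then have "k \<noteq> 0" using assms(2) by (intro notI) simp
  then obtain i where "k = Suc i" by (cases k) auto
  then show ?thesis using k by (intro that[of i]) auto
qed

lemma card_pts_in_interval: "card (pts k \<inter> {u..u + 3 * \<rho> ^ k}) \<le> 3 * L"
proof -
  let ?B = "\<lambda>v. pts k \<inter> {v..v + \<rho> ^ k}"
  have B: "card (?B v) \<le> L" for v by (rule card_close_pts) auto
  have "pts k \<inter> {u..u + 3 * \<rho> ^ k} \<subseteq> ?B u \<union> ?B (u + \<rho> ^ k) \<union> ?B (u + 2 * \<rho> ^ k)" by auto
  then have "card (pts k \<inter> {u..u + 3 * \<rho> ^ k}) \<le> card (?B u \<union> ?B (u + \<rho> ^ k) \<union> ?B (u + 2 * \<rho> ^ k))"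
    using finite_pts by (intro card_mono) auto
  also have "\<dots> \<le> card (?B u) + card (?B (u + \<rho> ^ k)) + card (?B (u + 2 * \<rho> ^ k))"
    by (meson add_mono card_Un_le order.trans order_refl)
  also have "\<dots> \<le> 3 * L" using B[of u] B[of "u + \<rho> ^ k"] B[of "u + 2 * \<rho> ^ k"] by simp
  finally show ?thesis .
qed

text \<open>The points of level \<open>n\<close> in the ball descend from points of the level
  \<open>k\<close> whose scale matches \<open>r\<close>; there are at most \<open>3 * L\<close> of
  these, each with at most \<open>M (n - k)\<close> descendants.\<close>

lemma card_pts_in_ball:
  assumes r: "0 < r" "r \<le> 1" and n: "\<rho> ^ n \<le> r"
  shows "card (pts n \<inter> {x - r<..<x + r}) \<le> (3 * L * L / \<rho> powr s) * exp (h * n) * r powr s"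
proof -
  obtain k where k: "\<rho> ^ Suc k < r" "r \<le> \<rho> ^ k" using ex_scale[OF r] .
  have "k \<le> n"
  proof (rule ccontr)
    assume "\<not> k \<le> n"
    then have "\<rho> ^ k < \<rho> ^ n" using rho_pos rho_less_1 by (intro power_strict_decreasing) auto
    then show False using n k by simp
  qed
  \<comment> \<open>A level \<open>k\<close> ancestor lies at most \<open>\<rho> ^ k\<close> to the
    left of its descendant, so the window extends that far beyond the ball;
    \<open>r \<le> \<rho> ^ k\<close> bounds its length by \<open>3 * \<rho> ^ k\<close>.\<close>
  let ?A = "pts n \<inter> {x - r<..<x + r}" and ?u = "x - r - \<rho> ^ k"
  let ?B = "pts k \<inter> {?u..?u + 3 * \<rho> ^ k}"
  have "?A \<subseteq> (\<lambda>(y, z). y + \<rho> ^ k * z) ` (?B \<times> pts (n - k))"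
  proof
    fix w assume w: "w \<in> ?A"
    then have "w \<in> pts (k + (n - k))" using \<open>k \<le> n\<close> by simp
    then obtain y z where yz: "y \<in> pts k" "z \<in> pts (n - k)" "w = y + \<rho> ^ k * z"
      by (rule pts_addE)
    have "0 \<le> z" "z \<le> 1" using yz(2) pts_01 by blast+
    then have "0 \<le> \<rho> ^ k * z" "\<rho> ^ k * z \<le> \<rho> ^ k" using rho_pos by (auto simp: mult_left_le)
    moreover have "x - r < w" "w < x + r" using w by auto
    ultimately have "?u \<le> y" "y \<le> ?u + 3 * \<rho> ^ k" using yz(3) k by linarith+
    then have "y \<in> ?B" using yz(1) by simp
    then show "w \<in> (\<lambda>(y, z). y + \<rho> ^ k * z) ` (?B \<times> pts (n - k))"
      using yz by (intro image_eqI[where x = "(y, z)"]) simp_all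
  qed
  then have "card ?A \<le> card ((\<lambda>(y, z). y + \<rho> ^ k * z) ` (?B \<times> pts (n - k)))"
    using finite_pts by (intro card_mono) auto
  also have "\<dots> \<le> card (?B \<times> pts (n - k))" using finite_pts by (intro card_image_le) auto
  also have "\<dots> \<le> (3 * L) * M (n - k)"
    unfolding card_cartesian_product M_def by (intro mult_right_mono card_pts_in_interval) simp
  finally have "real (card ?A) \<le> (3 * L) * real (M (n - k))" by (metis of_nat_le_iff of_nat_mult)
  also have "\<dots> \<le> (3 * L) * (L * exp (h * (n - k)))"
    using M_le_exp[of "n - k"] by (intro mult_left_mono) auto
  also have "\<dots> = (3 * L * L) * (exp (h * n) * exp (- h * k))"
    using \<open>k \<le> n\<close> by (simp add: of_nat_diff algebra_simps flip: exp_add)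
  also have "\<dots> \<le> (3 * L * L) * (exp (h * n) * (r powr s / \<rho> powr s))"
  proof (intro mult_left_mono)
    have "exp (- h * k) = (\<rho> ^ k) powr s" by (simp add: rho_power_powr_s)
    also have "\<dots> \<le> (r / \<rho>) powr s"
      using k rho_pos s_nonneg by (intro powr_mono2) (auto simp: field_simps)
    finally show "exp (- h * k) \<le> r powr s / \<rho> powr s" using r rho_pos by (simp add: powr_divide)
  qed auto
  finally show ?thesis by simp
qed


subsection \<open>Hausdorff dimension of the attractor\<close>

lemma K_cover: "K \<subseteq> (\<Union>y\<in>pts n. {y..y + \<rho> ^ n})"
proof
  fix x assume "x \<in> K"
  then obtain \<sigma> y where y: "\<sigma> \<in> W n" "y \<in> K" "x = c \<sigma> + \<rho> ^ n * y" using K_decompose by blast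
  have "0 \<le> y" "y \<le> 1" using y(2) K_subset by auto
  then have "x \<in> {c \<sigma>..c \<sigma> + \<rho> ^ n}" using y(3) rho_pos by (auto simp: mult_left_le)
  then show "x \<in> (\<Union>y\<in>pts n. {y..y + \<rho> ^ n})" using ptsI[OF y(1)] by blast
qed

text \<open>Cover by the intervals of the \<open>M n\<close> distinct level \<open>n\<close>
  cylinders, padded with empty sets, whose gauge is \<open>0\<close>.\<close>

lemma premeasure_K_le:
  assumes "t > 0" and "\<rho> ^ n \<le> \<delta>"
  shows "hausdorff_premeasure t \<delta> K \<le> ennreal (L * (exp h * \<rho> powr t) ^ n)"
proof -
  obtain e where e: "bij_betw e {0..<M n} (pts n)"
    unfolding M_def using ex_bij_betw_nat_finite[OF finite_pts] by blast
  define U where "U i = (if i < M n then {e i..e i + \<rho> ^ n} else {})" for i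
  have diam: "diameter {e i..e i + \<rho> ^ n} = \<rho> ^ n" for i
    using rho_pos by (subst diameter_closed_interval) auto
  have "K \<subseteq> (\<Union>i. U i)"
  proof
    fix x assume "x \<in> K"
    then obtain y where y: "y \<in> pts n" "x \<in> {y..y + \<rho> ^ n}" using K_cover by blast
    obtain i where "i \<in> {0..<M n}" "y = e i" using y(1) bij_betw_imp_surj_on[OF e] by blast
    then show "x \<in> (\<Union>i. U i)" using y(2) by (auto simp: U_def)
  qed
  moreover have "0 \<le> \<delta>" using assms(2) zero_le_power[of \<rho> n] rho_pos by linarith
  then have "bounded (U i) \<and> diameter (U i) \<le> \<delta>" for i
    using diam assms(2) by (simp add: U_def)
  ultimately have "hausdorff_premeasure t \<delta> K \<le> (\<Sum>i. hausdorff_gauge t (U i))"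
    unfolding hausdorff_premeasure_def by (intro INF_lower) auto
  also have "\<dots> = (\<Sum>i\<in>{..<M n}. hausdorff_gauge t (U i))"
    by (rule suminf_finite) (auto simp: U_def hausdorff_gauge_def)
  also have "\<dots> = (\<Sum>i\<in>{..<M n}. ennreal ((\<rho> ^ n) powr t))"
    using assms(1) rho_pos diam by (intro sum.cong) (auto simp: U_def hausdorff_gauge_def)
  also have "\<dots> = ennreal (M n * (\<rho> ^ n) powr t)"
    by (subst sum_ennreal) auto
  also have "\<dots> \<le> ennreal (L * (exp h * \<rho> powr t) ^ n)"
  proof (rule ennreal_leI)
    have "(\<rho> ^ n) powr t = (\<rho> powr t) ^ n"
      using rho_pos by (simp add: powr_powr powr_power mult.commute flip: powr_realpow)
    moreover have "exp (h * n) = exp h ^ n" by (simp add: exp_of_nat2_mult)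
    ultimately have "M n * (\<rho> ^ n) powr t \<le> L * exp h ^ n * (\<rho> powr t) ^ n"
      using M_le_exp[of n] by (simp add: mult_right_mono)
    then show "M n * (\<rho> ^ n) powr t \<le> L * (exp h * \<rho> powr t) ^ n"
      by (simp add: power_mult_distrib mult.assoc)
  qed
  finally show ?thesis .
qed

lemma hausdorff_measure_K_eq_0:
  assumes "t > s"
  shows "hausdorff_measure t K = 0"
proof -
  have t: "t > 0" using assms s_nonneg by simp
  have "hausdorff_premeasure t \<delta> K = 0" if \<delta>: "\<delta> > 0" for \<delta> :: real
  proof -
    let ?q = "exp h * \<rho> powr t"
    \<comment> \<open>The bound from the covers decays geometrically because \<open>t > s\<close>
      says exactly that \<open>h + t * ln \<rho> < 0\<close>.\<close>
    have "?q = exp (h + t * ln \<rho>)" using rho_pos by (simp add: powr_def exp_add)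
    also have "h + t * ln \<rho> < 0"
      using assms ln_rho_neg by (simp add: h_eq mult_less_cancel_right)
    finally have q: "0 \<le> ?q" "?q < 1" by auto
    have "(\<lambda>n. ennreal (L * ?q ^ n)) \<longlonglongrightarrow> ennreal (real L * 0)"
      using q by (intro tendsto_ennrealI tendsto_mult tendsto_const LIMSEQ_realpow_zero)
    then have lim: "(\<lambda>n. ennreal (L * ?q ^ n)) \<longlonglongrightarrow> 0" by simp
    have "(\<lambda>n. \<rho> ^ n) \<longlonglongrightarrow> 0"
      using rho_pos rho_less_1 by (intro LIMSEQ_realpow_zero) auto
    then have "\<forall>\<^sub>F n in sequentially. \<rho> ^ n < \<delta>" using \<delta> by (rule order_tendstoD)
    then have "\<forall>\<^sub>F n in sequentially. hausdorff_premeasure t \<delta> K \<le> ennreal (L * ?q ^ n)"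
      by eventually_elim (use premeasure_K_le[OF t] in auto)
    then have "hausdorff_premeasure t \<delta> K \<le> 0"
      using lim by (intro tendsto_lowerbound[OF lim]) auto
    then show ?thesis by simp
  qed
  then show ?thesis unfolding hausdorff_measure_def by (auto intro!: antisym SUP_least)
qed

text \<open>By compactness a countable cover may be replaced by finitely many intervals of radii \<open>r i\<close>;
  counting the points of a fine level in each of them bounds the sum of \<open>r i powr s\<close> from below.\<close>

lemma hausdorff_measure_K_pos:
  assumes "0 \<le> t" "t < s"
  shows "hausdorff_measure t K \<noteq> 0"
proof
  assume H0: "hausdorff_measure t K = 0"
  define Q where "Q = 3 * L * L / \<rho> powr s"
  have Q: "Q > 0" using L_ge_1 rho_pos by (simp add: Q_def)
  \<comment> \<open>The value \<open>1 / (4 * Q)\<close> makes the final count contradictory through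
    \<open>2 * Q * \<epsilon> < 1\<close>; the value \<open>1 / 2\<close> keeps all radii at most
    \<open>1\<close> and excludes \<open>t = 0\<close>, where a single non-empty set already costs
    \<open>1\<close>.\<close>
  define \<epsilon> where "\<epsilon> = min (1 / 2) (1 / (4 * Q))"
  have \<epsilon>: "0 < \<epsilon>" "\<epsilon> \<le> 1 / 2" "2 * Q * \<epsilon> < 1" using Q by (auto simp: \<epsilon>_def min_def field_simps)
  have "hausdorff_premeasure t 1 K \<le> hausdorff_measure t K"
    unfolding hausdorff_measure_def by (intro SUP_upper) auto
  then have "hausdorff_premeasure t 1 K < ennreal \<epsilon>" using H0 \<epsilon> by simp
  then obtain U where U: "K \<subseteq> (\<Union>i. U i)" "\<And>i. bounded (U i)"
      "(\<Sum>i. hausdorff_gauge t (U i)) < ennreal \<epsilon>"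
    unfolding hausdorff_premeasure_def by (auto simp: INF_less_iff)
  have sum_less: "(\<Sum>i\<in>I. hausdorff_gauge t (U i)) < ennreal \<epsilon>" if "finite I" for I
    using sum_le_suminf[OF summableI \<open>finite I\<close>, of "\<lambda>i. hausdorff_gauge t (U i)"] U(3)
    by (auto intro: le_less_trans)
  show False
  proof (cases "t = 0")
    case True
    obtain i where "U i \<noteq> {}" using U(1) K_ne by blast
    then have "hausdorff_gauge t (U i) = 1" using True by (simp add: hausdorff_gauge_def)
    then have "1 < ennreal \<epsilon>" using sum_less[of "{i}"] by simp
    then show False using \<epsilon> by (simp add: ennreal_less_iff flip: ennreal_1)
  next
    case False
    with assms have t: "t > 0" by simp
    have gauge: "hausdorff_gauge t (U i) = ennreal (diameter (U i) powr t)" for i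
      using t by (simp add: hausdorff_gauge_def diameter_empty)
    have diam_nonneg: "0 \<le> diameter (U i)" for i using U(2) by (rule diameter_ge_0)
    \<comment> \<open>The summable extra term gives even a set of diameter \<open>0\<close> a radius
      strictly larger than its diameter, so that open intervals are available for the compactness
      argument.\<close>
    define v where "v i = diameter (U i) powr t + \<epsilon> * (1 / 2) ^ Suc i" for i
    define r where "r i = v i powr (1 / t)" for i
    have v_pos: "v i > 0" for i using \<epsilon> unfolding v_def by (intro add_nonneg_pos) auto
    have r_pos: "r i > 0" for i using v_pos[of i] by (simp add: r_def)
    have r_t: "r i powr t = v i" for i using t v_pos[of i] by (simp add: r_def powr_powr)
    have sum_v: "(\<Sum>i\<in>I. v i) \<le> 2 * \<epsilon>" if I: "finite I" for I
    proof -
      have "ennreal (\<Sum>i\<in>I. diameter (U i) powr t) < ennreal \<epsilon>"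
        using sum_less[OF I] by (simp add: gauge sum_ennreal)
      then have "(\<Sum>i\<in>I. diameter (U i) powr t) < \<epsilon>" using \<epsilon> by (simp add: ennreal_less_iff sum_nonneg)
      moreover have "(\<Sum>i\<in>I. (1 / 2 :: real) ^ Suc i) \<le> 1"
        using sum_le_suminf[OF sums_summable[OF power_half_series] I] sums_unique[OF power_half_series]
        by simp
      then have "\<epsilon> * (\<Sum>i\<in>I. (1 / 2) ^ Suc i) \<le> \<epsilon> * 1" using \<epsilon> by (intro mult_left_mono) auto
      ultimately show ?thesis unfolding v_def by (simp add: sum.distrib sum_distrib_left)
    qed
    have r_le: "r i \<le> 1" for i
    proof -
      have "v i \<le> 1" using sum_v[of "{i}"] \<epsilon> by simp
      then show ?thesis using v_pos[of i] t unfolding r_def by (intro powr_le1) auto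
    qed
    have diam_less: "diameter (U i) < r i" for i
    proof (rule ccontr)
      assume "\<not> diameter (U i) < r i"
      then have "r i powr t \<le> diameter (U i) powr t" using r_pos[of i] t by (intro powr_mono2) auto
      moreover have "0 < \<epsilon> * (1 / 2) ^ Suc i" using \<epsilon> by simp
      ultimately show False unfolding r_t v_def by linarith
    qed
    \<comment> \<open>For empty \<open>U i\<close> the centre is arbitrary; the interval
      \<open>B i\<close> is still paid for by the extra term in \<open>v i\<close>.\<close>
    define x where "x i = (SOME x. x \<in> U i)" for i
    define B where "B i = {x i - r i<..<x i + r i}" for i
    have UB: "U i \<subseteq> B i" for i
    proof
      fix y assume y: "y \<in> U i"
      then have "x i \<in> U i" unfolding x_def by (rule someI)
      then have "dist (x i) y \<le> diameter (U i)" using y U(2) by (intro diameter_bounded_bound)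
      then show "y \<in> B i" using diam_less[of i] by (auto simp: B_def dist_real_def)
    qed
    have cover: "K \<subseteq> (\<Union>i\<in>UNIV. B i)"
      by (rule order.trans[OF U(1)]) (intro UN_mono UB subset_refl)
    obtain I where I: "finite I" "K \<subseteq> (\<Union>i\<in>I. B i)"
      by (rule compactE_image[OF compact_K _ cover]) (simp_all add: B_def)
    have "I \<noteq> {}" using I K_ne by auto
    have "0 < Min (r ` I)" using I(1) \<open>I \<noteq> {}\<close> r_pos by simp
    then obtain n where n: "\<rho> ^ n < Min (r ` I)" using rho_less_1 by (metis real_arch_pow_inv)
    have "M n \<le> card (\<Union>i\<in>I. pts n \<inter> B i)"
      unfolding M_def using I pts_K finite_pts by (intro card_mono) auto
    also have "\<dots> \<le> (\<Sum>i\<in>I. card (pts n \<inter> B i))" by (rule card_UN_le[OF I(1)])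
    finally have "real (M n) \<le> (\<Sum>i\<in>I. real (card (pts n \<inter> B i)))" by (metis of_nat_le_iff of_nat_sum)
    also have "\<dots> \<le> (\<Sum>i\<in>I. Q * exp (h * n) * v i)"
    proof (rule sum_mono)
      fix i assume i: "i \<in> I"
      have "\<rho> ^ n \<le> r i" using n I(1) i by (meson Min_le finite_imageI image_eqI less_le_trans less_imp_le)
      then have "card (pts n \<inter> B i) \<le> Q * exp (h * n) * r i powr s"
        unfolding B_def Q_def using card_pts_in_ball[OF r_pos r_le] by blast
      also have "r i powr s \<le> r i powr t" using r_pos[of i] r_le[of i] assms by (intro powr_mono') auto
      finally show "card (pts n \<inter> B i) \<le> Q * exp (h * n) * v i"
        using Q by (simp add: r_t mult_left_mono)
    qed
    also have "\<dots> = Q * exp (h * n) * (\<Sum>i\<in>I. v i)" by (simp add: sum_distrib_left)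
    also have "\<dots> \<le> Q * exp (h * n) * (2 * \<epsilon>)" using sum_v[OF I(1)] Q by (intro mult_left_mono) auto
    also have "\<dots> = exp (h * n) * (2 * Q * \<epsilon>)" by simp
    also have "\<dots> < exp (h * n) * 1" using \<epsilon>(3) by (intro mult_strict_left_mono) auto
    finally show False using M_ge_exp[of n] by simp
  qed
qed

lemma hausdorff_dim_K: "hausdorff_dim K = ereal s"
proof (rule antisym)
  show "hausdorff_dim K \<le> ereal s"
  proof (rule dense_ge)
    fix z assume "ereal s < z"
    then show "hausdorff_dim K \<le> z"
      unfolding hausdorff_dim_def using s_nonneg hausdorff_measure_K_eq_0
      by (cases z) (auto intro!: INF_lower)
  qed
  show "ereal s \<le> hausdorff_dim K"
    unfolding hausdorff_dim_def using hausdorff_measure_K_pos by (intro INF_greatest) force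
qed


subsection \<open>Saturated and stable words\<close>

text \<open>These are the cylinders of the same level whose intervals meet that of
  \<open>\<sigma>\<close>, touching ones included, because all these intervals have length
  \<open>\<rho> ^ length \<sigma>\<close>.\<close>

definition near :: "nat list \<Rightarrow> real set" where
  "near \<sigma> = {y \<in> pts (length \<sigma>). \<bar>y - c \<sigma>\<bar> \<le> \<rho> ^ length \<sigma>}"

lemma finite_near: "finite (near \<sigma>)"
  unfolding near_def using finite_pts by auto

lemma near_subset: "near \<sigma> \<subseteq> pts (length \<sigma>)"
  by (auto simp: near_def)

lemma card_near_le: "card (near \<sigma>) \<le> 3 * L"
proof -
  let ?u = "c \<sigma> - \<rho> ^ length \<sigma>"
  have "0 \<le> \<rho> ^ length \<sigma>" using rho_pos by simp
  then have "near \<sigma> \<subseteq> pts (length \<sigma>) \<inter> {?u..?u + 3 * \<rho> ^ length \<sigma>}"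
    by (auto simp: near_def abs_le_iff)
  then have "card (near \<sigma>) \<le> card (pts (length \<sigma>) \<inter> {?u..?u + 3 * \<rho> ^ length \<sigma>})"
    using finite_pts by (intro card_mono) auto
  then show ?thesis using card_pts_in_interval[of "length \<sigma>" ?u] by simp
qed

text \<open>Prefixing by \<open>\<omega>\<close> is a similarity, so it carries neighbours to
  neighbours. The inclusion can be strict: cylinders that are not copies under
  \<open>\<omega>\<close> may also lie near \<open>\<omega> @ \<sigma>\<close>.\<close>

lemma near_append_superset:
  assumes "set \<omega> \<subseteq> {..m}"
  shows "(\<lambda>y. c \<omega> + \<rho> ^ length \<omega> * y) ` near \<sigma> \<subseteq> near (\<omega> @ \<sigma>)"
proof safe
  fix y assume y: "y \<in> near \<sigma>"
  have "\<omega> \<in> W (length \<omega>)" using assms by (simp add: ifs_words_def)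
  then have "c \<omega> + \<rho> ^ length \<omega> * y \<in> pts (length \<omega> + length \<sigma>)"
    unfolding pts_add using y near_subset by (intro image_eqI[where x = "(c \<omega>, y)"]) (auto simp: ptsI)
  moreover have "c \<omega> + \<rho> ^ length \<omega> * y - c (\<omega> @ \<sigma>) = \<rho> ^ length \<omega> * (y - c \<sigma>)"
    by (simp add: word_map_append_0 algebra_simps)
  then have "\<bar>c \<omega> + \<rho> ^ length \<omega> * y - c (\<omega> @ \<sigma>)\<bar> = \<rho> ^ length \<omega> * \<bar>y - c \<sigma>\<bar>"
    using rho_pos by (simp add: abs_mult)
  moreover have "\<rho> ^ length \<omega> * \<bar>y - c \<sigma>\<bar> \<le> \<rho> ^ length \<omega> * \<rho> ^ length \<sigma>"
    using y rho_pos by (intro mult_left_mono) (auto simp: near_def)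
  ultimately show "c \<omega> + \<rho> ^ length \<omega> * y \<in> near (\<omega> @ \<sigma>)" by (simp add: near_def power_add)
qed

text \<open>A word whose number of neighbours is maximal: prefixing it with any word creates no new
  neighbours, so all cylinders that meet its interval factor through the prefix.\<close>

lemma ex_saturated:
  "\<exists>\<sigma>. set \<sigma> \<subseteq> {..m} \<and>
     (\<forall>\<omega>. set \<omega> \<subseteq> {..m} \<longrightarrow> near (\<omega> @ \<sigma>) = (\<lambda>y. c \<omega> + \<rho> ^ length \<omega> * y) ` near \<sigma>)"
proof -
  have "\<exists>\<sigma>. set \<sigma> \<subseteq> {..m} \<and> (\<forall>\<tau>. set \<tau> \<subseteq> {..m} \<longrightarrow> card (near \<tau>) \<le> card (near \<sigma>))"
    by (rule ex_has_greatest_nat[where k = "[]" and b = "3 * L + 1"])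
      (use card_near_le in \<open>auto simp: less_Suc_eq_le\<close>)
  then obtain \<sigma> where \<sigma>: "set \<sigma> \<subseteq> {..m}" "\<And>\<tau>. set \<tau> \<subseteq> {..m} \<Longrightarrow> card (near \<tau>) \<le> card (near \<sigma>)"
    by blast
  have "near (\<omega> @ \<sigma>) = (\<lambda>y. c \<omega> + \<rho> ^ length \<omega> * y) ` near \<sigma>" if \<omega>: "set \<omega> \<subseteq> {..m}" for \<omega>
  proof -
    have "card ((\<lambda>y. c \<omega> + \<rho> ^ length \<omega> * y) ` near \<sigma>) = card (near \<sigma>)"
      using rho_pos by (intro card_image) (auto simp: inj_on_def)
    moreover have "card (near (\<omega> @ \<sigma>)) \<le> card (near \<sigma>)" using \<omega> \<sigma>(1) by (intro \<sigma>(2)) auto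
    ultimately show ?thesis
      using card_seteq[OF finite_near near_append_superset[OF \<omega>, of \<sigma>]] by simp
  qed
  with \<sigma>(1) show ?thesis by blast
qed

definition \<omega>\<^sub>0 :: "nat list" where
  "\<omega>\<^sub>0 = (SOME \<sigma>. set \<sigma> \<subseteq> {..m} \<and>
     (\<forall>\<omega>. set \<omega> \<subseteq> {..m} \<longrightarrow> near (\<omega> @ \<sigma>) = (\<lambda>y. c \<omega> + \<rho> ^ length \<omega> * y) ` near \<sigma>))"

abbreviation k\<^sub>0 :: nat where "k\<^sub>0 \<equiv> length \<omega>\<^sub>0"

lemma set_\<omega>\<^sub>0: "set \<omega>\<^sub>0 \<subseteq> {..m}"
  using someI_ex[OF ex_saturated] unfolding \<omega>\<^sub>0_def by (rule conjunct1)

lemma near_\<omega>\<^sub>0: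
  "set \<omega> \<subseteq> {..m} \<Longrightarrow> near (\<omega> @ \<omega>\<^sub>0) = (\<lambda>y. c \<omega> + \<rho> ^ length \<omega> * y) ` near \<omega>\<^sub>0"
  using someI_ex[OF ex_saturated] unfolding \<omega>\<^sub>0_def by (elim conjE allE impE)

lemma saturated:
  assumes "set \<omega> \<subseteq> {..m}" "\<tau> \<in> W (length \<omega> + k\<^sub>0)"
    "\<bar>c \<tau> - c (\<omega> @ \<omega>\<^sub>0)\<bar> \<le> \<rho> ^ (length \<omega> + k\<^sub>0)"
  obtains y where "y \<in> near \<omega>\<^sub>0" "c \<tau> = c \<omega> + \<rho> ^ length \<omega> * y"
proof -
  have "c \<tau> \<in> near (\<omega> @ \<omega>\<^sub>0)" using assms by (simp add: near_def ptsI)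
  then show thesis unfolding near_\<omega>\<^sub>0[OF assms(1)] by (elim imageE) (rule that)
qed

text \<open>\<open>reach u\<close> consists of the neighbours of \<open>\<omega>\<^sub>0\<close> one of whose descendants has the same map as
  \<open>\<omega>\<^sub>0 @ u\<close>. Only these can contribute to the weight of a cylinder below \<open>\<omega>\<^sub>0 @ u\<close>.\<close>

definition reach :: "nat list \<Rightarrow> real set" where
  "reach u = {y \<in> near \<omega>\<^sub>0. \<exists>v\<in>W (length u). y + \<rho> ^ k\<^sub>0 * c v = c (\<omega>\<^sub>0 @ u)}"

text \<open>Two paths that have met stay together when the same \<open>\<eta>\<close> is appended to
  both. So \<open>reach\<close> only grows with the word and, being bounded in size,
  stabilises.\<close>

lemma reach_append:
  assumes "set \<eta> \<subseteq> {..m}"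
  shows "reach u \<subseteq> reach (u @ \<eta>)"
proof
  fix y assume "y \<in> reach u"
  then obtain v where v: "y \<in> near \<omega>\<^sub>0" "v \<in> W (length u)" "y + \<rho> ^ k\<^sub>0 * c v = c (\<omega>\<^sub>0 @ u)"
    unfolding reach_def by blast
  have "v @ \<eta> \<in> W (length (u @ \<eta>))" using v(2) assms by (auto simp: ifs_words_def)
  moreover have "y + \<rho> ^ k\<^sub>0 * c (v @ \<eta>) = c (\<omega>\<^sub>0 @ u @ \<eta>)"
    using v(3) W_length[OF v(2)] by (simp add: word_map_append_0 algebra_simps power_add)
  ultimately show "y \<in> reach (u @ \<eta>)" using v(1) unfolding reach_def by blast
qed

lemma finite_reach: "finite (reach u)"
  using finite_near by (simp add: reach_def)

text \<open>The factor \<open>[0, m]\<close> moves the cylinder into the interior, away from both endpoints.\<close>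

lemma ex_stable:
  "\<exists>u. set u \<subseteq> {..m} \<and> (\<forall>\<eta>. set \<eta> \<subseteq> {..m} \<longrightarrow> reach (([0, m] @ u) @ \<eta>) = reach ([0, m] @ u))"
proof -
  have "\<exists>u. set u \<subseteq> {..m} \<and>
      (\<forall>v. set v \<subseteq> {..m} \<longrightarrow> card (reach ([0, m] @ v)) \<le> card (reach ([0, m] @ u)))"
  proof (rule ex_has_greatest_nat[where k = "[]" and b = "card (near \<omega>\<^sub>0) + 1"])
    show "\<forall>v. set v \<subseteq> {..m} \<longrightarrow> card (reach ([0, m] @ v)) < card (near \<omega>\<^sub>0) + 1"
      using finite_near by (auto simp: reach_def less_Suc_eq_le intro!: card_mono)
  qed simp
  then obtain u where u: "set u \<subseteq> {..m}"
      "\<And>v. set v \<subseteq> {..m} \<Longrightarrow> card (reach ([0, m] @ v)) \<le> card (reach ([0, m] @ u))" by blast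
  have "reach (([0, m] @ u) @ \<eta>) = reach ([0, m] @ u)" if \<eta>: "set \<eta> \<subseteq> {..m}" for \<eta>
  proof -
    have "card (reach ([0, m] @ u @ \<eta>)) \<le> card (reach ([0, m] @ u))"
      using \<eta> u(1) by (intro u(2)) auto
    then show ?thesis
      using card_seteq[OF finite_reach reach_append[OF \<eta>, of "[0, m] @ u"]] by simp
  qed
  with u(1) show ?thesis by blast
qed

definition u\<^sub>0 :: "nat list" where
  "u\<^sub>0 = (SOME u. set u \<subseteq> {..m} \<and>
     (\<forall>\<eta>. set \<eta> \<subseteq> {..m} \<longrightarrow> reach (([0, m] @ u) @ \<eta>) = reach ([0, m] @ u)))"

definition u\<^sub>1 :: "nat list" where "u\<^sub>1 = [0, m] @ u\<^sub>0"

text \<open>The head \<open>\<omega>\<^sub>0\<close> makes the neighbourhood independent of what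
  precedes, the tail \<open>u\<^sub>1\<close> makes the set of contributing neighbours independent
  of what follows; together they decouple the two sides of \<open>\<theta>\<close>.\<close>

definition \<theta> :: "nat list" where "\<theta> = \<omega>\<^sub>0 @ u\<^sub>1"

lemma set_u\<^sub>0: "set u\<^sub>0 \<subseteq> {..m}"
  using someI_ex[OF ex_stable] unfolding u\<^sub>0_def by (rule conjunct1)

lemma set_u\<^sub>1: "set u\<^sub>1 \<subseteq> {..m}"
  using set_u\<^sub>0 by (simp add: u\<^sub>1_def)

lemma set_\<theta>: "set \<theta> \<subseteq> {..m}"
  using set_u\<^sub>1 set_\<omega>\<^sub>0 by (simp add: \<theta>_def)

lemma reach_stable: "set \<eta> \<subseteq> {..m} \<Longrightarrow> reach (u\<^sub>1 @ \<eta>) = reach u\<^sub>1"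
  using someI_ex[OF ex_stable] unfolding u\<^sub>1_def u\<^sub>0_def by (elim conjE allE impE)


subsection \<open>Net intervals\<close>

abbreviation net :: "nat \<Rightarrow> (real \<times> real) set" where "net n \<equiv> net_intervals m \<rho> d K n"
abbreviation char :: "nat \<Rightarrow> real \<times> real \<Rightarrow> char_vec" where "char n \<Delta> \<equiv> char_vector m \<rho> d K n \<Delta>"
abbreviation child :: "char_vec \<Rightarrow> char_vec \<Rightarrow> bool" where "child \<equiv> char_child m \<rho> d K"

lemma E_eq: "E n = pts n \<union> (\<lambda>y. y + \<rho> ^ n) ` pts n"
proof -
  have "word_map \<rho> d \<sigma> 1 = c \<sigma> + \<rho> ^ n" if "\<sigma> \<in> W n" for \<sigma>
    using word_map_eq[of \<rho> d \<sigma> 1] W_length[OF that] by simp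
  then have "E n = (\<Union>\<sigma>\<in>W n. {c \<sigma>, c \<sigma> + \<rho> ^ n})" by (simp add: level_points_def)
  then show ?thesis by (auto simp: pts_def)
qed

lemma finite_E: "finite (E n)"
  using finite_pts by (simp add: E_eq)

lemma c_replicate_0: "c (replicate n 0) = 0"
  by (induction n) (auto simp: ifs_map_def d_0)

lemma c_replicate_m: "c (replicate n m) = 1 - \<rho> ^ n"
proof (induction n)
  case (Suc n)
  show ?case by (simp add: ifs_map_def d_m Suc algebra_simps)
qed simp

lemma zero_in_pts: "0 \<in> pts n"
  using ptsI[OF zeros_in_W, of n] by (simp add: c_replicate_0)

lemma one_minus_in_pts: "1 - \<rho> ^ n \<in> pts n"
proof -
  have "replicate n m \<in> W n" by (auto simp: ifs_words_def)
  then show ?thesis using ptsI c_replicate_m by metis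
qed

lemma pts_addI: "y \<in> pts a \<Longrightarrow> z \<in> pts b \<Longrightarrow> y + \<rho> ^ a * z \<in> pts (a + b)"
  unfolding pts_add by (intro image_eqI[where x = "(y, z)"]) auto

text \<open>A left endpoint survives by appending letters \<open>0\<close>, a right endpoint by
  appending letters \<open>m\<close>, because \<open>0\<close> and \<open>1\<close> are the fixed
  points of the two extreme maps.\<close>

lemma E_mono: "n \<le> j \<Longrightarrow> E n \<subseteq> E j"
proof -
  assume "n \<le> j"
  then obtain i where j: "j = n + i" using le_Suc_ex by blast
  have "y \<in> E j" if y: "y \<in> pts n" for y
    using pts_addI[OF y zero_in_pts, of i] by (simp add: E_eq j)
  moreover have "y + \<rho> ^ n \<in> E j" if y: "y \<in> pts n" for y
  proof -
    have "y + \<rho> ^ n * (1 - \<rho> ^ i) \<in> pts j" using pts_addI[OF y one_minus_in_pts, of i] by (simp add: j)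
    moreover have "y + \<rho> ^ n = y + \<rho> ^ n * (1 - \<rho> ^ i) + \<rho> ^ j" by (simp add: j power_add algebra_simps)
    ultimately show ?thesis unfolding E_eq by blast
  qed
  ultimately show ?thesis by (auto simp: E_eq[of n])
qed

lemma zero_in_E: "0 \<in> E n" and one_in_E: "1 \<in> E n"
  using E_mono[of 0 n] by (auto simp: E_eq[of 0] pts_0)

text \<open>Level \<open>0\<close> fits the general description: the point \<open>\<rho>\<close>,
  the image of \<open>1\<close> under the first map, lies in \<open>K\<close> strictly between
  \<open>0\<close> and \<open>1\<close>.\<close>

lemma net_iff:
  "(a, b) \<in> net n \<longleftrightarrow> a \<in> E n \<and> b \<in> E n \<and> a < b \<and> {a<..<b} \<inter> E n = {} \<and> {a<..<b} \<inter> K \<noteq> {}"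
proof (cases "n = 0")
  case True
  have "\<rho> \<in> K" using one_in_K K_eq d_0 by (force simp: ifs_map_def)
  then have "{0<..<1} \<inter> K \<noteq> {}" using rho_pos rho_less_1 by auto
  then show ?thesis using True by (auto simp: net_intervals_def E_eq pts_0)
qed (simp add: net_intervals_def)

lemma infinite_K: "infinite K"
proof
  assume "finite K"
  have "\<rho> ^ n \<in> K" for n
    using word_map_W_K[OF zeros_in_W one_in_K, of n] by (simp add: c_replicate_0)
  then have "finite (range (\<lambda>n. \<rho> ^ n))" using \<open>finite K\<close> by (auto intro: finite_subset)
  moreover have "inj (\<lambda>n. \<rho> ^ n)" using rho_pos rho_less_1 by (auto simp: inj_on_def power_inject_exp')
  ultimately show False using finite_imageD by blast
qed

lemma net_exists:
  assumes "x \<in> K" "x \<notin> E n"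
  obtains a b where "(a, b) \<in> net n" "a < x" "x < b"
proof -
  have x: "0 < x" "x < 1"
    using assms K_subset zero_in_E one_in_E by (auto simp: less_le)
  define a where "a = Max {e \<in> E n. e < x}"
  define b where "b = Min {e \<in> E n. x < e}"
  have fin: "finite {e \<in> E n. e < x}" "finite {e \<in> E n. x < e}" using finite_E by auto
  have "a \<in> {e \<in> E n. e < x}" unfolding a_def using fin x zero_in_E by (intro Max_in) auto
  moreover have "b \<in> {e \<in> E n. x < e}" unfolding b_def using fin x one_in_E by (intro Min_in) auto
  moreover have "e \<le> a \<or> b \<le> e" if e: "e \<in> E n" for e
  proof (cases "e < x")
    case True
    then show ?thesis unfolding a_def using fin e by auto
  next
    case False
    then have "x < e" using e assms(2) by (cases "e = x") auto
    then show ?thesis unfolding b_def using fin e by auto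
  qed
  ultimately have "(a, b) \<in> net n" "a < x" "x < b" unfolding net_iff using assms(1) by fastforce+
  then show thesis by (rule that)
qed

text \<open>Nestedness of the net intervals of all levels, in the form used from here on: endpoints
  persist, so a finer interval cannot straddle a coarser endpoint.\<close>

lemma net_sep:
  assumes "(a, b) \<in> net n" "j \<le> n" "e \<in> E j"
  shows "e \<le> a \<or> b \<le> e"
proof -
  have "e \<in> E n" using E_mono[OF assms(2)] assms(3) by blast
  then have "e \<notin> {a<..<b}" using assms(1) unfolding net_iff by blast
  then show ?thesis by auto
qed

lemma net_parent:
  assumes "(a, b) \<in> net (Suc n)"
  obtains u v where "(u, v) \<in> net n" "u \<le> a" "b \<le> v" "net_child m \<rho> d K n (u, v) (a, b)"
proof -
  obtain x where x: "x \<in> K" "a < x" "x < b" using assms by (auto simp: net_iff)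
  have "x \<notin> E n" using net_sep[OF assms, of n x] x by auto
  then obtain u v where uv: "(u, v) \<in> net n" "u < x" "x < v" using net_exists[OF x(1)] by blast
  have "u \<in> E n" "v \<in> E n" using uv(1) by (auto simp: net_iff)
  then have "u \<le> a" "b \<le> v" using net_sep[OF assms, of n] uv x by force+
  then show thesis using uv(1) assms by (intro that) (auto simp: net_child_def)
qed

text \<open>Climb from the finer interval through its parents; by \<open>net_sep\<close> no ancestor
  of level at least \<open>n\<close> can leave \<open>(a, b)\<close>, so the climb ends at
  \<open>(a, b)\<close> itself.\<close>

lemma net_descendant:
  assumes "(a, b) \<in> net n" "(a', b') \<in> net (n + j)" "a \<le> a'" "b' \<le> b"
  shows "child\<^sup>*\<^sup>* (char n (a, b)) (char (n + j) (a', b'))"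
  using assms(2-)
proof (induction j arbitrary: a' b')
  case 0
  have "a' \<in> E n" "b' \<in> E n" "a' < b'" using 0 by (auto simp: net_iff)
  then have "a' = a" "b' = b" using net_sep[OF assms(1), of n] 0 by force+
  then show ?case by simp
next
  case (Suc j)
  then have \<Delta>': "(a', b') \<in> net (Suc (n + j))" by simp
  obtain u v where uv: "(u, v) \<in> net (n + j)" "u \<le> a'" "b' \<le> v"
      "net_child m \<rho> d K (n + j) (u, v) (a', b')"
    using net_parent[OF \<Delta>'] .
  have "a' < b'" using \<Delta>' by (simp add: net_iff)
  moreover have "a \<in> E n" "b \<in> E n" using assms(1) by (auto simp: net_iff)
  ultimately have "a \<le> u" "v \<le> b" using net_sep[OF uv(1), of n] uv Suc.prems by force+
  then have "child\<^sup>*\<^sup>* (char n (a, b)) (char (n + j) (u, v))" using Suc.IH uv(1) by blast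
  moreover have "child (char (n + j) (u, v)) (char (n + Suc j) (a', b'))"
    unfolding char_child_def
    by (intro exI[of _ "n + j"] exI[of _ "(u, v)"] exI[of _ "(a', b')"]) (use uv(4) in simp)
  ultimately show ?case by (rule rtranclp.rtrancl_into_rtrancl)
qed

lemma cylinder_inside:
  assumes "x \<in> K" "a < x" "x < b"
  obtains \<omega> where "set \<omega> \<subseteq> {..m}" "n \<le> length \<omega>" "a < c \<omega>" "c \<omega> + \<rho> ^ length \<omega> < b"
proof -
  obtain i where i: "\<rho> ^ i < min (x - a) (b - x)"
    using real_arch_pow_inv[of "min (x - a) (b - x)" \<rho>] assms rho_less_1 by auto
  define N where "N = max n i"
  have "\<rho> ^ N \<le> \<rho> ^ i" using rho_pos rho_less_1 by (intro power_decreasing) (auto simp: N_def)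
  obtain \<omega> y where \<omega>: "\<omega> \<in> W N" "y \<in> K" "x = c \<omega> + \<rho> ^ N * y" using K_decompose[OF assms(1)] by blast
  have "0 \<le> y" "y \<le> 1" using \<omega>(2) K_subset by auto
  then have "0 \<le> \<rho> ^ N * y" "\<rho> ^ N * y \<le> \<rho> ^ N" using rho_pos by (auto simp: mult_left_le)
  then have "a < c \<omega>" "c \<omega> + \<rho> ^ N < b" using \<omega>(3) i \<open>\<rho> ^ N \<le> \<rho> ^ i\<close> by linarith+
  then show thesis using \<omega>(1) by (intro that[of \<omega>]) (auto simp: ifs_words_def N_def)
qed

section \<open>Copies of the net structure around \<open>\<omega>\<^sub>0\<close> under prefix
  maps\<close>

definition \<phi> :: "nat list \<Rightarrow> real \<Rightarrow> real" where "\<phi> \<omega> x = c \<omega> + \<rho> ^ length \<omega> * x"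

definition T :: "real set" where "T = {c \<omega>\<^sub>0..c \<omega>\<^sub>0 + \<rho> ^ k\<^sub>0}"

lemma \<phi>_less_iff: "\<phi> \<omega> x < \<phi> \<omega> y \<longleftrightarrow> x < y" and \<phi>_le_iff: "\<phi> \<omega> x \<le> \<phi> \<omega> y \<longleftrightarrow> x \<le> y"
  and \<phi>_eq_iff: "\<phi> \<omega> x = \<phi> \<omega> y \<longleftrightarrow> x = y"
  using rho_pos by (auto simp: \<phi>_def)

lemma \<phi>_surj: "\<exists>x. y = \<phi> \<omega> x"
  using rho_pos by (intro exI[of _ "(y - c \<omega>) / \<rho> ^ length \<omega>"]) (simp add: \<phi>_def)

lemma \<phi>_pts: "set \<omega> \<subseteq> {..m} \<Longrightarrow> y \<in> pts n \<Longrightarrow> \<phi> \<omega> y \<in> pts (length \<omega> + n)"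
  unfolding \<phi>_def by (intro pts_addI ptsI) (auto simp: ifs_words_def)

lemma \<phi>_add: "\<phi> \<omega> y + \<rho> ^ (length \<omega> + n) * z = \<phi> \<omega> (y + \<rho> ^ n * z)"
  by (simp add: \<phi>_def power_add algebra_simps)

text \<open>The level \<open>length \<omega> + k\<^sub>0\<close> ancestor of the cylinder at
  \<open>y\<close> also contains \<open>\<phi> \<omega> x\<close>, hence meets the cylinder of
  \<open>\<omega> @ \<omega>\<^sub>0\<close>. By saturation this ancestor is a copy under
  \<open>\<omega>\<close>, and so is the cylinder itself.\<close>

lemma pts_transport:
  assumes \<omega>: "set \<omega> \<subseteq> {..m}" and n: "k\<^sub>0 \<le> n" and y: "y \<in> pts (length \<omega> + n)" and x: "x \<in> T"
    and le: "y \<le> \<phi> \<omega> x" "\<phi> \<omega> x \<le> y + \<rho> ^ (length \<omega> + n)"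
  obtains y' where "y' \<in> pts n" "y = \<phi> \<omega> y'"
proof -
  let ?l = "length \<omega> + k\<^sub>0"
  have "length \<omega> + n = ?l + (n - k\<^sub>0)" using n by simp
  then have "y \<in> pts (?l + (n - k\<^sub>0))" using y by simp
  then obtain y1 z where yz: "y1 \<in> pts ?l" "z \<in> pts (n - k\<^sub>0)" "y = y1 + \<rho> ^ ?l * z" by (rule pts_addE)
  obtain \<tau> where \<tau>: "\<tau> \<in> W ?l" "y1 = c \<tau>" using yz(1) by (rule ptsE)
  obtain \<upsilon> where \<upsilon>: "\<upsilon> \<in> W (n - k\<^sub>0)" "z = c \<upsilon>" using yz(2) by (rule ptsE)
  have z: "0 \<le> z" "z + \<rho> ^ (n - k\<^sub>0) \<le> 1" using c_W[OF \<upsilon>(1)] \<upsilon>(2) by auto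
  have "0 \<le> \<rho> ^ ?l * z" using z rho_pos by simp
  moreover have "\<rho> ^ ?l * (z + \<rho> ^ (n - k\<^sub>0)) \<le> \<rho> ^ ?l * 1" using z rho_pos by (intro mult_left_mono) auto
  then have "\<rho> ^ ?l * z + \<rho> ^ (length \<omega> + n) \<le> \<rho> ^ ?l"
    using n by (simp add: distrib_left mult.assoc flip: power_add)
  ultimately have "c \<tau> \<le> \<phi> \<omega> x" "\<phi> \<omega> x \<le> c \<tau> + \<rho> ^ ?l" using le yz(3) \<tau>(2) by linarith+
  moreover have "c (\<omega> @ \<omega>\<^sub>0) \<le> \<phi> \<omega> x" "\<phi> \<omega> x \<le> c (\<omega> @ \<omega>\<^sub>0) + \<rho> ^ ?l"
  proof -
    have "\<phi> \<omega> (c \<omega>\<^sub>0) \<le> \<phi> \<omega> x" "\<phi> \<omega> x \<le> \<phi> \<omega> (c \<omega>\<^sub>0 + \<rho> ^ k\<^sub>0)" using x by (auto simp: \<phi>_le_iff T_def)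
    then show "c (\<omega> @ \<omega>\<^sub>0) \<le> \<phi> \<omega> x" "\<phi> \<omega> x \<le> c (\<omega> @ \<omega>\<^sub>0) + \<rho> ^ ?l"
      by (simp_all add: \<phi>_def word_map_append_0 power_add distrib_left)
  qed
  ultimately have "\<bar>c \<tau> - c (\<omega> @ \<omega>\<^sub>0)\<bar> \<le> \<rho> ^ ?l" by linarith
  then obtain w where w: "w \<in> near \<omega>\<^sub>0" "c \<tau> = c \<omega> + \<rho> ^ length \<omega> * w" by (rule saturated[OF \<omega> \<tau>(1)])
  have "w \<in> pts k\<^sub>0" using w(1) near_subset by blast
  then have "w + \<rho> ^ k\<^sub>0 * z \<in> pts n" using pts_addI[OF _ yz(2)] n by fastforce
  moreover have "y = \<phi> \<omega> (w + \<rho> ^ k\<^sub>0 * z)"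
    using yz(3) \<tau>(2) w(2) by (simp add: \<phi>_def power_add algebra_simps)
  ultimately show thesis by (rule that)
qed

lemma E_transport:
  assumes \<omega>: "set \<omega> \<subseteq> {..m}" and n: "k\<^sub>0 \<le> n" and x: "x \<in> T"
  shows "\<phi> \<omega> x \<in> E (length \<omega> + n) \<longleftrightarrow> x \<in> E n"
proof
  have pos: "0 < \<rho> ^ (length \<omega> + n)" using rho_pos by simp
  assume "\<phi> \<omega> x \<in> E (length \<omega> + n)"
  then consider "\<phi> \<omega> x \<in> pts (length \<omega> + n)"
    | y where "y \<in> pts (length \<omega> + n)" "\<phi> \<omega> x = y + \<rho> ^ (length \<omega> + n)"
    unfolding E_eq by blast
  then show "x \<in> E n"
  proof cases
    case 1
    then obtain y' where "y' \<in> pts n" "\<phi> \<omega> x = \<phi> \<omega> y'"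
      by (rule pts_transport[OF \<omega> n _ x]) (use pos in auto)
    then show ?thesis by (simp add: E_eq \<phi>_eq_iff)
  next
    case 2
    obtain y' where y': "y' \<in> pts n" "y = \<phi> \<omega> y'"
      by (rule pts_transport[OF \<omega> n 2(1) x]) (use pos 2(2) in auto)
    have "\<phi> \<omega> x = \<phi> \<omega> (y' + \<rho> ^ n)" using 2(2) y'(2) \<phi>_add[of \<omega> y' n 1] by simp
    then show ?thesis using y'(1) by (auto simp: E_eq \<phi>_eq_iff)
  qed
next
  assume "x \<in> E n"
  then consider "x \<in> pts n" | y where "y \<in> pts n" "x = y + \<rho> ^ n" unfolding E_eq by blast
  then show "\<phi> \<omega> x \<in> E (length \<omega> + n)"
  proof cases
    case 1
    then show ?thesis using \<phi>_pts[OF \<omega>] by (auto simp: E_eq)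
  next
    case 2
    have "\<phi> \<omega> x = \<phi> \<omega> y + \<rho> ^ (length \<omega> + n)" using 2(2) \<phi>_add[of \<omega> y n 1] by simp
    then show ?thesis using \<phi>_pts[OF \<omega> 2(1)] by (auto simp: E_eq)
  qed
qed

lemma K_transport:
  assumes \<omega>: "set \<omega> \<subseteq> {..m}" and x: "x \<in> T"
  shows "\<phi> \<omega> x \<in> K \<longleftrightarrow> x \<in> K"
proof
  assume "x \<in> K"
  then show "\<phi> \<omega> x \<in> K" unfolding \<phi>_def using \<omega> by (intro word_map_W_K) (auto simp: ifs_words_def)
next
  assume "\<phi> \<omega> x \<in> K"
  then obtain \<tau> y where \<tau>: "\<tau> \<in> W (length \<omega> + k\<^sub>0)" "y \<in> K" "\<phi> \<omega> x = c \<tau> + \<rho> ^ (length \<omega> + k\<^sub>0) * y"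
    using K_decompose by blast
  have "0 \<le> y" "y \<le> 1" using \<tau>(2) K_subset by auto
  then have "0 \<le> \<rho> ^ (length \<omega> + k\<^sub>0) * y" "\<rho> ^ (length \<omega> + k\<^sub>0) * y \<le> \<rho> ^ (length \<omega> + k\<^sub>0)"
    using rho_pos by (auto simp: mult_left_le)
  then have "c \<tau> \<le> \<phi> \<omega> x" "\<phi> \<omega> x \<le> c \<tau> + \<rho> ^ (length \<omega> + k\<^sub>0)" using \<tau>(3) by linarith+
  then obtain y' where y': "y' \<in> pts k\<^sub>0" "c \<tau> = \<phi> \<omega> y'"
    using pts_transport[OF \<omega> order_refl ptsI[OF \<tau>(1)] x] by blast
  then obtain \<sigma> where \<sigma>: "\<sigma> \<in> W k\<^sub>0" "y' = c \<sigma>" by (blast elim: ptsE)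
  have "x = y' + \<rho> ^ k\<^sub>0 * y" using \<tau>(3) y'(2) by (simp add: \<phi>_add \<phi>_eq_iff)
  then show "x \<in> K" using word_map_W_K[OF \<sigma>(1) \<tau>(2)] \<sigma>(2) by simp
qed

lemma net_transport:
  assumes \<omega>: "set \<omega> \<subseteq> {..m}" and n: "k\<^sub>0 \<le> n" and ab: "a \<in> T" "b \<in> T"
  shows "(\<phi> \<omega> a, \<phi> \<omega> b) \<in> net (length \<omega> + n) \<longleftrightarrow> (a, b) \<in> net n"
proof -
  have img: "{\<phi> \<omega> a<..<\<phi> \<omega> b} = \<phi> \<omega> ` {a<..<b}"
  proof (intro equalityI subsetI)
    fix y assume "y \<in> {\<phi> \<omega> a<..<\<phi> \<omega> b}"
    moreover obtain x where "y = \<phi> \<omega> x" using \<phi>_surj by blast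
    ultimately show "y \<in> \<phi> \<omega> ` {a<..<b}" by (auto simp: \<phi>_less_iff)
  qed (auto simp: \<phi>_less_iff)
  have sub: "{a<..<b} \<subseteq> T" using ab by (auto simp: T_def)
  have "{\<phi> \<omega> a<..<\<phi> \<omega> b} \<inter> E (length \<omega> + n) = {} \<longleftrightarrow> {a<..<b} \<inter> E n = {}"
    unfolding img using E_transport[OF \<omega> n] sub by blast
  moreover have "{\<phi> \<omega> a<..<\<phi> \<omega> b} \<inter> K = {} \<longleftrightarrow> {a<..<b} \<inter> K = {}"
    unfolding img using K_transport[OF \<omega>] sub by blast
  ultimately show ?thesis unfolding net_iff using E_transport[OF \<omega> n] ab by (auto simp: \<phi>_less_iff)
qed

lemma word_map_image: "\<sigma> \<in> W n \<Longrightarrow> word_map \<rho> d \<sigma> ` {0..1} = {c \<sigma>..c \<sigma> + \<rho> ^ n}"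
proof -
  assume \<sigma>: "\<sigma> \<in> W n"
  have "word_map \<rho> d \<sigma> x = \<rho> ^ n * x + c \<sigma>" for x
    using word_map_eq[of \<rho> d \<sigma> x] W_length[OF \<sigma>] by (simp only:)
  then have "word_map \<rho> d \<sigma> ` {0..1} = (\<lambda>x. \<rho> ^ n * x + c \<sigma>) ` {0..1}"
    by (rule image_cong[OF refl])
  also have "\<dots> = {c \<sigma>..c \<sigma> + \<rho> ^ n}"
    using rho_pos by (subst image_affinity_atLeastAtMost) (auto simp: add.commute)
  finally show ?thesis .
qed

lemma neighbours_eq:
  assumes "fst \<Delta> \<le> snd \<Delta>"
  shows "neighbours m \<rho> d n \<Delta> = sorted_list_of_set
    ((\<lambda>y. (fst \<Delta> - y) / \<rho> ^ n) ` {y \<in> pts n. y \<le> fst \<Delta> \<and> snd \<Delta> \<le> y + \<rho> ^ n})"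
proof -
  have iff: "{fst \<Delta>..snd \<Delta>} \<subseteq> word_map \<rho> d \<sigma> ` {0..1} \<longleftrightarrow> c \<sigma> \<le> fst \<Delta> \<and> snd \<Delta> \<le> c \<sigma> + \<rho> ^ n"
    if \<sigma>: "\<sigma> \<in> W n" for \<sigma>
    using assms unfolding word_map_image[OF \<sigma>] by auto
  have "{(fst \<Delta> - c \<sigma>) / \<rho> ^ n |\<sigma>. \<sigma> \<in> W n \<and> {fst \<Delta>..snd \<Delta>} \<subseteq> word_map \<rho> d \<sigma> ` {0..1}} =
      (\<lambda>y. (fst \<Delta> - y) / \<rho> ^ n) ` {y \<in> pts n. y \<le> fst \<Delta> \<and> snd \<Delta> \<le> y + \<rho> ^ n}"
    using iff by (auto simp: pts_def)
  then show ?thesis by (simp add: neighbours_def)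
qed

lemma neighbours_transport:
  assumes \<omega>: "set \<omega> \<subseteq> {..m}" and n: "k\<^sub>0 \<le> n" and ab: "a \<in> T" "b \<in> T" "a \<le> b"
  shows "neighbours m \<rho> d (length \<omega> + n) (\<phi> \<omega> a, \<phi> \<omega> b) = neighbours m \<rho> d n (a, b)"
proof -
  let ?N = "length \<omega> + n"
  have "{y \<in> pts ?N. y \<le> \<phi> \<omega> a \<and> \<phi> \<omega> b \<le> y + \<rho> ^ ?N} = \<phi> \<omega> ` {y \<in> pts n. y \<le> a \<and> b \<le> y + \<rho> ^ n}"
    (is "?L = ?R")
  proof (intro equalityI subsetI)
    fix y assume y: "y \<in> ?L"
    have "\<phi> \<omega> a \<le> \<phi> \<omega> b" using ab by (simp add: \<phi>_le_iff)
    then obtain y' where y': "y' \<in> pts n" "y = \<phi> \<omega> y'"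
      using y by (elim CollectE conjE) (rule pts_transport[OF \<omega> n _ ab(1)], auto)
    moreover have "y' \<le> a" "b \<le> y' + \<rho> ^ n"
      using y y'(2) \<phi>_add[of \<omega> y' n 1] by (auto simp: \<phi>_le_iff)
    ultimately show "y \<in> ?R" by blast
  next
    fix y assume "y \<in> ?R"
    then obtain y' where y': "y' \<in> pts n" "y' \<le> a" "b \<le> y' + \<rho> ^ n" "y = \<phi> \<omega> y'" by blast
    then show "y \<in> ?L" using \<phi>_add[of \<omega> y' n 1] \<phi>_pts[OF \<omega>] by (auto simp: \<phi>_le_iff)
  qed
  moreover have "(\<phi> \<omega> a - \<phi> \<omega> y) / \<rho> ^ ?N = (a - y) / \<rho> ^ n" for y
    using rho_pos by (simp add: \<phi>_def power_add divide_simps algebra_simps)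
  ultimately show ?thesis using ab(3) by (simp add: neighbours_eq \<phi>_le_iff image_image)
qed

lemma norm_length_transport:
  "norm_length \<rho> (length \<omega> + n) (\<phi> \<omega> a, \<phi> \<omega> b) = norm_length \<rho> n (a, b)"
  using rho_pos by (simp add: norm_length_def \<phi>_def power_add divide_simps algebra_simps)

text \<open>This keeps the parent of a net interval in \<open>T\<close> inside \<open>T\<close>,
  where the transport lemmas apply: the ends of \<open>T\<close> are endpoints already at level
  \<open>k\<^sub>0\<close>.\<close>

lemma net_below:
  assumes "(u, v) \<in> net j" "u \<le> a" "a < b" "b \<le> v"
    "i \<le> j" "e \<in> E i" "e' \<in> E i" "e \<le> a" "b \<le> e'"
  shows "e \<le> u \<and> v \<le> e'"
  using net_sep[OF assms(1,5,6)] net_sep[OF assms(1,5,7)] assms by linarith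

lemma T_ends: "c \<omega>\<^sub>0 \<in> E k\<^sub>0" "c \<omega>\<^sub>0 + \<rho> ^ k\<^sub>0 \<in> E k\<^sub>0"
  using ptsI[of \<omega>\<^sub>0 k\<^sub>0] set_\<omega>\<^sub>0 by (auto simp: E_eq ifs_words_def)

lemma net_child_iff:
  "net_child m \<rho> d K j (u, v) (a, b) \<longleftrightarrow> (u, v) \<in> net j \<and> (a, b) \<in> net (Suc j) \<and> u \<le> a \<and> b \<le> v"
  by (auto simp: net_child_def net_iff)

text \<open>Siblings range over the whole parent, so the parent too must lie in \<open>T\<close>.
  This is guaranteed once its level \<open>n\<close> is at least \<open>k\<^sub>0\<close>, which is
  why characteristic vectors are transported at level \<open>Suc k\<^sub>0\<close>.\<close>

lemma sibling_position_transport: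
  assumes \<omega>: "set \<omega> \<subseteq> {..m}" and n: "k\<^sub>0 \<le> n" and ab: "(a, b) \<in> net (Suc n)" "a \<in> T" "b \<in> T"
  shows "sibling_position m \<rho> d K (length \<omega> + Suc n) (\<phi> \<omega> a, \<phi> \<omega> b) =
    sibling_position m \<rho> d K (Suc n) (a, b)"
proof -
  let ?l = "length \<omega>"
  define S where "S = {\<Delta>'. (\<exists>P. net_child m \<rho> d K n P (a, b) \<and> net_child m \<rho> d K n P \<Delta>') \<and>
    norm_length \<rho> (Suc n) \<Delta>' = norm_length \<rho> (Suc n) (a, b) \<and> fst \<Delta>' \<le> a}"
  define S' where "S' = {\<Delta>'. (\<exists>P. net_child m \<rho> d K (?l + n) P (\<phi> \<omega> a, \<phi> \<omega> b) \<and>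
      net_child m \<rho> d K (?l + n) P \<Delta>') \<and>
    norm_length \<rho> (?l + Suc n) \<Delta>' = norm_length \<rho> (?l + Suc n) (\<phi> \<omega> a, \<phi> \<omega> b) \<and> fst \<Delta>' \<le> \<phi> \<omega> a}"
  have less: "a < b" using ab(1) by (simp add: net_iff)
  have parent_T: "u \<in> T" "v \<in> T" if uv: "(u, v) \<in> net n" "u \<le> a" "b \<le> v" for u v
    using net_below[OF uv(1,2) less uv(3) n T_ends] uv(2,3) ab(2,3) less by (auto simp: T_def)
  have net\<phi>: "(\<phi> \<omega> x, \<phi> \<omega> y) \<in> net (?l + n) \<longleftrightarrow> (x, y) \<in> net n"
      "(\<phi> \<omega> x, \<phi> \<omega> y) \<in> net (Suc (?l + n)) \<longleftrightarrow> (x, y) \<in> net (Suc n)"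
    if "x \<in> T" "y \<in> T" for x y
    using net_transport[OF \<omega> _ that, of n] net_transport[OF \<omega> _ that, of "Suc n"] n by auto
  have "S' = map_prod (\<phi> \<omega>) (\<phi> \<omega>) ` S"
  proof (intro equalityI subsetI)
    fix \<Delta>' assume "\<Delta>' \<in> map_prod (\<phi> \<omega>) (\<phi> \<omega>) ` S"
    then obtain a' b' where *: "\<Delta>' = (\<phi> \<omega> a', \<phi> \<omega> b')" "(a', b') \<in> S" by auto
    then obtain u v where uv: "net_child m \<rho> d K n (u, v) (a, b)" "net_child m \<rho> d K n (u, v) (a', b')"
        "norm_length \<rho> (Suc n) (a', b') = norm_length \<rho> (Suc n) (a, b)" "a' \<le> a"
      unfolding S_def by auto
    then have T: "u \<in> T" "v \<in> T" using parent_T by (auto simp: net_child_iff)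
    have "u \<le> a'" "a' < b'" "b' \<le> v" using uv(2) by (simp_all add: net_child_iff net_iff)
    then have T': "a' \<in> T" "b' \<in> T" using T by (auto simp: T_def)
    have "net_child m \<rho> d K (?l + n) (\<phi> \<omega> u, \<phi> \<omega> v) (\<phi> \<omega> a, \<phi> \<omega> b)"
        "net_child m \<rho> d K (?l + n) (\<phi> \<omega> u, \<phi> \<omega> v) (\<phi> \<omega> a', \<phi> \<omega> b')"
      using uv(1,2) net\<phi> T T' ab by (auto simp: net_child_iff \<phi>_le_iff)
    then show "\<Delta>' \<in> S'"
      unfolding S'_def *(1) using uv(3,4) by (auto simp: norm_length_transport \<phi>_le_iff simp del: add_Suc_right)
  next
    fix \<Delta>' assume "\<Delta>' \<in> S'"
    then obtain P where P: "net_child m \<rho> d K (?l + n) P (\<phi> \<omega> a, \<phi> \<omega> b)"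
        "net_child m \<rho> d K (?l + n) P \<Delta>'"
        "norm_length \<rho> (?l + Suc n) \<Delta>' = norm_length \<rho> (?l + Suc n) (\<phi> \<omega> a, \<phi> \<omega> b)" "fst \<Delta>' \<le> \<phi> \<omega> a"
      unfolding S'_def by blast
    obtain u v where uv: "P = (\<phi> \<omega> u, \<phi> \<omega> v)" using \<phi>_surj by (metis surj_pair)
    obtain a' b' where ab': "\<Delta>' = (\<phi> \<omega> a', \<phi> \<omega> b')" using \<phi>_surj by (metis surj_pair)
    have le: "u \<le> a" "b \<le> v" "u \<le> a'" "b' \<le> v" "a' < b'"
      using P(1,2) unfolding uv ab' by (auto simp: net_child_iff \<phi>_le_iff \<phi>_less_iff net_iff)
    \<comment> \<open>The converse inclusion starts from a parent on the side of the copy; to pull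
      it back, the ends of the copied \<open>T\<close> must stop it as well.\<close>
    have T_ends': "\<phi> \<omega> (c \<omega>\<^sub>0) \<in> E (?l + k\<^sub>0)" "\<phi> \<omega> (c \<omega>\<^sub>0 + \<rho> ^ k\<^sub>0) \<in> E (?l + k\<^sub>0)"
      using T_ends E_transport[OF \<omega> order_refl] rho_pos by (auto simp: T_def)
    have "(\<phi> \<omega> u, \<phi> \<omega> v) \<in> net (?l + n)" using P(1) unfolding uv by (simp add: net_child_iff)
    then have "\<phi> \<omega> (c \<omega>\<^sub>0) \<le> \<phi> \<omega> u \<and> \<phi> \<omega> v \<le> \<phi> \<omega> (c \<omega>\<^sub>0 + \<rho> ^ k\<^sub>0)"
      by (rule net_below[where a = "\<phi> \<omega> a" and b = "\<phi> \<omega> b" and i = "?l + k\<^sub>0"])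
         (use le less n T_ends' ab in \<open>auto simp: \<phi>_le_iff \<phi>_less_iff T_def\<close>)
    then have T: "u \<in> T" "v \<in> T" using le less ab by (auto simp: \<phi>_le_iff T_def)
    then have T': "a' \<in> T" "b' \<in> T" using le by (auto simp: T_def)
    have "net_child m \<rho> d K n (u, v) (a, b)" "net_child m \<rho> d K n (u, v) (a', b')"
      using P(1,2) net\<phi> T T' ab unfolding uv ab' by (auto simp: net_child_iff \<phi>_le_iff)
    then have "(a', b') \<in> S"
      unfolding S_def using P(3,4) unfolding ab' by (auto simp: norm_length_transport \<phi>_le_iff simp del: add_Suc_right)
    then show "\<Delta>' \<in> map_prod (\<phi> \<omega>) (\<phi> \<omega>) ` S" unfolding ab' by force
  qed
  moreover have "inj_on (map_prod (\<phi> \<omega>) (\<phi> \<omega>)) S" by (auto simp: inj_on_def \<phi>_eq_iff)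
  ultimately have "card S' = card S" by (simp add: card_image)
  then show ?thesis by (simp add: sibling_position_def S_def S'_def)
qed

lemma char_transport:
  assumes \<omega>: "set \<omega> \<subseteq> {..m}" and ab: "(a, b) \<in> net (Suc k\<^sub>0)" "a \<in> T" "b \<in> T"
  shows "char (length \<omega> + Suc k\<^sub>0) (\<phi> \<omega> a, \<phi> \<omega> b) = char (Suc k\<^sub>0) (a, b)"
proof -
  have "a \<le> b" using ab(1) by (simp add: net_iff)
  then show ?thesis
    using norm_length_transport[of \<omega> "Suc k\<^sub>0" a b] neighbours_transport[OF \<omega> _ ab(2,3), of "Suc k\<^sub>0"]
      sibling_position_transport[OF \<omega> order_refl ab]
    by (simp add: char_vector_def del: add_Suc_right)
qed

text \<open>The cylinder of \<open>\<omega>\<^sub>0\<close> contains infinitely many points of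
  \<open>K\<close>, and only finitely many are endpoints; the net interval around any other one
  cannot cross the ends of \<open>T\<close>.\<close>

lemma ex_net_in_T: "\<exists>a b. (a, b) \<in> net (Suc k\<^sub>0) \<and> a \<in> T \<and> b \<in> T"
proof -
  have W: "\<omega>\<^sub>0 \<in> W k\<^sub>0" using set_\<omega>\<^sub>0 by (simp add: ifs_words_def)
  have "inj_on (\<phi> \<omega>\<^sub>0) K" by (simp add: inj_on_def \<phi>_eq_iff)
  then have "infinite (\<phi> \<omega>\<^sub>0 ` K)" using infinite_K finite_imageD by blast
  then obtain x where x: "x \<in> \<phi> \<omega>\<^sub>0 ` K" "x \<notin> E (Suc k\<^sub>0)"
    using finite_E by (meson finite_subset subsetI)
  then obtain y where y: "y \<in> K" "x = c \<omega>\<^sub>0 + \<rho> ^ k\<^sub>0 * y" by (auto simp: \<phi>_def)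
  have "x \<in> K" using word_map_W_K[OF W y(1)] y(2) by simp
  then obtain a b where ab: "(a, b) \<in> net (Suc k\<^sub>0)" "a < x" "x < b" using net_exists x(2) by blast
  have "0 \<le> y" "y \<le> 1" using y(1) K_subset by auto
  then have "0 \<le> \<rho> ^ k\<^sub>0 * y" "\<rho> ^ k\<^sub>0 * y \<le> \<rho> ^ k\<^sub>0" using rho_pos by (auto simp: mult_left_le)
  then have "c \<omega>\<^sub>0 \<le> a" "b \<le> c \<omega>\<^sub>0 + \<rho> ^ k\<^sub>0"
    using net_sep[OF ab(1) _ T_ends(1)] net_sep[OF ab(1) _ T_ends(2)] ab y(2) by linarith+
  then show ?thesis using ab by (intro exI[of _ a] exI[of _ b]) (auto simp: T_def)
qed


subsection \<open>The essential class\<close>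

definition \<Delta>\<^sub>1 :: "real \<times> real" where
  "\<Delta>\<^sub>1 = (SOME \<Delta>. \<Delta> \<in> net (Suc k\<^sub>0) \<and> fst \<Delta> \<in> T \<and> snd \<Delta> \<in> T)"

definition \<alpha>\<^sub>1 :: char_vec where "\<alpha>\<^sub>1 = char (Suc k\<^sub>0) \<Delta>\<^sub>1"

lemma \<Delta>\<^sub>1: "(fst \<Delta>\<^sub>1, snd \<Delta>\<^sub>1) \<in> net (Suc k\<^sub>0)" "fst \<Delta>\<^sub>1 \<in> T" "snd \<Delta>\<^sub>1 \<in> T"
proof -
  have "\<exists>\<Delta>. \<Delta> \<in> net (Suc k\<^sub>0) \<and> fst \<Delta> \<in> T \<and> snd \<Delta> \<in> T" using ex_net_in_T by fastforce
  from someI_ex[OF this] show "(fst \<Delta>\<^sub>1, snd \<Delta>\<^sub>1) \<in> net (Suc k\<^sub>0)" "fst \<Delta>\<^sub>1 \<in> T" "snd \<Delta>\<^sub>1 \<in> T"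
    unfolding \<Delta>\<^sub>1_def by auto
qed

text \<open>Every net interval contains a copy of \<open>\<Delta>\<^sub>1\<close> with the same characteristic vector, so this vector
  is reachable from everywhere and the vectors reachable from it form the only essential class.\<close>

lemma reaches_\<alpha>\<^sub>1:
  assumes "\<alpha> \<in> char_vectors m \<rho> d K"
  shows "child\<^sup>*\<^sup>* \<alpha> \<alpha>\<^sub>1"
proof -
  obtain n a b where ab: "(a, b) \<in> net n" "\<alpha> = char n (a, b)"
    using assms by (auto simp: char_vectors_def)
  then obtain x where "x \<in> K" "a < x" "x < b" by (auto simp: net_iff)
  then obtain \<omega> where \<omega>: "set \<omega> \<subseteq> {..m}" "n \<le> length \<omega>" "a < c \<omega>" "c \<omega> + \<rho> ^ length \<omega> < b"
    using cylinder_inside by blast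
  let ?a = "fst \<Delta>\<^sub>1" and ?b = "snd \<Delta>\<^sub>1"
  have "0 \<le> c \<omega>\<^sub>0" "c \<omega>\<^sub>0 + \<rho> ^ k\<^sub>0 \<le> 1" using c_bounds[OF set_\<omega>\<^sub>0] by auto
  then have "\<phi> \<omega> 0 \<le> \<phi> \<omega> ?a" "\<phi> \<omega> ?b \<le> \<phi> \<omega> 1" using \<Delta>\<^sub>1 unfolding \<phi>_le_iff T_def by auto
  then have in_ab: "a \<le> \<phi> \<omega> ?a" "\<phi> \<omega> ?b \<le> b" using \<omega> by (auto simp: \<phi>_def)
  obtain j where j: "length \<omega> + Suc k\<^sub>0 = n + j" using \<omega>(2) by (metis le_Suc_ex add.assoc)
  have "(\<phi> \<omega> ?a, \<phi> \<omega> ?b) \<in> net (n + j)"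
    using net_transport[OF \<omega>(1) _ \<Delta>\<^sub>1(2,3), of "Suc k\<^sub>0"] \<Delta>\<^sub>1(1) unfolding j by simp
  then have "child\<^sup>*\<^sup>* (char n (a, b)) (char (n + j) (\<phi> \<omega> ?a, \<phi> \<omega> ?b))"
    using in_ab by (intro net_descendant[OF ab(1)])
  moreover have "char (n + j) (\<phi> \<omega> ?a, \<phi> \<omega> ?b) = \<alpha>\<^sub>1"
    using char_transport[OF \<omega>(1) \<Delta>\<^sub>1] by (simp add: \<alpha>\<^sub>1_def flip: j)
  ultimately show ?thesis using ab(2) by simp
qed

lemma \<alpha>\<^sub>1_char_vector: "\<alpha>\<^sub>1 \<in> char_vectors m \<rho> d K"
proof -
  have "\<Delta>\<^sub>1 \<in> net (Suc k\<^sub>0)" using \<Delta>\<^sub>1(1) by simp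
  then show ?thesis unfolding \<alpha>\<^sub>1_def char_vectors_def by blast
qed

lemma child_char_vector: "child \<alpha> \<beta> \<Longrightarrow> \<beta> \<in> char_vectors m \<rho> d K"
  by (auto simp: char_child_def char_vectors_def net_child_def)

lemma reachable_char_vector: "child\<^sup>*\<^sup>* \<alpha> \<beta> \<Longrightarrow> \<alpha> \<in> char_vectors m \<rho> d K \<Longrightarrow> \<beta> \<in> char_vectors m \<rho> d K"
  by (induction rule: rtranclp_induct) (auto dest: child_char_vector)

lemma path_exists:
  assumes "child\<^sup>*\<^sup>* \<alpha> \<beta>" "\<alpha> \<in> char_vectors m \<rho> d K"
  shows "\<exists>\<gamma>. admissible_path m \<rho> d K \<gamma> \<and> hd \<gamma> = \<alpha> \<and> last \<gamma> = \<beta> \<and> (\<forall>\<delta>\<in>set \<gamma>. child\<^sup>*\<^sup>* \<alpha> \<delta>)"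
  using rtranclp_imp_successively[OF assms(1)] reachable_char_vector[OF _ assms(2)]
  unfolding admissible_path_def by blast

text \<open>Everything reachable from \<open>\<alpha>\<^sub>1\<close> leads back to it, so the
  reachable set is a loop class closed under children. Conversely, a class closed under children
  contains \<open>\<alpha>\<^sub>1\<close> and all it reaches, and the paths inside a loop class
  give the other inclusion.\<close>

lemma essential_class_eq: "essential_class m \<rho> d K = {\<beta>. child\<^sup>*\<^sup>* \<alpha>\<^sub>1 \<beta>}" (is "_ = ?L")
  unfolding essential_class_def
proof (rule the_equality)
  have char: "\<beta> \<in> char_vectors m \<rho> d K" if "\<beta> \<in> ?L" for \<beta>
    using that reachable_char_vector \<alpha>\<^sub>1_char_vector by blast
  have "\<exists>\<gamma>. admissible_path m \<rho> d K \<gamma> \<and> hd \<gamma> = \<alpha> \<and> last \<gamma> = \<beta> \<and> set \<gamma> \<subseteq> ?L"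
    if \<alpha>\<beta>: "\<alpha> \<in> ?L" "\<beta> \<in> ?L" for \<alpha> \<beta>
  proof -
    have "child\<^sup>*\<^sup>* \<alpha> \<beta>" using rtranclp_trans[OF reaches_\<alpha>\<^sub>1[OF char[OF \<alpha>\<beta>(1)]]] \<alpha>\<beta>(2) by simp
    then obtain \<gamma> where \<gamma>: "admissible_path m \<rho> d K \<gamma>" "hd \<gamma> = \<alpha>" "last \<gamma> = \<beta>" "\<forall>\<delta>\<in>set \<gamma>. child\<^sup>*\<^sup>* \<alpha> \<delta>"
      using path_exists[OF _ char[OF \<alpha>\<beta>(1)]] by blast
    have "set \<gamma> \<subseteq> ?L" using \<gamma>(4) \<alpha>\<beta>(1) by (auto intro: rtranclp_trans)
    with \<gamma> show ?thesis by blast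
  qed
  moreover have "?L \<noteq> {}" by blast
  ultimately have "loop_class m \<rho> d K ?L" unfolding loop_class_def using char by blast
  then show "is_essential_class m \<rho> d K ?L"
    unfolding is_essential_class_def by (auto intro: rtranclp.rtrancl_into_rtrancl)
next
  fix L' assume L': "is_essential_class m \<rho> d K L'"
  then have loop: "L' \<noteq> {}" "L' \<subseteq> char_vectors m \<rho> d K"
      "\<And>\<alpha> \<beta>. \<alpha> \<in> L' \<Longrightarrow> \<beta> \<in> L' \<Longrightarrow> \<exists>\<gamma>. admissible_path m \<rho> d K \<gamma> \<and> hd \<gamma> = \<alpha> \<and> last \<gamma> = \<beta> \<and> set \<gamma> \<subseteq> L'"
    and closed: "\<And>\<alpha> \<beta>. \<alpha> \<in> L' \<Longrightarrow> child \<alpha> \<beta> \<Longrightarrow> \<beta> \<in> L'"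
    unfolding is_essential_class_def loop_class_def by auto
  have closed': "child\<^sup>*\<^sup>* \<alpha> \<beta> \<Longrightarrow> \<alpha> \<in> L' \<Longrightarrow> \<beta> \<in> L'" for \<alpha> \<beta>
    by (induction rule: rtranclp_induct) (auto intro: closed)
  obtain \<alpha> where "\<alpha> \<in> L'" using loop(1) by blast
  then have "\<alpha>\<^sub>1 \<in> L'" using loop(2) reaches_\<alpha>\<^sub>1 closed' by blast
  show "L' = ?L"
  proof (intro equalityI subsetI)
    fix \<beta> assume "\<beta> \<in> L'"
    then obtain \<gamma> where \<gamma>: "admissible_path m \<rho> d K \<gamma>" "hd \<gamma> = \<alpha>\<^sub>1" "last \<gamma> = \<beta>"
      using loop(3)[OF \<open>\<alpha>\<^sub>1 \<in> L'\<close>] by blast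
    then show "\<beta> \<in> ?L" using successively_imp_rtranclp[of \<gamma> child] unfolding admissible_path_def by auto
  next
    fix \<beta> assume "\<beta> \<in> ?L"
    then show "\<beta> \<in> L'" using closed' \<open>\<alpha>\<^sub>1 \<in> L'\<close> by blast
  qed
qed

lemma essential_descendant:
  assumes "(a, b) \<in> net n" "Suc k\<^sub>0 \<le> n" "fst \<Delta>\<^sub>1 \<le> a" "b \<le> snd \<Delta>\<^sub>1"
  shows "essential_net_interval m \<rho> d K n (a, b)"
proof -
  obtain j where j: "n = Suc k\<^sub>0 + j" using assms(2) le_Suc_ex by blast
  have "child\<^sup>*\<^sup>* (char (Suc k\<^sub>0) (fst \<Delta>\<^sub>1, snd \<Delta>\<^sub>1)) (char (Suc k\<^sub>0 + j) (a, b))"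
    using assms unfolding j by (intro net_descendant[OF \<Delta>\<^sub>1(1)])
  then show ?thesis using assms(1) j by (simp add: essential_net_interval_def essential_class_eq \<alpha>\<^sub>1_def)
qed

text \<open>The point constructed later as a limit may or may not be a boundary point, so both cases
  are covered. A boundary point inside \<open>\<Delta>\<^sub>1\<close> is an endpoint only at finer
  levels, where the net intervals on both sides of it lie in \<open>\<Delta>\<^sub>1\<close> and are
  therefore essential.\<close>

lemma truly_essential_in_\<Delta>\<^sub>1:
  assumes "x \<in> K" "fst \<Delta>\<^sub>1 < x" "x < snd \<Delta>\<^sub>1"
  shows "truly_essential m \<rho> d K x"
proof (cases "boundary_point m \<rho> d K x")
  case False
  have "essential_net_interval m \<rho> d K (Suc k\<^sub>0) (fst \<Delta>\<^sub>1, snd \<Delta>\<^sub>1)"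
    by (rule essential_descendant[OF \<Delta>\<^sub>1(1)]) auto
  then show ?thesis
    using False assms unfolding truly_essential_def interior_essential_def
    by (metis fst_conv snd_conv greaterThanLessThan_iff)
next
  case True
  then obtain n a b where ab: "(a, b) \<in> net n" "x = a \<or> x = b" by (auto simp: boundary_point_def)
  then have x_E: "x \<in> E n" by (auto simp: net_iff)
  have n: "Suc k\<^sub>0 \<le> n"
  proof (rule ccontr)
    assume "\<not> Suc k\<^sub>0 \<le> n"
    then have "x \<le> fst \<Delta>\<^sub>1 \<or> snd \<Delta>\<^sub>1 \<le> x" by (intro net_sep[OF \<Delta>\<^sub>1(1) _ x_E]) simp
    then show False using assms by simp
  qed
  have ess: "essential_net_interval m \<rho> d K n (u, v)" if uv: "(u, v) \<in> net n" "x = u \<or> x = v" for u v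
  proof -
    have "fst \<Delta>\<^sub>1 \<in> E (Suc k\<^sub>0)" "snd \<Delta>\<^sub>1 \<in> E (Suc k\<^sub>0)" "u < v" using \<Delta>\<^sub>1(1) uv(1) unfolding net_iff by auto
    then have "fst \<Delta>\<^sub>1 \<le> u" "v \<le> snd \<Delta>\<^sub>1"
      using net_sep[OF uv(1) n, of "fst \<Delta>\<^sub>1"] net_sep[OF uv(1) n, of "snd \<Delta>\<^sub>1"] uv(2) assms by linarith+
    then show ?thesis by (rule essential_descendant[OF uv(1) n])
  qed
  have "boundary_essential m \<rho> d K x"
    unfolding boundary_essential_def
  proof (intro conjI exI[of _ n] bexI[of _ "(a, b)"] ballI impI)
    fix \<Delta>' assume "\<Delta>' \<in> net n"
      "(x = fst (a, b) \<and> x = snd \<Delta>') \<or> (x = snd (a, b) \<and> x = fst \<Delta>')"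
    then show "essential_net_interval m \<rho> d K n \<Delta>'" using ess[of "fst \<Delta>'" "snd \<Delta>'"] by auto
  qed (use assms ab ess in auto)
  then show ?thesis by (simp add: truly_essential_def)
qed

lemma \<Delta>\<^sub>1_cylinder:
  obtains \<omega> where "set \<omega> \<subseteq> {..m}" "fst \<Delta>\<^sub>1 < c \<omega>" "c \<omega> + \<rho> ^ length \<omega> < snd \<Delta>\<^sub>1"
proof -
  obtain x where "x \<in> K" "fst \<Delta>\<^sub>1 < x" "x < snd \<Delta>\<^sub>1" using \<Delta>\<^sub>1(1) unfolding net_iff by auto
  then show thesis using cylinder_inside that by blast
qed

end


subsection \<open>Quasi-multiplicativity of cylinder weights\<close>

locale finite_type_measure = finite_type_ifs +
  fixes p :: "nat \<Rightarrow> real" and \<mu> :: "real measure"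
  assumes p_pos: "\<And>j. j \<le> m \<Longrightarrow> p j > 0" and p_sum: "(\<Sum>j\<le>m. p j) = 1"
    and self_similar: "self_similar_measure m \<rho> d p \<mu>"
begin

definition pw :: "nat list \<Rightarrow> real" where "pw \<sigma> = prod_list (map p \<sigma>)"

definition wt :: "nat \<Rightarrow> real \<Rightarrow> real" where
  "wt n y = (\<Sum>\<tau>\<in>W n. if c \<tau> = y then pw \<tau> else 0)"

definition f :: "nat list \<Rightarrow> real" where "f \<sigma> = wt (length \<sigma>) (c \<sigma>)"

lemma pw_append: "pw (\<sigma> @ \<tau>) = pw \<sigma> * pw \<tau>"
  by (simp add: pw_def)

lemma pw_pos: "set \<sigma> \<subseteq> {..m} \<Longrightarrow> pw \<sigma> > 0"
  by (induction \<sigma>) (auto simp: pw_def p_pos)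

lemma pw_W_pos: "\<sigma> \<in> W n \<Longrightarrow> pw \<sigma> > 0"
  by (auto simp: ifs_words_def pw_pos)

lemma sum_pw: "(\<Sum>\<sigma>\<in>W n. pw \<sigma>) = 1"
proof (induction n)
  case (Suc n)
  have "(\<Sum>\<sigma>\<in>W (Suc n). pw \<sigma>) = (\<Sum>\<sigma>\<in>W n. pw \<sigma> * (\<Sum>j\<le>m. p j))"
    unfolding sum_ifs_words_Suc by (simp add: pw_append pw_def sum_distrib_left)
  then show ?case using Suc by (simp add: p_sum)
qed (simp add: ifs_words_0 pw_def)

lemma wt_nonneg: "wt n y \<ge> 0"
  unfolding wt_def using pw_W_pos by (intro sum_nonneg) (auto intro: less_imp_le)

lemma wt_le_1: "wt n y \<le> 1"
  unfolding wt_def sum_pw[of n, symmetric] using pw_W_pos by (intro sum_mono) (auto intro: less_imp_le)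

lemma pw_le_wt: "\<sigma> \<in> W n \<Longrightarrow> pw \<sigma> \<le> wt n (c \<sigma>)"
  unfolding wt_def using pw_W_pos
  by (intro order.trans[OF _ member_le_sum[where i = \<sigma>]]) (auto simp: finite_ifs_words intro: less_imp_le)

lemma wt_pos: "y \<in> pts n \<Longrightarrow> wt n y > 0"
  using pw_le_wt pw_W_pos by (metis less_le_trans ptsE)

lemma f_pos: "set \<sigma> \<subseteq> {..m} \<Longrightarrow> f \<sigma> > 0"
  unfolding f_def by (intro wt_pos ptsI) (simp add: ifs_words_def)

lemma f_le_1: "f \<sigma> \<le> 1"
  unfolding f_def by (rule wt_le_1)

lemma sum_wt: "(\<Sum>y\<in>pts n. wt n y) = 1"
proof -
  have "(\<Sum>y\<in>pts n. wt n y) = (\<Sum>\<tau>\<in>W n. \<Sum>y\<in>pts n. if c \<tau> = y then pw \<tau> else 0)"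
    unfolding wt_def by (rule sum.swap)
  also have "\<dots> = (\<Sum>\<tau>\<in>W n. pw \<tau>)"
    by (intro sum.cong refl) (simp add: finite_pts ptsI)
  finally show ?thesis by (simp add: sum_pw)
qed

text \<open>Each pair of words counted on the left has its concatenation counted on the right;
  concatenations of other pairs may reach the same point, so equality fails in general.\<close>

lemma wt_mult_le: "wt a y * wt b z \<le> wt (a + b) (y + \<rho> ^ a * z)"
proof -
  have "wt a y * wt b z = (\<Sum>\<sigma>\<in>W a. \<Sum>\<tau>\<in>W b.
      (if c \<sigma> = y then pw \<sigma> else 0) * (if c \<tau> = z then pw \<tau> else 0))"
    by (simp add: wt_def sum_product)
  also have "\<dots> \<le> (\<Sum>\<sigma>\<in>W a. \<Sum>\<tau>\<in>W b. if c (\<sigma> @ \<tau>) = y + \<rho> ^ a * z then pw (\<sigma> @ \<tau>) else 0)"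
    using pw_W_pos
    by (intro sum_mono) (auto simp: word_map_append_0 W_length pw_append less_imp_le)
  also have "\<dots> = wt (a + b) (y + \<rho> ^ a * z)"
    unfolding wt_def sum_ifs_words_add ..
  finally show ?thesis .
qed

lemma f_mult_le: "f \<sigma> * f \<tau> \<le> f (\<sigma> @ \<tau>)"
  using wt_mult_le[of "length \<sigma>" "c \<sigma>" "length \<tau>" "c \<tau>"] by (simp add: f_def word_map_append_0)

text \<open>One term per intermediate cylinder \<open>y\<close>: the reciprocal of the weight of
  \<open>y\<close> times the weight of the way from \<open>y\<close> to the end of
  \<open>\<theta>\<close>, which is what \<open>wt_reach_bound\<close> divides by. The surrounding
  words do not occur.\<close>

definition qc :: real where
  "qc = (\<Sum>y\<in>reach u\<^sub>1. 1 / (wt k\<^sub>0 y * wt (length u\<^sub>1) ((c \<theta> - y) / \<rho> ^ k\<^sub>0)))"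

text \<open>Lengthen each half by a fixed piece: the prefix part followed by the way from
  \<open>y\<close> to \<open>\<theta>\<close> is counted in \<open>f (\<omega> @ \<theta>)\<close>,
  and \<open>y\<close> followed by the rest is counted in \<open>f (\<theta> @ \<eta>)\<close>. The
  weights of both pieces are positive because \<open>y\<close> lies in
  \<open>reach u\<^sub>1\<close>.\<close>

lemma wt_reach_bound:
  assumes "y \<in> reach u\<^sub>1" "set \<omega> \<subseteq> {..m}" "set \<eta> \<subseteq> {..m}"
  shows "wt (length \<omega> + k\<^sub>0) (c \<omega> + \<rho> ^ length \<omega> * y) *
      wt (length u\<^sub>1 + length \<eta>) ((c (\<theta> @ \<eta>) - y) / \<rho> ^ k\<^sub>0) \<le>
    1 / (wt k\<^sub>0 y * wt (length u\<^sub>1) ((c \<theta> - y) / \<rho> ^ k\<^sub>0)) * (f (\<omega> @ \<theta>) * f (\<theta> @ \<eta>))"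
proof -
  obtain v where v: "y \<in> near \<omega>\<^sub>0" "v \<in> W (length u\<^sub>1)" "y + \<rho> ^ k\<^sub>0 * c v = c \<theta>"
    using assms(1) unfolding reach_def \<theta>_def by blast
  let ?z = "(c (\<theta> @ \<eta>) - y) / \<rho> ^ k\<^sub>0" and ?v = "(c \<theta> - y) / \<rho> ^ k\<^sub>0"
  have v_eq: "?v = c v" using v(3) rho_pos by (simp add: field_simps)
  have pos: "wt k\<^sub>0 y > 0" "wt (length u\<^sub>1) ?v > 0"
    using v(1,2) near_subset unfolding v_eq by (auto intro!: wt_pos ptsI)
  have "wt (length \<omega> + k\<^sub>0) (c \<omega> + \<rho> ^ length \<omega> * y) * wt (length u\<^sub>1) ?v \<le>
      wt (length \<omega> + k\<^sub>0 + length u\<^sub>1) (c \<omega> + \<rho> ^ length \<omega> * y + \<rho> ^ (length \<omega> + k\<^sub>0) * ?v)"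
    by (rule wt_mult_le)
  also have "\<dots> = f (\<omega> @ \<theta>)"
  proof -
    have "\<rho> ^ (length \<omega> + k\<^sub>0) * ?v = \<rho> ^ length \<omega> * (c \<theta> - y)" using rho_pos by (simp add: power_add)
    then have "c \<omega> + \<rho> ^ length \<omega> * y + \<rho> ^ (length \<omega> + k\<^sub>0) * ?v = c (\<omega> @ \<theta>)"
      by (simp only: word_map_append_0) (simp add: algebra_simps)
    moreover have "length (\<omega> @ \<theta>) = length \<omega> + k\<^sub>0 + length u\<^sub>1" by (simp add: \<theta>_def)
    ultimately show ?thesis by (simp only: f_def)
  qed
  finally have 1: "wt (length \<omega> + k\<^sub>0) (c \<omega> + \<rho> ^ length \<omega> * y) * wt (length u\<^sub>1) ?v \<le> f (\<omega> @ \<theta>)" .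
  have "wt k\<^sub>0 y * wt (length u\<^sub>1 + length \<eta>) ?z \<le> wt (k\<^sub>0 + (length u\<^sub>1 + length \<eta>)) (y + \<rho> ^ k\<^sub>0 * ?z)"
    by (rule wt_mult_le)
  also have "\<dots> = f (\<theta> @ \<eta>)"
    using rho_pos by (simp add: f_def \<theta>_def add.assoc)
  finally have 2: "wt k\<^sub>0 y * wt (length u\<^sub>1 + length \<eta>) ?z \<le> f (\<theta> @ \<eta>)" .
  have "(wt (length \<omega> + k\<^sub>0) (c \<omega> + \<rho> ^ length \<omega> * y) * wt (length u\<^sub>1) ?v) *
      (wt k\<^sub>0 y * wt (length u\<^sub>1 + length \<eta>) ?z) \<le> f (\<omega> @ \<theta>) * f (\<theta> @ \<eta>)"
    using 1 2 wt_nonneg by (intro mult_mono) (auto simp: f_def)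
  then show ?thesis using pos by (simp add: field_simps)
qed

text \<open>Cut every word with the map of \<open>\<omega> @ \<theta> @ \<eta>\<close> after
  \<open>length \<omega> + k\<^sub>0\<close> letters. The head meets the cylinder of
  \<open>\<omega> @ \<omega>\<^sub>0\<close>, so saturation makes it a copy of some
  \<open>y\<close>, and stability puts \<open>y\<close> into the fixed set
  \<open>reach u\<^sub>1\<close>. Summing over \<open>y\<close> turns the weight into products of
  two halves.\<close>

lemma f_quasi_mult:
  assumes \<omega>: "set \<omega> \<subseteq> {..m}" and \<eta>: "set \<eta> \<subseteq> {..m}"
  shows "f (\<omega> @ \<theta> @ \<eta>) \<le> qc * (f (\<omega> @ \<theta>) * f (\<theta> @ \<eta>))"
proof -
  let ?a = "length \<omega> + k\<^sub>0" and ?b = "length u\<^sub>1 + length \<eta>"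
  let ?x = "c (\<omega> @ \<theta> @ \<eta>)"
  let ?A = "\<lambda>y \<sigma>. if c \<sigma> = c \<omega> + \<rho> ^ length \<omega> * y then pw \<sigma> else 0"
  let ?B = "\<lambda>y \<tau>. if c \<tau> = (c (\<theta> @ \<eta>) - y) / \<rho> ^ k\<^sub>0 then pw \<tau> else 0"
  have step: "(if c (\<sigma> @ \<tau>) = ?x then pw (\<sigma> @ \<tau>) else 0) \<le> (\<Sum>y\<in>reach u\<^sub>1. ?A y \<sigma> * ?B y \<tau>)"
    if \<sigma>: "\<sigma> \<in> W ?a" and \<tau>: "\<tau> \<in> W ?b" for \<sigma> \<tau>
  proof (cases "c (\<sigma> @ \<tau>) = ?x")
    case True
    have pos: "pw \<sigma> > 0" "pw \<tau> > 0" using \<sigma> \<tau> pw_W_pos by auto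
    have eq: "c \<sigma> + \<rho> ^ ?a * c \<tau> = c (\<omega> @ \<omega>\<^sub>0) + \<rho> ^ ?a * c (u\<^sub>1 @ \<eta>)"
      using True W_length[OF \<sigma>] by (simp add: \<theta>_def word_map_append_0 power_add algebra_simps)
    have "0 \<le> c \<tau>" "c \<tau> \<le> 1" using c_W_01[OF \<tau>] by auto
    moreover have "u\<^sub>1 @ \<eta> \<in> W ?b" using set_u\<^sub>1 \<eta> by (auto simp: ifs_words_def)
    then have "0 \<le> c (u\<^sub>1 @ \<eta>)" "c (u\<^sub>1 @ \<eta>) \<le> 1" using c_W_01 by auto
    ultimately have "\<bar>c (u\<^sub>1 @ \<eta>) - c \<tau>\<bar> \<le> 1" by linarith
    moreover have "c \<sigma> - c (\<omega> @ \<omega>\<^sub>0) = \<rho> ^ ?a * (c (u\<^sub>1 @ \<eta>) - c \<tau>)" using eq by (simp add: algebra_simps)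
    then have "\<bar>c \<sigma> - c (\<omega> @ \<omega>\<^sub>0)\<bar> = \<rho> ^ ?a * \<bar>c (u\<^sub>1 @ \<eta>) - c \<tau>\<bar>"
      using rho_pos by (simp add: abs_mult)
    ultimately have "\<bar>c \<sigma> - c (\<omega> @ \<omega>\<^sub>0)\<bar> \<le> \<rho> ^ ?a" using rho_pos by (simp add: mult_left_le)
    then obtain y where y: "y \<in> near \<omega>\<^sub>0" "c \<sigma> = c \<omega> + \<rho> ^ length \<omega> * y"
      by (rule saturated[OF \<omega> \<sigma>])
    have "\<rho> ^ length \<omega> * (y + \<rho> ^ k\<^sub>0 * c \<tau>) = \<rho> ^ length \<omega> * c (\<omega>\<^sub>0 @ u\<^sub>1 @ \<eta>)"
      using eq y(2) by (simp add: word_map_append_0 power_add algebra_simps)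
    then have y\<tau>: "y + \<rho> ^ k\<^sub>0 * c \<tau> = c (\<omega>\<^sub>0 @ u\<^sub>1 @ \<eta>)" using rho_pos by simp
    then have "y \<in> reach (u\<^sub>1 @ \<eta>)" using y(1) \<tau> unfolding reach_def by auto
    then have y_reach: "y \<in> reach u\<^sub>1" using reach_stable[OF \<eta>] by simp
    have "c \<tau> = (c (\<theta> @ \<eta>) - y) / \<rho> ^ k\<^sub>0" using y\<tau> rho_pos by (simp add: \<theta>_def field_simps)
    then have "pw (\<sigma> @ \<tau>) = ?A y \<sigma> * ?B y \<tau>" using y(2) by (simp add: pw_append)
    also have "\<dots> \<le> (\<Sum>y\<in>reach u\<^sub>1. ?A y \<sigma> * ?B y \<tau>)"
      using pos by (intro member_le_sum y_reach finite_reach) auto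
    finally show ?thesis using True by simp
  next
    case False
    have "pw \<sigma> > 0" "pw \<tau> > 0" using \<sigma> \<tau> pw_W_pos by auto
    with False show ?thesis by (auto intro!: sum_nonneg)
  qed
  have len: "length (\<omega> @ \<theta> @ \<eta>) = ?a + ?b" by (simp add: \<theta>_def)
  have "f (\<omega> @ \<theta> @ \<eta>) = (\<Sum>\<sigma>\<in>W ?a. \<Sum>\<tau>\<in>W ?b. if c (\<sigma> @ \<tau>) = ?x then pw (\<sigma> @ \<tau>) else 0)"
    unfolding f_def len wt_def sum_ifs_words_add ..
  also have "\<dots> \<le> (\<Sum>\<sigma>\<in>W ?a. \<Sum>\<tau>\<in>W ?b. \<Sum>y\<in>reach u\<^sub>1. ?A y \<sigma> * ?B y \<tau>)"
    by (intro sum_mono step)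
  also have "\<dots> = (\<Sum>\<sigma>\<in>W ?a. \<Sum>y\<in>reach u\<^sub>1. \<Sum>\<tau>\<in>W ?b. ?A y \<sigma> * ?B y \<tau>)"
    by (intro sum.cong refl sum.swap)
  also have "\<dots> = (\<Sum>y\<in>reach u\<^sub>1. \<Sum>\<sigma>\<in>W ?a. \<Sum>\<tau>\<in>W ?b. ?A y \<sigma> * ?B y \<tau>)"
    by (rule sum.swap)
  also have "\<dots> = (\<Sum>y\<in>reach u\<^sub>1. wt ?a (c \<omega> + \<rho> ^ length \<omega> * y) * wt ?b ((c (\<theta> @ \<eta>) - y) / \<rho> ^ k\<^sub>0))"
    by (simp only: wt_def sum_product)
  also have "\<dots> \<le> (\<Sum>y\<in>reach u\<^sub>1. 1 / (wt k\<^sub>0 y * wt (length u\<^sub>1) ((c \<theta> - y) / \<rho> ^ k\<^sub>0)) *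
      (f (\<omega> @ \<theta>) * f (\<theta> @ \<eta>)))"
    using \<omega> \<eta> by (intro sum_mono wt_reach_bound)
  also have "\<dots> = qc * (f (\<omega> @ \<theta>) * f (\<theta> @ \<eta>))"
    by (simp add: qc_def sum_distrib_right)
  finally show ?thesis .
qed

text \<open>With empty surroundings quasi-multiplicativity reads
  \<open>f \<theta> \<le> qc * f \<theta> * f \<theta>\<close>, while
  \<open>f \<theta> \<le> 1\<close>.\<close>

lemma qc_ge_1: "qc \<ge> 1"
proof -
  have "0 < f \<theta>" "f \<theta> \<le> 1" using f_pos set_\<theta> f_le_1 by auto
  have "f \<theta> \<le> qc * (f \<theta> * f \<theta>)" using f_quasi_mult[of "[]" "[]"] by simp
  then have "1 \<le> qc * f \<theta>" using \<open>0 < f \<theta>\<close> by (simp add: field_simps)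
  moreover have "qc > 0" using calculation \<open>0 < f \<theta>\<close> by (smt (verit) mult_nonpos_nonneg)
  ultimately show ?thesis using \<open>f \<theta> \<le> 1\<close> by (smt (verit) mult_left_le)
qed


subsection \<open>Measure of small intervals\<close>

lemma sets_\<mu>: "sets \<mu> = sets borel" and prob_\<mu>: "prob_space \<mu>"
  and measure_self_similar: "A \<in> sets borel \<Longrightarrow>
    measure \<mu> A = (\<Sum>j\<le>m. p j * measure (distr \<mu> borel (ifs_map \<rho> d j)) A)"
  using self_similar by (auto simp: self_similar_measure_def)

interpretation \<mu>: prob_space \<mu>
  by (rule prob_\<mu>)

lemma space_\<mu>: "space \<mu> = UNIV"
  using sets_eq_imp_space_eq[OF sets_\<mu>] by simp

lemma vimage_affine_borel: "A \<in> sets borel \<Longrightarrow> (\<lambda>x::real. a + b * x) -` A \<in> sets borel"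
  using measurable_sets[of "\<lambda>x::real. a + b * x" borel borel A] by simp

lemma measure_step:
  assumes "A \<in> sets borel"
  shows "measure \<mu> A = (\<Sum>j\<le>m. p j * measure \<mu> ((\<lambda>x. d j + \<rho> * x) -` A))"
proof -
  have "measure (distr \<mu> borel (ifs_map \<rho> d j)) A = measure \<mu> ((\<lambda>x. d j + \<rho> * x) -` A)" for j
  proof -
    have eq: "ifs_map \<rho> d j = (\<lambda>x. d j + \<rho> * x)" by (auto simp: ifs_map_def)
    have "(\<lambda>x. d j + \<rho> * x) \<in> measurable borel borel" by measurable
    then have "(\<lambda>x. d j + \<rho> * x) \<in> measurable \<mu> borel"
      unfolding measurable_cong_sets[OF sets_\<mu> refl] .
    then show ?thesis unfolding eq using assms by (subst measure_distr) (auto simp: space_\<mu>)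
  qed
  then show ?thesis using measure_self_similar[OF assms] by simp
qed

lemma measure_words:
  "A \<in> sets borel \<Longrightarrow> measure \<mu> A = (\<Sum>\<sigma>\<in>W n. pw \<sigma> * measure \<mu> ((\<lambda>x. c \<sigma> + \<rho> ^ n * x) -` A))"
proof (induction n)
  case 0
  then show ?case by (simp add: ifs_words_0 pw_def)
next
  case (Suc n)
  have "measure \<mu> A = (\<Sum>\<sigma>\<in>W n. pw \<sigma> * measure \<mu> ((\<lambda>x. c \<sigma> + \<rho> ^ n * x) -` A))"
    using Suc by simp
  also have "\<dots> = (\<Sum>\<sigma>\<in>W n. \<Sum>j\<le>m. pw (\<sigma> @ [j]) *
      measure \<mu> ((\<lambda>x. c (\<sigma> @ [j]) + \<rho> ^ Suc n * x) -` A))"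
  proof (intro sum.cong refl)
    fix \<sigma> assume \<sigma>: "\<sigma> \<in> W n"
    have "measure \<mu> ((\<lambda>x. c \<sigma> + \<rho> ^ n * x) -` A) =
        (\<Sum>j\<le>m. p j * measure \<mu> ((\<lambda>x. d j + \<rho> * x) -` (\<lambda>x. c \<sigma> + \<rho> ^ n * x) -` A))"
      by (intro measure_step vimage_affine_borel Suc.prems)
    also have "\<dots> = (\<Sum>j\<le>m. p j * measure \<mu> ((\<lambda>x. c (\<sigma> @ [j]) + \<rho> ^ Suc n * x) -` A))"
      using W_length[OF \<sigma>]
      by (intro sum.cong refl arg_cong2[where f = "(*)"] arg_cong2[where f = measure])
         (auto simp: word_map_append_0 ifs_map_def algebra_simps)
    finally show "pw \<sigma> * measure \<mu> ((\<lambda>x. c \<sigma> + \<rho> ^ n * x) -` A) =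
        (\<Sum>j\<le>m. pw (\<sigma> @ [j]) * measure \<mu> ((\<lambda>x. c (\<sigma> @ [j]) + \<rho> ^ Suc n * x) -` A))"
      by (simp add: pw_append pw_def sum_distrib_left mult.assoc)
  qed
  finally show ?case by (simp only: sum_ifs_words_Suc)
qed

text \<open>Every level \<open>n\<close> map contracts the larger interval into
  \<open>{- R..1 + R}\<close>, as it sends \<open>{0..1}\<close> into itself. The larger intervals
  exhaust the line, so \<open>{- R..1 + R}\<close> will have full measure.\<close>

lemma measure_enlarge_le: "R \<ge> 0 \<Longrightarrow> measure \<mu> {- (R / \<rho> ^ n)..1 + R / \<rho> ^ n} \<le> measure \<mu> {- R..1 + R}"
proof -
  assume R: "R \<ge> 0"
  let ?B = "{- (R / \<rho> ^ n)..1 + R / \<rho> ^ n}"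
  have "measure \<mu> ?B = (\<Sum>\<sigma>\<in>W n. pw \<sigma> * measure \<mu> ?B)"
    by (simp add: sum_pw flip: sum_distrib_right)
  also have "\<dots> \<le> (\<Sum>\<sigma>\<in>W n. pw \<sigma> * measure \<mu> ((\<lambda>x. c \<sigma> + \<rho> ^ n * x) -` {- R..1 + R}))"
  proof (intro sum_mono mult_left_mono \<mu>.finite_measure_mono)
    fix \<sigma> assume \<sigma>: "\<sigma> \<in> W n"
    show "?B \<subseteq> (\<lambda>x. c \<sigma> + \<rho> ^ n * x) -` {- R..1 + R}"
    proof
      fix x assume "x \<in> ?B"
      then have "0 \<le> \<rho> ^ n * (x + R / \<rho> ^ n)" "0 \<le> \<rho> ^ n * (1 + R / \<rho> ^ n - x)"
        using rho_pos by auto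
      then have "- R \<le> \<rho> ^ n * x" "\<rho> ^ n * x \<le> \<rho> ^ n + R"
        using rho_pos by (simp_all add: distrib_left right_diff_distrib)
      then show "x \<in> (\<lambda>x. c \<sigma> + \<rho> ^ n * x) -` {- R..1 + R}" using c_W[OF \<sigma>] by auto
    qed
    show "(\<lambda>x. c \<sigma> + \<rho> ^ n * x) -` {- R..1 + R} \<in> sets \<mu>"
      unfolding sets_\<mu> by (intro vimage_affine_borel) simp
    show "0 \<le> pw \<sigma>" using pw_W_pos[OF \<sigma>] by simp
  qed
  also have "\<dots> = measure \<mu> {- R..1 + R}" by (rule measure_words[symmetric]) simp
  finally show ?thesis .
qed

text \<open>That \<open>\<mu>\<close> lives on \<open>{0..1}\<close> has to be derived from
  self-similarity. Continuity from below gives every enlarged interval measure \<open>1\<close>,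
  then continuity from above shrinks the enlargement to \<open>0\<close>.\<close>

lemma measure_unit_interval: "measure \<mu> {0..1} = 1"
proof -
  have 1: "measure \<mu> {- R..1 + R} = 1" if R: "R > 0" for R
  proof (rule antisym)
    let ?B = "\<lambda>n. {- (R / \<rho> ^ n)..1 + R / \<rho> ^ n}"
    have R_le: "R / \<rho> ^ i \<le> R / \<rho> ^ j" if ij: "i \<le> j" for i j
    proof -
      have "\<rho> ^ j \<le> \<rho> ^ i" using ij rho_pos rho_less_1 by (intro power_decreasing) auto
      then show ?thesis using R rho_pos by (intro divide_left_mono) auto
    qed
    have "incseq ?B"
    proof (rule incseq_SucI)
      show "?B n \<le> ?B (Suc n)" for n using R_le[of n "Suc n"] by auto
    qed
    have "(\<Union>n. ?B n) = UNIV"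
    proof -
      have "x \<in> (\<Union>n. ?B n)" for x
      proof -
        have "0 < R / (\<bar>x\<bar> + 1)" using R by simp
        then obtain n where "\<rho> ^ n < R / (\<bar>x\<bar> + 1)" using rho_less_1 by (metis real_arch_pow_inv)
        then have "\<bar>x\<bar> + 1 < R / \<rho> ^ n" using rho_pos by (simp add: field_simps)
        then have "x \<in> ?B n" by (auto simp: abs_if split: if_splits)
        then show ?thesis by blast
      qed
      then show ?thesis by auto
    qed
    moreover have "range ?B \<subseteq> sets \<mu>" unfolding sets_\<mu> by auto
    ultimately have "(\<lambda>n. measure \<mu> (?B n)) \<longlonglongrightarrow> measure \<mu> UNIV"
      using \<mu>.finite_Lim_measure_incseq[OF _ \<open>incseq ?B\<close>] by simp
    moreover have "measure \<mu> UNIV = 1" using \<mu>.prob_space space_\<mu> by simp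
    ultimately have "(\<lambda>n. measure \<mu> (?B n)) \<longlonglongrightarrow> 1" by simp
    then show "1 \<le> measure \<mu> {- R..1 + R}"
      using measure_enlarge_le[of R] R by (intro LIMSEQ_le_const2) auto
  qed simp
  let ?C = "\<lambda>n. {- (1 / Suc n)..1 + 1 / real (Suc n)}"
  have "decseq ?C"
  proof (rule decseq_SucI)
    show "?C (Suc n) \<le> ?C n" for n
      using divide_left_mono[of "real (Suc n)" "real (Suc (Suc n))" 1] by auto
  qed
  have "(\<Inter>n. ?C n) = {0..1}"
  proof (intro equalityI subsetI)
    fix x assume x: "x \<in> (\<Inter>n. ?C n)"
    have lim: "(\<lambda>n. 1 / real (Suc n)) \<longlonglongrightarrow> 0" using LIMSEQ_Suc[OF lim_1_over_n] by simp
    have "(\<lambda>n. - (1 / real (Suc n))) \<longlonglongrightarrow> - 0" "(\<lambda>n. 1 + 1 / real (Suc n)) \<longlonglongrightarrow> 1 + 0"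
      by (intro tendsto_intros lim)+
    then have "- 0 \<le> x" "x \<le> 1 + 0" using x by (auto intro: LIMSEQ_le_const LIMSEQ_le_const2)
    then show "x \<in> {0..1}" by simp
  next
    fix x :: real assume "x \<in> {0..1}"
    then have "- (1 / real (Suc n)) \<le> x \<and> x \<le> 1 + 1 / real (Suc n)" for n
      by (smt (verit) atLeastAtMost_iff divide_nonneg_nonneg of_nat_0_le_iff)
    then show "x \<in> (\<Inter>n. ?C n)" by auto
  qed
  moreover have "range ?C \<subseteq> sets \<mu>" unfolding sets_\<mu> by auto
  ultimately have "(\<lambda>n. measure \<mu> (?C n)) \<longlonglongrightarrow> measure \<mu> {0..1}"
    using \<mu>.finite_Lim_measure_decseq[OF _ \<open>decseq ?C\<close>] by simp
  moreover have "measure \<mu> (?C n) = 1" for n using 1[of "1 / Suc n"] by simp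
  ultimately show ?thesis by (simp add: LIMSEQ_const_iff)
qed

text \<open>Every word with the map of \<open>\<sigma>\<close> sends all of \<open>{0..1}\<close>,
  which carries the full measure, into the ball.\<close>

lemma measure_ball_ge:
  assumes "set \<sigma> \<subseteq> {..m}" "c \<sigma> \<le> x" "x \<le> c \<sigma> + \<rho> ^ length \<sigma>" "\<rho> ^ length \<sigma> \<le> r"
  shows "f \<sigma> \<le> measure \<mu> {x - r..x + r}"
proof -
  let ?n = "length \<sigma>"
  have "f \<sigma> \<le> (\<Sum>\<tau>\<in>W ?n. pw \<tau> * measure \<mu> ((\<lambda>y. c \<tau> + \<rho> ^ ?n * y) -` {x - r..x + r}))"
    unfolding f_def wt_def
  proof (rule sum_mono)
    fix \<tau> assume \<tau>: "\<tau> \<in> W ?n"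
    let ?V = "(\<lambda>y. c \<tau> + \<rho> ^ ?n * y) -` {x - r..x + r}"
    have "1 \<le> measure \<mu> ?V" if eq: "c \<tau> = c \<sigma>"
    proof -
      have "{0..1} \<subseteq> ?V"
      proof
        fix y :: real assume "y \<in> {0..1}"
        then have "0 \<le> \<rho> ^ ?n * y" "\<rho> ^ ?n * y \<le> \<rho> ^ ?n" using rho_pos by (auto simp: mult_left_le)
        then have "x - r \<le> c \<tau> + \<rho> ^ ?n * y" "c \<tau> + \<rho> ^ ?n * y \<le> x + r" using assms eq by linarith+
        then show "y \<in> ?V" by simp
      qed
      moreover have "?V \<in> sets \<mu>" unfolding sets_\<mu> by (intro vimage_affine_borel) simp
      ultimately have "measure \<mu> {0..1} \<le> measure \<mu> ?V" by (intro \<mu>.finite_measure_mono)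
      then show ?thesis by (simp add: measure_unit_interval)
    qed
    then show "(if c \<tau> = c \<sigma> then pw \<tau> else 0) \<le> pw \<tau> * measure \<mu> ?V"
      using pw_W_pos[OF \<tau>] by auto
  qed
  also have "\<dots> = measure \<mu> {x - r..x + r}" by (rule measure_words[symmetric]) simp
  finally show ?thesis .
qed

text \<open>A word whose point is outside \<open>near \<sigma>\<close> sends \<open>{0..1}\<close>
  off \<open>{a..b}\<close>, so its preimage of \<open>{a..b}\<close> is a null set.\<close>

lemma measure_interval_le:
  assumes "c \<sigma> \<le> a" "b \<le> c \<sigma> + \<rho> ^ length \<sigma>"
  shows "measure \<mu> {a..b} \<le> (\<Sum>y\<in>near \<sigma>. wt (length \<sigma>) y)"
proof -
  let ?n = "length \<sigma>"
  have "measure \<mu> {a..b} = (\<Sum>\<tau>\<in>W ?n. pw \<tau> * measure \<mu> ((\<lambda>y. c \<tau> + \<rho> ^ ?n * y) -` {a..b}))"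
    by (rule measure_words) simp
  also have "\<dots> \<le> (\<Sum>\<tau>\<in>W ?n. \<Sum>y\<in>near \<sigma>. if c \<tau> = y then pw \<tau> else 0)"
  proof (rule sum_mono)
    fix \<tau> assume \<tau>: "\<tau> \<in> W ?n"
    let ?V = "(\<lambda>y. c \<tau> + \<rho> ^ ?n * y) -` {a..b}"
    have V: "?V \<in> sets \<mu>" unfolding sets_\<mu> by (intro vimage_affine_borel) simp
    show "pw \<tau> * measure \<mu> ?V \<le> (\<Sum>y\<in>near \<sigma>. if c \<tau> = y then pw \<tau> else 0)"
    proof (cases "c \<tau> \<in> near \<sigma>")
      case True
      have "pw \<tau> * measure \<mu> ?V \<le> pw \<tau> * 1" using pw_W_pos[OF \<tau>] by (intro mult_left_mono) auto
      then show ?thesis using True by (simp add: finite_near)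
    next
      case False
      then have far: "\<bar>c \<tau> - c \<sigma>\<bar> > \<rho> ^ ?n" using \<tau> by (simp add: near_def ptsI)
      have "?V \<inter> {0..1} = {}"
      proof (rule ccontr)
        assume "?V \<inter> {0..1} \<noteq> {}"
        then obtain y where y: "a \<le> c \<tau> + \<rho> ^ ?n * y" "c \<tau> + \<rho> ^ ?n * y \<le> b" "0 \<le> y" "y \<le> 1" by auto
        then have "0 \<le> \<rho> ^ ?n * y" "\<rho> ^ ?n * y \<le> \<rho> ^ ?n" using rho_pos by (auto simp: mult_left_le)
        then show False using far y(1,2) assms by linarith
      qed
      then have "measure \<mu> ?V + measure \<mu> {0..1} = measure \<mu> (?V \<union> {0..1})"
        using V by (intro \<mu>.finite_measure_Union[symmetric]) (auto simp: sets_\<mu>)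
      then have "measure \<mu> ?V \<le> 0" using measure_unit_interval \<mu>.prob_le_1[of "?V \<union> {0..1}"] by linarith
      then have "measure \<mu> ?V = 0" using measure_nonneg[of \<mu> ?V] by linarith
      moreover have "(\<Sum>y\<in>near \<sigma>. if c \<tau> = y then pw \<tau> else 0) \<ge> 0"
        using pw_W_pos[OF \<tau>] by (intro sum_nonneg) auto
      ultimately show ?thesis by simp
    qed
  qed
  also have "\<dots> = (\<Sum>y\<in>near \<sigma>. wt ?n y)" unfolding wt_def by (rule sum.swap)
  finally show ?thesis .
qed

text \<open>In units of the cylinder of \<open>\<omega> @ \<theta> @ \<omega>\<^sub>0\<close>, the
  subcylinder \<open>[0, m]\<close> runs from \<open>\<rho> * (1 - \<rho>)\<close> to
  \<open>\<rho>\<close>, at distance at least \<open>\<rho> * (1 - \<rho>)\<close> from both ends;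
  the factor \<open>\<rho> ^ k\<^sub>0\<close> converts to units of
  \<open>\<omega> @ \<theta>\<close>.\<close>

definition \<kappa> :: real where "\<kappa> = \<rho> ^ k\<^sub>0 * (\<rho> * (1 - \<rho>))"

lemma \<kappa>_pos: "\<kappa> > 0"
  using rho_pos rho_less_1 by (simp add: \<kappa>_def)

lemma cylinder_subset:
  assumes "set \<tau> \<subseteq> {..m}" "c (\<sigma> @ \<tau>) \<le> x" "x \<le> c (\<sigma> @ \<tau>) + \<rho> ^ length (\<sigma> @ \<tau>)"
  shows "c \<sigma> \<le> x \<and> x \<le> c \<sigma> + \<rho> ^ length \<sigma>"
proof -
  have b: "0 \<le> c \<tau>" "c \<tau> + \<rho> ^ length \<tau> \<le> 1" using c_bounds[OF assms(1)] by auto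
  have "0 \<le> \<rho> ^ length \<sigma> * c \<tau>" using b rho_pos by simp
  moreover have "\<rho> ^ length \<sigma> * (c \<tau> + \<rho> ^ length \<tau>) \<le> \<rho> ^ length \<sigma> * 1"
    using b rho_pos by (intro mult_left_mono) auto
  ultimately show ?thesis using assms by (simp add: word_map_append_0 power_add algebra_simps)
qed

text \<open>The second \<open>\<theta>\<close> begins with \<open>\<omega>\<^sub>0 @ [0, m]\<close>,
  which keeps the ball inside the cylinder of \<open>\<omega> @ \<theta> @ \<omega>\<^sub>0\<close>.
  By saturation the neighbours of that cylinder are of the form
  \<open>\<omega> @ \<theta> @ \<eta>\<close>: there is a fixed number of them, each of weight at
  most \<open>qc * f (\<omega> @ \<theta>)\<close>.\<close>

lemma measure_ball_le:
  assumes "set \<omega> \<subseteq> {..m}" and x: "c (\<omega> @ \<theta> @ \<theta>) \<le> x" "x \<le> c (\<omega> @ \<theta> @ \<theta>) + \<rho> ^ length (\<omega> @ \<theta> @ \<theta>)"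
    and r: "r \<le> \<kappa> * \<rho> ^ length (\<omega> @ \<theta>)"
  shows "measure \<mu> {x - r..x + r} \<le> (card (near \<omega>\<^sub>0) * qc) * f (\<omega> @ \<theta>)"
proof -
  let ?\<sigma> = "(\<omega> @ \<theta>) @ \<omega>\<^sub>0"
  let ?q = "\<rho> ^ length ?\<sigma>"
  have "\<omega> @ \<theta> @ \<theta> = (?\<sigma> @ [0, m]) @ u\<^sub>0" by (simp add: \<theta>_def u\<^sub>1_def)
  then have "c (?\<sigma> @ [0, m]) \<le> x \<and> x \<le> c (?\<sigma> @ [0, m]) + \<rho> ^ length (?\<sigma> @ [0, m])"
    using x by (intro cylinder_subset[OF set_u\<^sub>0]) simp_all
  moreover have "c (?\<sigma> @ [0, m]) = c ?\<sigma> + ?q * (\<rho> * (1 - \<rho>))"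
    by (subst word_map_append_0) (simp add: ifs_map_def d_0 d_m)
  moreover have "\<rho> ^ length (?\<sigma> @ [0, m]) = ?q * (\<rho> * \<rho>)" by (simp add: power_add)
  ultimately have x': "c ?\<sigma> + ?q * (\<rho> * (1 - \<rho>)) \<le> x" "x \<le> c ?\<sigma> + ?q * \<rho>"
    by (simp_all add: algebra_simps)
  have r': "r \<le> ?q * (\<rho> * (1 - \<rho>))" using r by (simp add: \<kappa>_def power_add mult_ac)
  \<comment> \<open>The margin on the right: \<open>1 - \<rho>\<close> is at least
    \<open>\<rho> * (1 - \<rho>)\<close>.\<close>
  have "0 \<le> (1 - \<rho>) * (1 - \<rho>)" by simp
  then have "\<rho> + \<rho> * (1 - \<rho>) \<le> 1" by (simp add: algebra_simps)
  then have "?q * (\<rho> + \<rho> * (1 - \<rho>)) \<le> ?q * 1" using rho_pos by (intro mult_left_mono) auto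
  then have "measure \<mu> {x - r..x + r} \<le> (\<Sum>y\<in>near ?\<sigma>. wt (length ?\<sigma>) y)"
    using x' r' by (intro measure_interval_le) (simp_all add: distrib_left)
  also have "\<dots> \<le> (\<Sum>y\<in>near ?\<sigma>. qc * f (\<omega> @ \<theta>))"
  proof (rule sum_mono)
    fix y assume "y \<in> near ?\<sigma>"
    then obtain z where z: "z \<in> near \<omega>\<^sub>0" "y = c (\<omega> @ \<theta>) + \<rho> ^ length (\<omega> @ \<theta>) * z"
      using near_\<omega>\<^sub>0[of "\<omega> @ \<theta>"] assms(1) set_\<theta> by auto
    then obtain \<eta> where \<eta>: "\<eta> \<in> W k\<^sub>0" "z = c \<eta>" using near_subset by (blast elim: ptsE)
    have "wt (length ?\<sigma>) y = f (\<omega> @ \<theta> @ \<eta>)"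
      using z(2) \<eta>(2) W_length[OF \<eta>(1)] by (simp add: f_def word_map_append_0 power_add algebra_simps)
    also have "\<dots> \<le> qc * (f (\<omega> @ \<theta>) * f (\<theta> @ \<eta>))"
      using assms(1) \<eta>(1) by (intro f_quasi_mult) (auto simp: ifs_words_def)
    also have "\<dots> \<le> qc * (f (\<omega> @ \<theta>) * 1)"
      using qc_ge_1 f_le_1 f_pos[of "\<omega> @ \<theta>"] assms(1) set_\<theta> by (intro mult_left_mono) auto
    finally show "wt (length ?\<sigma>) y \<le> qc * f (\<omega> @ \<theta>)" by simp
  qed
  also have "\<dots> = card (near ?\<sigma>) * (qc * f (\<omega> @ \<theta>))" by simp
  also have "card (near ?\<sigma>) = card (near \<omega>\<^sub>0)"
    unfolding near_\<omega>\<^sub>0[of "\<omega> @ \<theta>", OF le_supI[of "set \<omega>" "{..m}" "set \<theta>", OF assms(1) set_\<theta>, folded set_append]]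
    using rho_pos by (intro card_image) (auto simp: inj_on_def)
  finally show ?thesis by simp
qed


subsection \<open>A point with the prescribed local dimension\<close>

text \<open>The weights of the \<open>M n\<close> maps of level \<open>n\<close> sum to
  \<open>1\<close>, so some weight is at least the average; framing by \<open>\<theta>\<close> costs
  a constant factor by supermultiplicativity.\<close>

lemma ex_heavy: "\<exists>\<eta>\<in>W n. f \<theta> * f \<theta> / M n \<le> f (\<theta> @ \<eta> @ \<theta>)"
proof -
  have "\<exists>y\<in>pts n. 1 / M n \<le> wt n y"
  proof (rule ccontr)
    assume "\<not> ?thesis"
    then have "(\<Sum>y\<in>pts n. wt n y) < (\<Sum>y\<in>pts n. 1 / M n)"
      using finite_pts pts_ne by (intro sum_strict_mono) auto
    also have "\<dots> = 1" using M_pos[of n] by (simp add: M_def)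
    finally show False by (simp add: sum_wt)
  qed
  then obtain \<eta> where \<eta>: "\<eta> \<in> W n" "1 / M n \<le> wt n (c \<eta>)" by (blast elim: ptsE)
  then have "1 / M n \<le> f \<eta>" by (simp add: f_def W_length)
  moreover have pos: "0 < f \<theta>" using f_pos set_\<theta> by auto
  ultimately have "f \<theta> * (1 / M n * f \<theta>) \<le> f \<theta> * (f \<eta> * f \<theta>)"
    by (intro mult_left_mono mult_right_mono) auto
  also have "\<dots> \<le> f \<theta> * f (\<eta> @ \<theta>)" using pos f_mult_le by (intro mult_left_mono) auto
  also have "\<dots> \<le> f (\<theta> @ \<eta> @ \<theta>)" by (rule f_mult_le)
  finally show ?thesis using \<eta>(1) by (intro bexI[of _ \<eta>]) simp_all
qed

text \<open>Here the average is taken over the framed words, because framing can bring in weight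
  from unrelated words. Distinct maps stay distinct after framing, so these \<open>M n\<close>
  weights sum to at most \<open>1\<close>.\<close>

lemma ex_light: "\<exists>\<eta>\<in>W n. f (\<theta> @ \<eta> @ \<theta>) \<le> 1 / M n"
proof -
  let ?N = "length \<theta> + (n + length \<theta>)"
  let ?g = "\<lambda>y. c \<theta> + \<rho> ^ length \<theta> * (y + \<rho> ^ n * c \<theta>)"
  have \<theta>W: "\<theta> \<in> W (length \<theta>)" using set_\<theta> by (simp add: ifs_words_def)
  have g: "?g (c \<eta>) = c (\<theta> @ \<eta> @ \<theta>)" if "\<eta> \<in> W n" for \<eta>
    using W_length[OF that] by (simp add: word_map_append_0)
  have "?g ` pts n \<subseteq> pts ?N"
  proof safe
    fix y assume "y \<in> pts n"
    then obtain \<eta> where \<eta>: "\<eta> \<in> W n" "y = c \<eta>" by (rule ptsE)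
    have "\<theta> @ \<eta> @ \<theta> \<in> W ?N" using \<theta>W \<eta>(1) by (intro append_in_ifs_words)
    then show "?g y \<in> pts ?N" using g[OF \<eta>(1)] \<eta>(2) ptsI by metis
  qed
  have "inj_on ?g (pts n)" using rho_pos by (simp add: inj_on_def)
  then have "(\<Sum>y\<in>pts n. wt ?N (?g y)) = (\<Sum>y\<in>?g ` pts n. wt ?N y)" by (simp add: sum.reindex)
  also have "\<dots> \<le> (\<Sum>y\<in>pts ?N. wt ?N y)"
    using \<open>?g ` pts n \<subseteq> pts ?N\<close> finite_pts wt_nonneg by (intro sum_mono2) auto
  finally have le: "(\<Sum>y\<in>pts n. wt ?N (?g y)) \<le> 1" by (simp add: sum_wt)
  have "\<exists>y\<in>pts n. wt ?N (?g y) \<le> 1 / M n"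
  proof (rule ccontr)
    assume "\<not> ?thesis"
    then have "(\<Sum>y\<in>pts n. 1 / M n) < (\<Sum>y\<in>pts n. wt ?N (?g y))"
      using finite_pts pts_ne by (intro sum_strict_mono) auto
    moreover have "(\<Sum>y\<in>pts n. 1 / M n) = 1" using M_pos[of n] by (simp add: M_def)
    ultimately show False using le by simp
  qed
  then obtain \<eta> where \<eta>: "\<eta> \<in> W n" "wt ?N (?g (c \<eta>)) \<le> 1 / M n" by (blast elim: ptsE)
  have "f (\<theta> @ \<eta> @ \<theta>) = wt ?N (?g (c \<eta>))"
    unfolding f_def g[OF \<eta>(1)] using W_length[OF \<eta>(1)] by simp
  then show ?thesis using \<eta> by (intro bexI[of _ \<eta>]) simp_all
qed

text \<open>A crude exponential bound for the side of a light block that averaging leaves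
  uncontrolled.\<close>

lemma f_ge_power: "\<exists>q. 0 < q \<and> q \<le> 1 \<and> (\<forall>\<sigma>. set \<sigma> \<subseteq> {..m} \<longrightarrow> q ^ length \<sigma> \<le> f \<sigma>)"
proof -
  define q where "q = min 1 (Min (p ` {..m}))"
  have q: "0 < q" "q \<le> 1" "\<And>j. j \<le> m \<Longrightarrow> q \<le> p j" using p_pos by (auto simp: q_def min_le_iff_disj)
  have "q ^ length \<sigma> \<le> pw \<sigma>" if "set \<sigma> \<subseteq> {..m}" for \<sigma>
    using that
  proof (induction \<sigma>)
    case (Cons j \<sigma>)
    then have "q * q ^ length \<sigma> \<le> p j * pw \<sigma>" using q by (intro mult_mono) (auto intro: less_imp_le p_pos)
    then show ?case by (simp add: pw_def)
  qed (simp add: pw_def)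
  moreover have "pw \<sigma> \<le> f \<sigma>" if "set \<sigma> \<subseteq> {..m}" for \<sigma>
    unfolding f_def using that by (intro pw_le_wt) (simp add: ifs_words_def)
  ultimately show ?thesis using q by (intro exI[of _ q]) (auto intro: order.trans)
qed

text \<open>The logarithm of \<open>f \<sigma>\<close> relative to the average order
  \<open>exp (- h * length \<sigma>)\<close>. Local dimension \<open>s\<close> follows once this is
  of lower order than the length along the construction.\<close>

definition dev :: "nat list \<Rightarrow> real" where "dev \<sigma> = ln (f \<sigma>) + h * length \<sigma>"

text \<open>A block \<open>\<theta> @ \<eta> @ \<theta>\<close> may be chosen so that its deviation \<open>dev\<close> has either prescribed sign,
  up to a constant independent of \<open>n\<close>; this is what keeps \<open>dev\<close> under control along the sequence.\<close>

lemma ex_block: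
  "\<exists>B\<ge>0. \<forall>n up. \<exists>\<eta>\<in>W n. \<bar>dev (\<theta> @ \<eta> @ \<theta>)\<bar> \<le> B * (real n + 1) \<and>
     (if up then - B \<le> dev (\<theta> @ \<eta> @ \<theta>) else dev (\<theta> @ \<eta> @ \<theta>) \<le> B)"
proof -
  obtain q where q: "0 < q" "q \<le> 1" "\<And>\<sigma>. set \<sigma> \<subseteq> {..m} \<Longrightarrow> q ^ length \<sigma> \<le> f \<sigma>" using f_ge_power by blast
  have f\<theta>: "0 < f \<theta>" "f \<theta> \<le> 1" using f_pos set_\<theta> f_le_1 by auto
  define t where "t = real (length \<theta>)"
  \<comment> \<open>The terms pay, in order, for the two frames \<open>\<theta>\<close>, for the
    factor \<open>L\<close> in the bound on \<open>M n\<close>, for the crude bound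
    \<open>q ^ n\<close> on light blocks, and for the trivial bound \<open>f \<le> 1\<close>, which
    leaves \<open>h * (n + 2 * t)\<close>.\<close>
  define B where "B = - 2 * ln (f \<theta>) + ln L - ln q + h * (1 + 2 * t)"
  have parts: "0 \<le> - 2 * ln (f \<theta>)" "0 \<le> ln L" "0 \<le> - ln q" "0 \<le> h" "0 \<le> h * (2 * t)"
    using f\<theta> q L_ge_1 h_nonneg by (auto simp: t_def)
  have B_eq: "B = - 2 * ln (f \<theta>) + ln L - ln q + h + h * (2 * t)" by (simp add: B_def distrib_left)
  have B: "0 \<le> B" using parts unfolding B_eq by linarith
  have lnM: "ln (M n) \<le> ln L + h * n" for n
  proof -
    have "ln (M n) \<le> ln (L * exp (h * n))" using M_le_exp[of n] M_pos[of n] by (intro ln_mono) auto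
    then show ?thesis using L_ge_1 by (simp add: ln_mult)
  qed
  have lnM': "h * n \<le> ln (M n)" for n
    using M_ge_exp[of n] M_pos[of n] by (simp add: ln_ge_iff)
  have "\<exists>\<eta>\<in>W n. \<bar>dev (\<theta> @ \<eta> @ \<theta>)\<bar> \<le> B * (real n + 1) \<and>
     (if up then - B \<le> dev (\<theta> @ \<eta> @ \<theta>) else dev (\<theta> @ \<eta> @ \<theta>) \<le> B)" for n up
  proof -
    have *: "0 < f (\<theta> @ \<eta> @ \<theta>)" "dev (\<theta> @ \<eta> @ \<theta>) = ln (f (\<theta> @ \<eta> @ \<theta>)) + h * n + h * (2 * t)"
      "dev (\<theta> @ \<eta> @ \<theta>) \<le> B * (real n + 1)" if "\<eta> \<in> W n" for \<eta>
    proof -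
      have "set (\<theta> @ \<eta> @ \<theta>) \<subseteq> {..m}" using set_\<theta> \<open>\<eta> \<in> W n\<close> by (auto simp: ifs_words_def)
      then show pos: "0 < f (\<theta> @ \<eta> @ \<theta>)" by (rule f_pos)
      show eq: "dev (\<theta> @ \<eta> @ \<theta>) = ln (f (\<theta> @ \<eta> @ \<theta>)) + h * n + h * (2 * t)"
        using W_length[OF \<open>\<eta> \<in> W n\<close>] by (simp add: dev_def t_def algebra_simps)
      have "ln (f (\<theta> @ \<eta> @ \<theta>)) \<le> 0" using pos f_le_1 by simp
      moreover have "h \<le> B" using parts unfolding B_eq by linarith
      then have "h * n \<le> B * n" by (intro mult_right_mono) auto
      moreover have "h * (2 * t) \<le> B" using parts unfolding B_eq by linarith
      ultimately show "dev (\<theta> @ \<eta> @ \<theta>) \<le> B * (real n + 1)" unfolding eq by (simp add: distrib_left)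
    qed
    have B_dist: "B * (real n + 1) = B * n + B" by (simp add: distrib_left)
    have Bn: "B \<le> B * (real n + 1)" using B by (simp add: distrib_left)
    show ?thesis
    proof (cases up)
      case True
      obtain \<eta> where \<eta>: "\<eta> \<in> W n" "f \<theta> * f \<theta> / M n \<le> f (\<theta> @ \<eta> @ \<theta>)" using ex_heavy by blast
      have "ln (f \<theta> * f \<theta> / M n) \<le> ln (f (\<theta> @ \<eta> @ \<theta>))"
        using \<eta> f\<theta> M_pos[of n] by (intro ln_mono) auto
      moreover have "ln (f \<theta> * f \<theta> / M n) = 2 * ln (f \<theta>) - ln (M n)"
        using f\<theta> M_pos[of n] by (simp add: ln_div ln_mult)
      ultimately have "- B \<le> dev (\<theta> @ \<eta> @ \<theta>)"
        using lnM[of n] parts *(2)[OF \<eta>(1)] unfolding B_eq by linarith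
      then show ?thesis using True *(3)[OF \<eta>(1)] Bn \<eta>(1) by (intro bexI[of _ \<eta>]) auto
    next
      case False
      obtain \<eta> where \<eta>: "\<eta> \<in> W n" "f (\<theta> @ \<eta> @ \<theta>) \<le> 1 / M n" using ex_light by blast
      have "ln (f (\<theta> @ \<eta> @ \<theta>)) \<le> ln (1 / M n)"
        using \<eta> *(1)[OF \<eta>(1)] M_pos[of n] by (intro ln_mono) auto
      then have "ln (f (\<theta> @ \<eta> @ \<theta>)) \<le> - ln (M n)" using M_pos[of n] by (simp add: ln_div)
      then have up: "dev (\<theta> @ \<eta> @ \<theta>) \<le> B"
        using lnM'[of n] parts *(2)[OF \<eta>(1)] unfolding B_eq by linarith
      have "f \<theta> * (q ^ n * f \<theta>) \<le> f \<theta> * (f \<eta> * f \<theta>)"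
        using q(3)[of \<eta>] \<eta>(1) f\<theta> by (intro mult_left_mono mult_right_mono) (auto simp: ifs_words_def)
      also have "\<dots> \<le> f \<theta> * f (\<eta> @ \<theta>)" using f\<theta> f_mult_le by (intro mult_left_mono) auto
      also have "\<dots> \<le> f (\<theta> @ \<eta> @ \<theta>)" by (rule f_mult_le)
      finally have "ln (f \<theta> * (q ^ n * f \<theta>)) \<le> ln (f (\<theta> @ \<eta> @ \<theta>))"
        using f\<theta> q by (intro ln_mono) auto
      then have "2 * ln (f \<theta>) + n * ln q \<le> ln (f (\<theta> @ \<eta> @ \<theta>))"
        using f\<theta> q by (simp add: ln_mult ln_realpow)
      moreover have "- (B * n) \<le> n * ln q"
      proof -
        have "- ln q \<le> B" using parts unfolding B_eq by linarith
        then have "real n * - ln q \<le> real n * B" by (intro mult_left_mono) auto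
        then show ?thesis by (simp add: mult.commute)
      qed
      moreover have "- 2 * ln (f \<theta>) \<le> B" using parts unfolding B_eq by linarith
      moreover have "0 \<le> h * n" using parts by simp
      ultimately have "- (B * (real n + 1)) \<le> dev (\<theta> @ \<eta> @ \<theta>)"
        using *(2)[OF \<eta>(1)] parts unfolding B_dist by linarith
      then show ?thesis using False *(3)[OF \<eta>(1)] up \<eta>(1) by (intro bexI[of _ \<eta>]) auto
    qed
  qed
  with B show ?thesis by blast
qed

text \<open>The first bound is supermultiplicativity. For the second, quasi-multiplicativity is
  applied at both adjacent copies of \<open>\<theta>\<close>, the last of the old word and the first
  of the new block; the leftover factor \<open>f (\<theta> @ \<theta>)\<close> is at most
  \<open>1\<close>.\<close>

lemma dev_append:
  assumes "set \<omega> \<subseteq> {..m}" "set \<eta> \<subseteq> {..m}"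
  shows "dev (\<omega> @ \<theta>) + dev (\<theta> @ \<eta> @ \<theta>) \<le> dev ((\<omega> @ \<theta> @ \<theta> @ \<eta>) @ \<theta>)"
    "dev ((\<omega> @ \<theta> @ \<theta> @ \<eta>) @ \<theta>) \<le> dev (\<omega> @ \<theta>) + dev (\<theta> @ \<eta> @ \<theta>) + 2 * ln qc"
proof -
  let ?\<beta> = "\<theta> @ \<eta> @ \<theta>"
  have sets: "set ?\<beta> \<subseteq> {..m}" "set (\<omega> @ \<theta>) \<subseteq> {..m}" "set (\<omega> @ \<theta> @ ?\<beta>) \<subseteq> {..m}"
    using assms set_\<theta> by auto
  then have pos: "0 < f ?\<beta>" "0 < f (\<omega> @ \<theta>)" "0 < f (\<omega> @ \<theta> @ ?\<beta>)" by (blast intro: f_pos)+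
  have len: "h * length (\<omega> @ \<theta> @ ?\<beta>) = h * length (\<omega> @ \<theta>) + h * length ?\<beta>"
    by (simp add: algebra_simps)
  have "f (\<omega> @ \<theta>) * f ?\<beta> \<le> f (\<omega> @ \<theta> @ ?\<beta>)" using f_mult_le[of "\<omega> @ \<theta>" ?\<beta>] by simp
  then have "ln (f (\<omega> @ \<theta>) * f ?\<beta>) \<le> ln (f (\<omega> @ \<theta> @ ?\<beta>))" using pos by (intro ln_mono) auto
  then show "dev (\<omega> @ \<theta>) + dev ?\<beta> \<le> dev ((\<omega> @ \<theta> @ \<theta> @ \<eta>) @ \<theta>)"
    using pos len by (simp add: dev_def ln_mult)
  have "f (\<theta> @ ?\<beta>) \<le> qc * (f (\<theta> @ \<theta>) * f ?\<beta>)"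
    using f_quasi_mult[OF set_\<theta>, of "\<eta> @ \<theta>"] assms set_\<theta> by simp
  also have "\<dots> \<le> qc * (1 * f ?\<beta>)"
    using qc_ge_1 f_le_1 pos by (intro mult_left_mono mult_right_mono) auto
  finally have "f (\<omega> @ \<theta>) * f (\<theta> @ ?\<beta>) \<le> f (\<omega> @ \<theta>) * (qc * f ?\<beta>)" using pos by (intro mult_left_mono) auto
  then have "qc * (f (\<omega> @ \<theta>) * f (\<theta> @ ?\<beta>)) \<le> qc * (f (\<omega> @ \<theta>) * (qc * f ?\<beta>))"
    by (rule mult_left_mono) (use qc_ge_1 in simp)
  then have "f (\<omega> @ \<theta> @ ?\<beta>) \<le> qc * (f (\<omega> @ \<theta>) * (qc * f ?\<beta>))"
    using f_quasi_mult[OF assms(1) sets(1)] by linarith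
  then have "ln (f (\<omega> @ \<theta> @ ?\<beta>)) \<le> ln (qc * (f (\<omega> @ \<theta>) * (qc * f ?\<beta>)))"
    using pos by (intro ln_mono) auto
  then show "dev ((\<omega> @ \<theta> @ \<theta> @ \<eta>) @ \<theta>) \<le> dev (\<omega> @ \<theta>) + dev ?\<beta> + 2 * ln qc"
    using pos qc_ge_1 len by (simp add: dev_def ln_mult)
qed

text \<open>The next block is heavy if the deviation is at most \<open>0\<close> and light
  otherwise. Then a move of order \<open>N\<close> goes towards or across zero, while a move away
  from zero is bounded by a constant; so the bound grows linearly although the sizes of the moves
  may add up to order \<open>N^2\<close>.\<close>

lemma ex_block_sequence:
  assumes "set \<omega> \<subseteq> {..m}"
  shows "\<exists>\<sigma> A. \<sigma> 0 = \<omega> \<and> (\<forall>N. set (\<sigma> N) \<subseteq> {..m}) \<and>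
    (\<forall>N. \<exists>\<eta>\<in>W N. \<sigma> (Suc N) = \<sigma> N @ \<theta> @ \<theta> @ \<eta>) \<and>
    (\<forall>N. \<bar>dev (\<sigma> N @ \<theta>)\<bar> \<le> A * (real N + 1))"
proof -
  obtain B where B: "B \<ge> 0" "\<And>n up. \<exists>\<eta>\<in>W n. \<bar>dev (\<theta> @ \<eta> @ \<theta>)\<bar> \<le> B * (real n + 1) \<and>
     (if up then - B \<le> dev (\<theta> @ \<eta> @ \<theta>) else dev (\<theta> @ \<eta> @ \<theta>) \<le> B)"
    using ex_block by blast
  then obtain b where b: "b n up \<in> W n" "\<bar>dev (\<theta> @ b n up @ \<theta>)\<bar> \<le> B * (real n + 1)"
     "if up then - B \<le> dev (\<theta> @ b n up @ \<theta>) else dev (\<theta> @ b n up @ \<theta>) \<le> B" for n up by metis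
  define \<sigma> where "\<sigma> = rec_nat \<omega> (\<lambda>N \<tau>. \<tau> @ \<theta> @ \<theta> @ b N (dev (\<tau> @ \<theta>) \<le> 0))"
  have \<sigma>_0: "\<sigma> 0 = \<omega>" and \<sigma>_Suc: "\<sigma> (Suc N) = \<sigma> N @ \<theta> @ \<theta> @ b N (dev (\<sigma> N @ \<theta>) \<le> 0)" for N
    by (simp_all add: \<sigma>_def)
  have set_b: "set (b n up) \<subseteq> {..m}" for n up using b(1)[of n up] by (simp add: ifs_words_def)
  have set_\<sigma>: "set (\<sigma> N) \<subseteq> {..m}" for N
    by (induction N) (use assms set_\<theta> set_b in \<open>auto simp: \<sigma>_0 \<sigma>_Suc\<close>)
  \<comment> \<open>The first term is the initial deviation and \<open>B + 2 * ln qc\<close> bounds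
    one move away from zero; \<open>A * (real N + 1)\<close> also dominates a move across
    zero.\<close>
  define A where "A = \<bar>dev (\<omega> @ \<theta>)\<bar> + B + 2 * ln qc"
  have lnqc: "0 \<le> 2 * ln qc" using qc_ge_1 by simp
  have "\<bar>dev (\<sigma> N @ \<theta>)\<bar> \<le> A * (real N + 1)" for N
  proof (induction N)
    case 0
    show ?case using B(1) lnqc by (simp add: \<sigma>_0 A_def)
  next
    case (Suc N)
    let ?up = "dev (\<sigma> N @ \<theta>) \<le> 0"
    let ?u = "dev (\<theta> @ b N ?up @ \<theta>)"
    have 1: "dev (\<sigma> N @ \<theta>) + ?u \<le> dev (\<sigma> (Suc N) @ \<theta>)"
        "dev (\<sigma> (Suc N) @ \<theta>) \<le> dev (\<sigma> N @ \<theta>) + ?u + 2 * ln qc"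
      unfolding \<sigma>_Suc using dev_append[OF set_\<sigma> set_b] by blast+
    have "B * (real N + 1) + 2 * ln qc \<le> (B + 2 * ln qc) * (real N + 1)"
      using lnqc by (simp add: distrib_left distrib_right)
    also have "\<dots> \<le> A * (real N + 1)" unfolding A_def by (intro mult_right_mono) auto
    finally have 2: "B * (real N + 1) + 2 * ln qc \<le> A * (real N + 1)" .
    have A: "B + 2 * ln qc \<le> A" "A * (real (Suc N) + 1) = A * (real N + 1) + A"
      by (simp_all add: A_def algebra_simps)
    have b2: "- (B * (real N + 1)) \<le> ?u" "?u \<le> B * (real N + 1)" using b(2)[of N ?up] by linarith+
    show ?case
    proof (cases ?up)
      case True
      then have "- B \<le> ?u" using b(3)[of ?up N] by simp
      then show ?thesis using 1 2 A b2 Suc B(1) lnqc True by linarith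
    next
      case False
      then have "?u \<le> B" using b(3)[of ?up N] by simp
      then show ?thesis using 1 2 A b2 Suc B(1) lnqc False by linarith
    qed
  qed
  moreover have "\<exists>\<eta>\<in>W N. \<sigma> (Suc N) = \<sigma> N @ \<theta> @ \<theta> @ \<eta>" for N using \<sigma>_Suc b(1) by blast
  ultimately show ?thesis using \<sigma>_0 set_\<sigma> by blast
qed

section \<open>The limit point and its local dimension\<close>

lemma nested_cylinders:
  assumes "\<And>N. set (\<sigma> N) \<subseteq> {..m}" "\<And>N. \<exists>\<eta>. set \<eta> \<subseteq> {..m} \<and> \<sigma> (Suc N) = \<sigma> N @ \<eta>"
    "\<And>N. N \<le> length (\<sigma> N)"
  obtains x where "x \<in> K" "\<And>N. c (\<sigma> N) \<le> x" "\<And>N. x \<le> c (\<sigma> N) + \<rho> ^ length (\<sigma> N)"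
proof -
  let ?I = "\<lambda>N. {c (\<sigma> N)..c (\<sigma> N) + \<rho> ^ length (\<sigma> N)}"
  have "?I (Suc N) \<subseteq> ?I N" for N
  proof
    fix x assume x: "x \<in> ?I (Suc N)"
    obtain \<eta> where "set \<eta> \<subseteq> {..m}" "\<sigma> (Suc N) = \<sigma> N @ \<eta>" using assms(2) by blast
    then show "x \<in> ?I N" using cylinder_subset[of \<eta> "\<sigma> N" x] x by auto
  qed
  then have dec: "decseq ?I" by (rule decseq_SucI)
  have "\<exists>x. \<forall>N. x \<in> ?I N"
  proof -
    have "(\<Inter>N. ?I N) \<noteq> {}"
      by (rule compact_nest) (use dec rho_pos in \<open>auto simp: decseq_def\<close>)
    then show ?thesis by blast
  qed
  then obtain x where x: "\<And>N. x \<in> ?I N" by blast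
  have "(\<lambda>N. c (\<sigma> N)) \<longlonglongrightarrow> x"
  proof (rule LIMSEQ_I)
    fix e :: real assume "0 < e"
    then obtain N0 where N0: "\<rho> ^ N0 < e" using rho_less_1 by (metis real_arch_pow_inv)
    have "norm (c (\<sigma> N) - x) < e" if "N0 \<le> N" for N
    proof -
      have "\<rho> ^ length (\<sigma> N) \<le> \<rho> ^ N0"
        using rho_pos rho_less_1 assms(3)[of N] \<open>N0 \<le> N\<close> by (intro power_decreasing) auto
      then show ?thesis using x[of N] N0 by (simp add: abs_if)
    qed
    then show "\<exists>N0. \<forall>N\<ge>N0. norm (c (\<sigma> N) - x) < e" by blast
  qed
  moreover have "c (\<sigma> N) \<in> K" for N
    using assms(1) by (intro pts_K[OF ptsI]) (auto simp: ifs_words_def)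
  ultimately have "x \<in> K" using closed_sequentially[OF compact_imp_closed[OF compact_K], of "\<lambda>N. c (\<sigma> N)" x] by blast
  then show thesis using that x by auto
qed

text \<open>The lengths \<open>\<nu> N\<close> grow quadratically, while the deviations and the gaps
  between consecutive lengths are linear in \<open>N\<close>. For a radius between two consecutive
  scales, the logarithm of the measure therefore equals \<open>s * ln r\<close> up to O(N), against
  \<open>ln r\<close> of order \<open>N^2\<close>.\<close>

lemma has_local_dim_s:
  assumes \<sigma>: "\<And>N. set (\<sigma> N) \<subseteq> {..m}" "\<And>N. \<exists>\<eta>\<in>W N. \<sigma> (Suc N) = \<sigma> N @ \<theta> @ \<theta> @ \<eta>"
    and dev: "\<And>N. \<bar>dev (\<sigma> N @ \<theta>)\<bar> \<le> A * (real N + 1)"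
    and x: "\<And>N. c (\<sigma> N) \<le> x" "\<And>N. x \<le> c (\<sigma> N) + \<rho> ^ length (\<sigma> N)"
  shows "has_local_dim \<mu> x s"
proof -
  define t where "t = length \<theta>"
  define \<nu> where "\<nu> N = length (\<sigma> N @ \<theta>)" for N
  have \<nu>_Suc: "\<nu> (Suc N) = \<nu> N + 2 * t + N" for N
    using \<sigma>(2)[of N] by (auto simp: \<nu>_def t_def W_length)
  have \<nu>_ge: "real N * (real N - 1) / 2 \<le> \<nu> N" for N
    by (induction N) (simp_all add: \<nu>_Suc field_simps)
  define C where "C = max 1 (card (near \<omega>\<^sub>0) * qc)"
  have C: "C \<ge> 1" by (simp add: C_def)
  have \<kappa>: "0 < \<kappa>" "\<kappa> \<le> 1"
    using \<kappa>_pos rho_pos rho_less_1 by (auto simp: \<kappa>_def intro!: mult_le_one power_le_one)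
  have fpos: "0 < f (\<sigma> N @ \<theta>)" for N using \<sigma>(1)[of N] set_\<theta> by (intro f_pos) auto
  have ln_f: "ln (f (\<sigma> N @ \<theta>)) = dev (\<sigma> N @ \<theta>) - h * \<nu> N" for N by (simp add: dev_def \<nu>_def)
  have up: "measure \<mu> {x - r..x + r} \<le> C * f (\<sigma> N @ \<theta>)" if r: "r \<le> \<kappa> * \<rho> ^ \<nu> N" for r N
  proof -
    obtain \<eta> where \<eta>: "\<eta> \<in> W N" "\<sigma> (Suc N) = (\<sigma> N @ \<theta> @ \<theta>) @ \<eta>" using \<sigma>(2)[of N] by auto
    then have "c (\<sigma> N @ \<theta> @ \<theta>) \<le> x \<and> x \<le> c (\<sigma> N @ \<theta> @ \<theta>) + \<rho> ^ length (\<sigma> N @ \<theta> @ \<theta>)"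
      using x[of "Suc N"] by (intro cylinder_subset[of \<eta>]) (simp_all add: ifs_words_def)
    then have "measure \<mu> {x - r..x + r} \<le> (card (near \<omega>\<^sub>0) * qc) * f (\<sigma> N @ \<theta>)"
      using measure_ball_le[OF \<sigma>(1)] r by (simp add: \<nu>_def)
    also have "\<dots> \<le> C * f (\<sigma> N @ \<theta>)" using fpos[of N] by (intro mult_right_mono) (auto simp: C_def)
    finally show ?thesis .
  qed
  have low: "f (\<sigma> N @ \<theta>) \<le> measure \<mu> {x - r..x + r}" if r: "\<rho> ^ \<nu> N \<le> r" for r N
  proof -
    obtain \<eta> where \<eta>: "\<eta> \<in> W N" "\<sigma> (Suc N) = (\<sigma> N @ \<theta>) @ \<theta> @ \<eta>" using \<sigma>(2)[of N] by auto
    then have "c (\<sigma> N @ \<theta>) \<le> x \<and> x \<le> c (\<sigma> N @ \<theta>) + \<rho> ^ length (\<sigma> N @ \<theta>)"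
      using x[of "Suc N"] set_\<theta> by (intro cylinder_subset[of "\<theta> @ \<eta>"]) (simp_all add: ifs_words_def)
    then show ?thesis using \<sigma>(1) set_\<theta> r by (intro measure_ball_ge) (auto simp: \<nu>_def)
  qed
  define a where "a = \<bar>A\<bar>"
  have "A \<le> a" by (simp add: a_def)
  \<comment> \<open>Collects the errors in \<open>key\<close>: \<open>ln C\<close> from the upper
    ball estimate, \<open>3 * a\<close> from the deviation at index \<open>N + 2\<close>,
    \<open>4 * t + 2\<close> from the length difference \<open>4 * t + 2 * N + 1\<close> between
    indices \<open>N\<close> and \<open>N + 2\<close>, and \<open>ln \<kappa>\<close> from the scale
    of the balls.\<close>
  define A' where "A' = ln C + 3 * a + h * (4 * t + 2) - s * ln \<kappa>"
  have parts: "0 \<le> ln C" "0 \<le> a" "0 \<le> h" "0 \<le> h * t" "0 \<le> - (s * ln \<kappa>)"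
    using C h_nonneg s_nonneg \<kappa> by (auto simp: mult_nonneg_nonpos a_def)
  have A'_eq: "A' = ln C + 3 * a + 4 * (h * t) + 2 * h - s * ln \<kappa>" by (simp add: A'_def algebra_simps)
  have A': "0 \<le> A'" using parts unfolding A'_eq by linarith
  have key: "\<bar>ln (measure \<mu> {x - r..x + r}) - s * ln r\<bar> \<le> A' * (real N + 1)"
    if r: "\<kappa> * \<rho> ^ \<nu> (Suc N) \<le> r" "r \<le> \<kappa> * \<rho> ^ \<nu> N" and N: "\<rho> ^ N \<le> \<kappa>" for r N
  proof -
    \<comment> \<open>The lower ball estimate needs a cylinder no longer than \<open>r\<close>.
      Passing from \<open>Suc N\<close> to the next index gains at least the factor
      \<open>\<rho> ^ N\<close>, which absorbs \<open>\<kappa>\<close>.\<close>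
    have "\<rho> ^ \<nu> (Suc (Suc N)) = \<rho> ^ \<nu> (Suc N) * \<rho> ^ (2 * t + Suc N)"
      using \<nu>_Suc[of "Suc N"] by (simp add: add.assoc flip: power_add)
    also have "\<rho> ^ (2 * t + Suc N) \<le> \<rho> ^ N"
      using rho_pos rho_less_1 by (intro power_decreasing) auto
    then have "\<rho> ^ \<nu> (Suc N) * \<rho> ^ (2 * t + Suc N) \<le> \<rho> ^ \<nu> (Suc N) * \<kappa>"
      using N rho_pos by (intro mult_left_mono) auto
    finally have "\<rho> ^ \<nu> (Suc (Suc N)) \<le> r" using r(1) by (simp add: mult.commute)
    then have lo: "f (\<sigma> (Suc (Suc N)) @ \<theta>) \<le> measure \<mu> {x - r..x + r}" by (rule low)
    have pos: "0 < measure \<mu> {x - r..x + r}" using lo fpos[of "Suc (Suc N)"] by linarith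
    have r_pos: "0 < r" using r(1) \<kappa> rho_pos by (smt (verit) mult_pos_pos zero_less_power)
    have "ln (measure \<mu> {x - r..x + r}) \<le> ln (C * f (\<sigma> N @ \<theta>))" using up[OF r(2)] pos by (intro ln_mono) auto
    then have 1: "ln (measure \<mu> {x - r..x + r}) \<le> ln C + dev (\<sigma> N @ \<theta>) - h * \<nu> N"
      using C fpos[of N] ln_f[of N] by (simp add: ln_mult)
    have 2: "dev (\<sigma> (Suc (Suc N)) @ \<theta>) - h * \<nu> (Suc (Suc N)) \<le> ln (measure \<mu> {x - r..x + r})"
      using lo fpos[of "Suc (Suc N)"] by (simp flip: ln_f)
    have ln\<kappa>: "s * ln (\<kappa> * \<rho> ^ j) = s * ln \<kappa> - h * j" for j
      using \<kappa> rho_pos by (simp add: ln_mult ln_realpow h_eq algebra_simps)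
    have "s * ln r \<le> s * ln (\<kappa> * \<rho> ^ \<nu> N)" using r(2) r_pos s_nonneg by (intro mult_left_mono ln_mono) auto
    then have 3: "s * ln r \<le> s * ln \<kappa> - h * \<nu> N" by (simp add: ln\<kappa>)
    have "s * ln (\<kappa> * \<rho> ^ \<nu> (Suc N)) \<le> s * ln r"
      using r(1) \<kappa> rho_pos s_nonneg by (intro mult_left_mono ln_mono) auto
    then have 4: "s * ln \<kappa> - h * \<nu> (Suc N) \<le> s * ln r" by (simp add: ln\<kappa>)
    have 5: "h * \<nu> (Suc N) = h * \<nu> N + 2 * (h * t) + h * N"
        "h * \<nu> (Suc (Suc N)) = h * \<nu> N + 4 * (h * t) + 2 * (h * N) + h"
      by (simp_all add: \<nu>_Suc algebra_simps)
    have 6: "dev (\<sigma> N @ \<theta>) \<le> a * (real N + 1)"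
      "- (a * (real N + 3)) \<le> dev (\<sigma> (Suc (Suc N)) @ \<theta>)"
    proof -
      have "A * (real N + 1) \<le> a * (real N + 1)" using \<open>A \<le> a\<close> by (intro mult_right_mono) auto
      then show "dev (\<sigma> N @ \<theta>) \<le> a * (real N + 1)" using dev[of N] by linarith
      have "A * (real N + 3) \<le> a * (real N + 3)" using \<open>A \<le> a\<close> by (intro mult_right_mono) auto
      moreover have "\<bar>dev (\<sigma> (Suc (Suc N)) @ \<theta>)\<bar> \<le> A * (real N + 3)"
        using dev[of "Suc (Suc N)"] by (simp add: add_ac)
      ultimately show "- (a * (real N + 3)) \<le> dev (\<sigma> (Suc (Suc N)) @ \<theta>)" by linarith
    qed
    have A'N: "A' * (real N + 1) = A' + (ln C) * N + 3 * (a * N) + 4 * (h * t * N) + 2 * (h * N) + (- (s * ln \<kappa>)) * N"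
      unfolding A'_eq by (simp add: algebra_simps)
    have nn: "0 \<le> ln C * N" "0 \<le> a * N" "0 \<le> h * t * N" "0 \<le> h * N" "0 \<le> (- (s * ln \<kappa>)) * N"
      using parts mult_nonneg_nonneg[OF parts(5), of N] by simp_all
    have aN: "a * (real N + 1) = a * N + a" "a * (real N + 3) = a * N + 3 * a"
      by (simp_all add: algebra_simps)
    show ?thesis
    proof (rule abs_leI)
      show "ln (measure \<mu> {x - r..x + r}) - s * ln r \<le> A' * (real N + 1)"
        using 1 4 5(1) 6(1) aN(1) A'N nn parts A'_eq by linarith
      show "- (ln (measure \<mu> {x - r..x + r}) - s * ln r) \<le> A' * (real N + 1)"
        using 2 3 5(2) 6(2) aN(2) A'N nn parts A'_eq by linarith
    qed
  qed
  show ?thesis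
    unfolding has_local_dim_def
  proof (rule tendstoI)
    fix \<epsilon> :: real assume \<epsilon>: "0 < \<epsilon>"
    define l where "l = - ln \<rho>"
    have l: "0 < l" using ln_rho_neg by (simp add: l_def)
    \<comment> \<open>For \<open>N \<ge> 2\<close> the error is at most
      \<open>3 * A' * (N - 1)\<close> and must stay below
      \<open>\<epsilon> * l * N * (N - 1) / 2\<close>, which amounts to
      \<open>6 * A' < \<epsilon> * l * N\<close>. The index \<open>N2\<close> serves the hypothesis
      \<open>\<rho> ^ N \<le> \<kappa>\<close> of \<open>key\<close>.\<close>
    obtain N1 where N1: "6 * A' / (\<epsilon> * l) < real N1" using reals_Archimedean2 by blast
    obtain N2 where N2: "\<rho> ^ N2 < \<kappa>" using \<kappa>(1) rho_less_1 by (metis real_arch_pow_inv)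
    define N0 where "N0 = max 2 (max N1 N2)"
    have "dist (ln (measure \<mu> {x - r..x + r}) / ln r) s < \<epsilon>" if r: "0 < r" "r < \<kappa> * \<rho> ^ \<nu> N0" for r
    proof -
      have "\<exists>i. \<kappa> * \<rho> ^ \<nu> (N0 + i) \<le> r"
      proof -
        obtain i where i: "\<rho> ^ i < r" using r(1) rho_less_1 by (metis real_arch_pow_inv)
        have "i \<le> \<nu> (N0 + i)"
          by (induction i) (simp_all add: \<nu>_Suc N0_def)
        then have "\<rho> ^ \<nu> (N0 + i) \<le> \<rho> ^ i" using rho_pos rho_less_1 by (intro power_decreasing) auto
        moreover have "\<kappa> * \<rho> ^ \<nu> (N0 + i) \<le> 1 * \<rho> ^ \<nu> (N0 + i)" using \<kappa> rho_pos by (intro mult_right_mono) auto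
        ultimately show ?thesis using i by (intro exI[of _ i]) linarith
      qed
      \<comment> \<open>The least such \<open>j\<close> is positive because \<open>r\<close> lies
        below the scale of \<open>N0\<close>; its predecessor gives the index \<open>N\<close> with
        \<open>r\<close> between two consecutive scales.\<close>
      then obtain j where j: "\<kappa> * \<rho> ^ \<nu> (N0 + j) \<le> r" "\<And>i. i < j \<Longrightarrow> r < \<kappa> * \<rho> ^ \<nu> (N0 + i)"
        using exists_least_iff[of "\<lambda>i. \<kappa> * \<rho> ^ \<nu> (N0 + i) \<le> r"] by (meson not_le)
      have "j \<noteq> 0" using j(1) r(2) by (intro notI) simp
      then obtain i where i: "j = Suc i" by (cases j) auto
      define N where "N = N0 + i"
      have N: "\<kappa> * \<rho> ^ \<nu> (Suc N) \<le> r" "r \<le> \<kappa> * \<rho> ^ \<nu> N" using j(1) j(2)[of i] i by (auto simp: N_def)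
      have "N2 \<le> N" "N1 \<le> N" "2 \<le> N" by (auto simp: N_def N0_def)
      then have "\<rho> ^ N \<le> \<rho> ^ N2" using rho_pos rho_less_1 by (intro power_decreasing) auto
      then have main: "\<bar>ln (measure \<mu> {x - r..x + r}) - s * ln r\<bar> \<le> A' * (real N + 1)"
        using N2 by (intro key N) simp
      have "ln r \<le> ln (\<kappa> * \<rho> ^ \<nu> N)" using N(2) r(1) by (intro ln_mono) auto
      also have "\<dots> \<le> - (l * \<nu> N)" using \<kappa> rho_pos by (simp add: ln_mult ln_realpow l_def)
      finally have "l * \<nu> N \<le> - ln r" by simp
      moreover have "l * (real N * (real N - 1) / 2) \<le> l * \<nu> N" using l \<nu>_ge by (intro mult_left_mono) auto
      ultimately have ln_r: "l * (real N * (real N - 1) / 2) \<le> - ln r" by linarith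
      have "0 < real N - 1" using \<open>2 \<le> N\<close> by simp
      have "6 * A' < \<epsilon> * l * real N"
      proof -
        have "6 * A' / (\<epsilon> * l) < real N" using N1 \<open>N1 \<le> N\<close> by simp
        then show ?thesis using \<epsilon> l by (simp add: pos_divide_less_eq mult.commute)
      qed
      then have "6 * A' * (real N - 1) < \<epsilon> * l * real N * (real N - 1)"
        using \<open>0 < real N - 1\<close> by (intro mult_strict_right_mono)
      moreover have "A' * (real N + 1) \<le> A' * (3 * (real N - 1))"
        using A' \<open>2 \<le> N\<close> by (intro mult_left_mono) auto
      moreover have "A' * (3 * (real N - 1)) = 6 * A' * (real N - 1) / 2"
          "\<epsilon> * (l * (real N * (real N - 1) / 2)) = \<epsilon> * l * real N * (real N - 1) / 2" by simp_all
      ultimately have "A' * (real N + 1) < \<epsilon> * (l * (real N * (real N - 1) / 2))" by linarith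
      also have "\<dots> \<le> \<epsilon> * - ln r" using ln_r \<epsilon> by (intro mult_left_mono) auto
      finally have less: "\<bar>ln (measure \<mu> {x - r..x + r}) - s * ln r\<bar> < \<epsilon> * - ln r" using main by linarith
      have "0 < l * (real N * (real N - 1) / 2)" using l \<open>0 < real N - 1\<close> \<open>2 \<le> N\<close> by simp
      then have neg: "ln r < 0" using ln_r by linarith
      have "ln (measure \<mu> {x - r..x + r}) / ln r - s = (ln (measure \<mu> {x - r..x + r}) - s * ln r) / ln r"
        using neg by (simp add: field_simps)
      then have "dist (ln (measure \<mu> {x - r..x + r}) / ln r) s =
          \<bar>ln (measure \<mu> {x - r..x + r}) - s * ln r\<bar> / - ln r"
        using neg by (simp add: dist_real_def abs_divide)
      also have "\<dots> < \<epsilon>" using less neg by (simp only: pos_divide_less_eq neg_0_less_iff_less)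
      finally show ?thesis .
    qed
    then show "\<forall>\<^sub>F r in at_right 0. dist (ln (measure \<mu> {x - r..x + r}) / ln r) s < \<epsilon>"
      unfolding eventually_at_right_field using \<kappa> rho_pos
      by (intro exI[of _ "\<kappa> * \<rho> ^ \<nu> N0"]) auto
  qed
qed

end

theorem theorem3p18:
  fixes m :: nat and \<rho> :: real and d p :: "nat \<Rightarrow> real"
    and K :: "real set" and \<mu> :: "real measure"
  assumes "m \<ge> 1" and "0 < \<rho>" and "\<rho> < 1"
    and "d 0 = 0" and "strict_mono_on {..m} d"
    and "ifs_attractor m \<rho> d K" and "convex hull K = {0..1}"
    and "\<And>j. j \<le> m \<Longrightarrow> p j > 0" and "(\<Sum>j\<le>m. p j) = 1"
    and "self_similar_measure m \<rho> d p \<mu>"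
    and "ifs_finite_type m \<rho> d"
    and "positive_row_property m \<rho> d K p"
  shows "\<exists>x\<in>K. truly_essential m \<rho> d K x \<and>
           (\<exists>D. has_local_dim \<mu> x D \<and> ereal D = hausdorff_dim K)"
proof -
  interpret finite_type_measure m \<rho> d K p \<mu>
    using assms by unfold_locales
  \<comment> \<open>All points of this cylinder are interior to the essential net interval
    \<open>\<Delta>\<^sub>1\<close>, so starting here secures true essentiality whatever blocks
    follow.\<close>
  obtain \<omega> where \<omega>: "set \<omega> \<subseteq> {..m}" "fst \<Delta>\<^sub>1 < c \<omega>" "c \<omega> + \<rho> ^ length \<omega> < snd \<Delta>\<^sub>1"
    by (rule \<Delta>\<^sub>1_cylinder)
  obtain \<sigma> A where \<sigma>: "\<sigma> 0 = \<omega>" "\<And>N. set (\<sigma> N) \<subseteq> {..m}"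
      "\<And>N. \<exists>\<eta>\<in>W N. \<sigma> (Suc N) = \<sigma> N @ \<theta> @ \<theta> @ \<eta>"
      "\<And>N. \<bar>dev (\<sigma> N @ \<theta>)\<bar> \<le> A * (real N + 1)"
    using ex_block_sequence[OF \<omega>(1)] by blast
  obtain x where x: "x \<in> K" "\<And>N. c (\<sigma> N) \<le> x" "\<And>N. x \<le> c (\<sigma> N) + \<rho> ^ length (\<sigma> N)"
  proof (rule nested_cylinders[of \<sigma>])
    fix N
    obtain \<eta> where \<eta>: "\<eta> \<in> W N" "\<sigma> (Suc N) = \<sigma> N @ \<theta> @ \<theta> @ \<eta>" using \<sigma>(3) by blast
    then show "\<exists>\<eta>. set \<eta> \<subseteq> {..m} \<and> \<sigma> (Suc N) = \<sigma> N @ \<eta>"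
      using set_\<theta> by (intro exI[of _ "\<theta> @ \<theta> @ \<eta>"]) (auto simp: ifs_words_def)
  next
    fix N
    \<comment> \<open>The word \<open>u\<^sub>1\<close> starts with \<open>[0, m]\<close>, so every
      block adds letters, even the first one, whose \<open>\<eta>\<close> is empty.\<close>
    have "2 \<le> length \<theta>" by (simp add: \<theta>_def u\<^sub>1_def)
    show "N \<le> length (\<sigma> N)"
    proof (induction N)
      case (Suc N)
      obtain \<eta> where "\<sigma> (Suc N) = \<sigma> N @ \<theta> @ \<theta> @ \<eta>" using \<sigma>(3) by blast
      then show ?case using Suc \<open>2 \<le> length \<theta>\<close> by simp
    qed simp
  qed (use \<sigma>(2) in auto)
  have "has_local_dim \<mu> x s" by (rule has_local_dim_s[OF \<sigma>(2-4) x(2,3)])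
  moreover have "truly_essential m \<rho> d K x"
    using x(2)[of 0] x(3)[of 0] \<omega> unfolding \<sigma>(1) by (intro truly_essential_in_\<Delta>\<^sub>1 x(1)) auto
  ultimately show ?thesis using x(1) hausdorff_dim_K by auto
qed

end
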